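(* Let $t<n/2$ and let $x_1,\dots,x_F$ be real numbers such that $\sum_{j=1}^F x_j P_{\lambda^{(i)},\rho^{(j)}} = 1$ for $i=1$ and $=\zeta$ for $1<i\le F$. Then the eigenvalue of $\sum_{j=1}^F x_jA_{\rho^{(j)}}$ on $S^{2(n-t,1^t)}$ satisfies \[\eta_{(n-t,1^t)} = \sum_{j=1}^F x_j P_{(n-t,1^t),\rho^{(j)}} = \zeta.\]
   Context: $\mathcal{M}_{2n}$ is the set of perfect matchings of $K_{2n}$. For $m,m'\in\mathcal{M}_{2n}$ the multigraph union $m\cup m'$ is a disjoint union of even cycles (a common edge is a $2$-cycle); listing cycle lengths as $2\rho_1\ge2\rho_2\ge\dots$ gives the cycle type $d(m,m')=\rho\vdash n$. For $\rho\vdash n$ the associate $A_\rho$ is the 0/1 matrix indexed by $\mathcal{M}_{2n}$ with $(A_\rho)_{m,m'}=1$ iff $d(m,m')=\rho$. $\mathbb{R}[\mathcal{M}_{2n}]$ decomposes multiplicity-freely as $\bigoplus_{\lambda\vdash n}S^{2\lambda}$ (irreducible $S_{2n}$-modules indexed by $2\lambda=(2\lambda_1,2\lambda_2,\dots)$), and $P_{\lambda,\rho}$ is the eigenvalue of $A_\rho$ on $S^{2\lambda}$. Partitions of $n$ are ordered reverse-lexicographically ($\mu\le\lambda$ iff $\mu=\lambda$ or $\mu_j<\lambda_j$ at the first differing index $j$); $\lambda\vdash n$ is fat if $\lambda\ge(n-t,1^t)$. $F_t$ is the number of fat partitions of $n$, $F=F_t-1$, and $\lambda^{(1)}>\dots>\lambda^{(F)}$,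 $\rho^{(1)}>\dots>\rho^{(F)}$ both denote the first $F$ partitions of $n$ in reverse-lexicographic order (the fat partitions other than $(n-t,1^t)$). $\zeta=-1/\big((2n-1)(2n-3)\cdots(2n-2t+1)-1\big)$. *)

theory Defs
  imports Complex_Main "HOL-Library.Multiset" "HOL-Library.List_Lexorder" "HOL-Combinatorics.Permutations"
begin

definition matchings :: "nat \<Rightarrow> nat set set set" where
  "matchings n = {m. (\<forall>e\<in>m. card e = 2 \<and> e \<subseteq> {0..<2*n}) \<and>
                     (\<forall>e\<in>m. \<forall>e'\<in>m. e \<noteq> e' \<longrightarrow> e \<inter> e' = {}) \<and>
                     \<Union>m = {0..<2*n}}"

definition union_components :: "nat \<Rightarrow> nat set set \<Rightarrow> nat set set \<Rightarrow> nat set set" where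
  "union_components n m m' =
     (\<lambda>x. {y. (x, y) \<in> {(a, b). {a, b} \<in> m \<union> m'}\<^sup>*}) ` {0..<2*n}"

text \<open>Cycle type: component (= cycle) sizes 2 rho_i, listed as a weakly decreasing
  list rho_1 \<ge> rho_2 \<ge> ... (a common edge is a 2-cycle, i.e. a component of size 2).\<close>
definition cycle_type :: "nat \<Rightarrow> nat set set \<Rightarrow> nat set set \<Rightarrow> nat list" where
  "cycle_type n m m' =
     rev (sorted_list_of_multiset (image_mset (\<lambda>C. card C div 2) (mset_set (union_components n m m'))))"

definition partitions :: "nat \<Rightarrow> nat list set" where
  "partitions n = {l. sorted_wrt (\<ge>) l \<and> 0 \<notin> set l \<and> sum_list l = n}"

text \<open>Reverse-lexicographic order: mu < lambda iff at the first differing index j, mu_j < lambda_j.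
  (This is exactly the order on lists from List_Lexorder, which is used below to sort.)\<close>
definition revlex_less :: "nat list \<Rightarrow> nat list \<Rightarrow> bool" where
  "revlex_less mu la \<longleftrightarrow> (mu, la) \<in> lexord {(a, b). a < b}"

definition hook :: "nat \<Rightarrow> nat \<Rightarrow> nat list" where
  "hook n t = (n - t) # replicate t 1"

text \<open>The fat partitions other than (n-t,1^t), in decreasing order:
  fat_list n t ! (i-1) = lambda^(i) = rho^(i), for 1 \<le> i \<le> F.\<close>
definition fat_list :: "nat \<Rightarrow> nat \<Rightarrow> nat list list" where
  "fat_list n t = rev (sorted_list_of_set {mu \<in> partitions n. revlex_less (hook n t) mu})"

definition double :: "nat list \<Rightarrow> nat list" where
  "double la = map (\<lambda>k. 2 * k) la"

definition cells :: "nat list \<Rightarrow> (nat \<times> nat) set" where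
  "cells mu = {(i, j). i < length mu \<and> j < mu ! i}"

definition tableaux :: "nat list \<Rightarrow> nat \<Rightarrow> (nat \<times> nat \<Rightarrow> nat) set" where
  "tableaux mu N = {T. bij_betw T (cells mu) {0..<N}}"

text \<open>A tabloid is represented by its row function {0..<N} -> rows (0 outside {0..<N}).\<close>
definition tabloid_of :: "nat list \<Rightarrow> nat \<Rightarrow> (nat \<times> nat \<Rightarrow> nat) \<Rightarrow> (nat \<Rightarrow> nat)" where
  "tabloid_of mu N T = (\<lambda>x. if x < N then fst (inv_into (cells mu) T x) else 0)"

definition column_group :: "nat list \<Rightarrow> nat \<Rightarrow> (nat \<times> nat \<Rightarrow> nat) \<Rightarrow> (nat \<Rightarrow> nat) set" where
  "column_group mu N T = {s. s permutes {0..<N} \<and>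
      (\<forall>x\<in>{0..<N}. snd (inv_into (cells mu) T (s x)) = snd (inv_into (cells mu) T x))}"

definition polytabloid :: "nat list \<Rightarrow> nat \<Rightarrow> (nat \<times> nat \<Rightarrow> nat) \<Rightarrow> ((nat \<Rightarrow> nat) \<Rightarrow> real)" where
  "polytabloid mu N T = (\<lambda>r. \<Sum>s\<in>column_group mu N T.
       of_int (sign s) * (if r = tabloid_of mu N (s \<circ> T) then 1 else 0))"

definition lin_span :: "('a \<Rightarrow> real) set \<Rightarrow> ('a \<Rightarrow> real) set" where
  "lin_span G = {u. \<exists>S c. finite S \<and> S \<subseteq> G \<and> u = (\<lambda>a. \<Sum>g\<in>S. c g * g a)}"

definition specht :: "nat list \<Rightarrow> nat \<Rightarrow> ((nat \<Rightarrow> nat) \<Rightarrow> real) set" where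
  "specht mu N = lin_span (polytabloid mu N ` tableaux mu N)"

text \<open>S_N actions: on tabloid functions (s.{T} = {s o T}) and on functions on matchings.\<close>
definition act_tab :: "(nat \<Rightarrow> nat) \<Rightarrow> ((nat \<Rightarrow> nat) \<Rightarrow> real) \<Rightarrow> ((nat \<Rightarrow> nat) \<Rightarrow> real)" where
  "act_tab s u = (\<lambda>r. u (r \<circ> s))"

definition act_match :: "(nat \<Rightarrow> nat) \<Rightarrow> (nat set set \<Rightarrow> real) \<Rightarrow> (nat set set \<Rightarrow> real)" where
  "act_match s f = (\<lambda>m. f ((\<lambda>e. inv s ` e) ` m))"

definition equiv_hom :: "nat \<Rightarrow> nat list \<Rightarrow> (((nat \<Rightarrow> nat) \<Rightarrow> real) \<Rightarrow> (nat set set \<Rightarrow> real)) \<Rightarrow> bool" where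
  "equiv_hom n mu phi \<longleftrightarrow>
     (\<forall>u\<in>specht mu (2*n). \<forall>v\<in>specht mu (2*n). \<forall>a b::real.
         phi (\<lambda>r. a * u r + b * v r) = (\<lambda>m. a * phi u m + b * phi v m)) \<and>
     (\<forall>s u. s permutes {0..<2*n} \<and> u \<in> specht mu (2*n) \<longrightarrow> phi (act_tab s u) = act_match s (phi u)) \<and>
     (\<forall>u\<in>specht mu (2*n). \<forall>m. m \<notin> matchings n \<longrightarrow> phi u m = 0)"

text \<open>The S^mu-isotypic component of R[M_{2n}] (for mu = 2 lambda this is the copy of S^{2 lambda}).\<close>
definition isotypic :: "nat \<Rightarrow> nat list \<Rightarrow> (nat set set \<Rightarrow> real) set" where
  "isotypic n mu = lin_span {phi u | phi u. equiv_hom n mu phi \<and> u \<in> specht mu (2*n)}"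

definition assoc_op :: "nat \<Rightarrow> nat list \<Rightarrow> (nat set set \<Rightarrow> real) \<Rightarrow> (nat set set \<Rightarrow> real)" where
  "assoc_op n rho f = (\<lambda>m. if m \<in> matchings n then
      (\<Sum>m'\<in>matchings n. (if cycle_type n m m' = rho then 1 else 0) * f m') else 0)"

definition P :: "nat \<Rightarrow> nat list \<Rightarrow> nat list \<Rightarrow> real" where
  "P n la rho = (THE c. \<forall>f\<in>isotypic n (double la). assoc_op n rho f = (\<lambda>m. c * f m))"

definition zeta :: "nat \<Rightarrow> nat \<Rightarrow> real" where
  "zeta n t = - 1 / ((\<Prod>k\<in>{1..t}. real (2*n - 2*k + 1)) - 1)"

end

(*
Let U be the indicator of the perfect matchings that contain t fixed disjoint edges, and let
A = sum x_j A_rho(j). Two such matchings share t edges, so their cycle type has t ones and is none of the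
rho(j); hence <A U, U> = 0. Moreover U is fixed by a Young subgroup of shape 2(n-t,1^t), so
its components u_lambda in S^(2 lambda) vanish unless lambda is fat. As A acts on u_lambda by 1 for
lambda = (n), by zeta for the other fat lambda, and by eta on the hook, and as |u_(n)|^2 = |U|^2 / N
with N / |U| = (2n-1)(2n-3)...(2n-2t+1), the value of zeta turns <A U, U> = 0 into
(eta - zeta) |u_hook|^2 = 0, and u_hook is nonzero.

The decomposition of U rests on two facts. Kernels on matchings invariant under the symmetric group
are functions of the cycle type; they are therefore symmetric, which forces S^(2 lambda) to occur at
most once, and they form a space of dimension at most the number of partitions of n. Each
S^(2 lambda) does occur, so the projections to these components already span all invariant kernels,
and the identity is one of them.
*)
theory Submission
  imports Defs
begin

text \<open>\<open>P\<close> is a definite description, so the hypothesis on the \<open>x j\<close>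
  carries information only once every component is known to be nonzero and every associate is known
  to act on it as a scalar. Both facts have to be extracted from the bare definition of Specht
  modules by polytabloids. The tools are real and elementary: the invariant inner product on
  matchings, the column antisymmetrizer, which sends each vector of a Specht module to a multiple of
  one polytabloid, and group averages of rank-one kernels. The indicator U is itself tied to this
  construction. In a tabloid of shape 2(n-t,1^t) the t short rows have two entries each, so a
  matching that stays inside the rows must contain those t pairs as edges and is free on the long
  row. Hence U is the image of such a tabloid, and the generator of the hook component is a signed
  sum of relabelled copies of U; this is why the hook component of U cannot vanish. With D =
  (2n-1)(2n-3)...(2n-2t+1), the constant component carries the fraction 1/D of the squared norm of
  U, and zeta is the number for which 1/D + zeta (1 - 1/D) = 0.\<close>

section \<open>Linear systems and bijections from multisets\<close>

text \<open>Gaussian elimination: an equation with a nonzero coefficient at \<open>k\<close> is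
  solved for the unknown \<open>k\<close>, which is then eliminated from the other equations. It
  serves to force a linear relation among invariant kernels.\<close>

lemma homogeneous_system_nontrivial:
  fixes a :: "'i \<Rightarrow> 'j \<Rightarrow> real"
  assumes "finite I" "finite J" "card I < card J"
  shows "\<exists>c. (\<exists>j\<in>J. c j \<noteq> 0) \<and> (\<forall>i\<in>I. (\<Sum>j\<in>J. a i j * c j) = 0)"
  using assms
proof (induction I arbitrary: J a rule: finite_induct)
  case empty
  then have "J \<noteq> {}" by auto
  then show ?case by (intro exI[of _ "\<lambda>_. 1"]) auto
next
  case (insert i I)
  show ?case
  proof (cases "\<forall>j\<in>J. a i j = 0")
    case True
    then show ?thesis using insert.IH[of J a] insert.prems insert.hyps by auto
  next
    case False
    then obtain k where k: "k \<in> J" "a i k \<noteq> 0" by auto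
    define J' where "J' = J - {k}"
    have J: "J = insert k J'" "k \<notin> J'" "finite J'" using k insert.prems by (auto simp: J'_def)
    have "card I < card J'" using insert.prems insert.hyps J by auto
    then obtain c where c: "\<exists>j\<in>J'. c j \<noteq> 0"
      "\<And>l. l \<in> I \<Longrightarrow> (\<Sum>j\<in>J'. (a l j - a l k * a i j / a i k) * c j) = 0"
      using insert.IH[of J' "\<lambda>l j. a l j - a l k * a i j / a i k"] J by blast
    define s where "s = (\<Sum>j\<in>J'. a i j * c j)"
    define c' where "c' = c(k := - s / a i k)"
    have sum: "(\<Sum>j\<in>J. a l j * c' j) = a l k * (- s / a i k) + (\<Sum>j\<in>J'. a l j * c j)" for l
    proof -
      have "(\<Sum>j\<in>J'. a l j * c' j) = (\<Sum>j\<in>J'. a l j * c j)"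
        using J by (intro sum.cong) (auto simp: c'_def)
      then show ?thesis using J by (simp add: c'_def)
    qed
    have "(\<Sum>j\<in>J. a l j * c' j) = 0" if "l \<in> I" for l
    proof -
      have "(\<Sum>j\<in>J'. (a l j - a l k * a i j / a i k) * c j)
          = (\<Sum>j\<in>J'. a l j * c j) - (a l k / a i k) * s"
        unfolding s_def sum_distrib_left sum_subtractf[symmetric]
        by (intro sum.cong) (auto simp: field_simps)
      then show ?thesis using c(2)[OF that] sum[of l] by simp
    qed
    moreover have "(\<Sum>j\<in>J. a i j * c' j) = 0" using sum[of i] k by (simp add: s_def)
    moreover have "\<exists>j\<in>J. c' j \<noteq> 0" using c(1) J by (auto simp: c'_def)
    ultimately show ?thesis by (intro exI[of _ c']) auto
  qed
qed

text \<open>Turns equality of two cycle types, which are multisets of sizes, into a size-preserving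
  matching-up of the cycles themselves.\<close>

lemma bij_betw_of_image_mset_eq:
  assumes "finite A" "finite B" "image_mset f (mset_set A) = image_mset g (mset_set B)"
  shows "\<exists>h. bij_betw h A B \<and> (\<forall>a\<in>A. g (h a) = f a)"
  using assms
proof (induction A arbitrary: B rule: finite_induct)
  case empty
  then have "B = {}" by (metis finite_set_mset_mset_set image_mset_is_empty_iff mset_set.empty set_mset_empty)
  then show ?case by (auto simp: bij_betw_def)
next
  case (insert a A)
  have "f a \<in># image_mset g (mset_set B)" using insert by (metis finite.insertI image_eqI insertI1 finite_set_mset_mset_set set_image_mset)
  then obtain b where b: "b \<in> B" "g b = f a" using insert.prems(1) by auto
  have "mset_set B = add_mset b (mset_set (B - {b}))"
    using b insert.prems(1) by (metis mset_set.remove)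
  then have "image_mset f (mset_set A) = image_mset g (mset_set (B - {b}))"
    using insert.prems(2) insert.hyps b by simp
  then obtain h where h: "bij_betw h A (B - {b})" "\<forall>a\<in>A. g (h a) = f a"
    using insert.IH[of "B - {b}"] insert.prems(1) by auto
  have "bij_betw (h(a := b)) (insert a A) (insert b (B - {b}))"
  proof -
    have "bij_betw (h(a := b)) A (B - {b})"
      using h(1) insert.hyps by (subst bij_betw_cong[of A _ h]) auto
    moreover have "bij_betw (h(a := b)) {a} {b}" by (simp add: bij_betw_def)
    ultimately have "bij_betw (h(a := b)) ({a} \<union> A) ({b} \<union> (B - {b}))"
      by (intro bij_betw_combine) auto
    then show ?thesis by simp
  qed
  moreover have "insert b (B - {b}) = B" using b by auto
  ultimately have "bij_betw (h(a := b)) (insert a A) B" by metis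
  moreover have "\<forall>c\<in>insert a A. g ((h(a := b)) c) = f c" using h(2) b insert.hyps by auto
  ultimately show ?case by blast
qed

section \<open>Pairs of fixed-point-free involutions and their orbits\<close>

text \<open>Two perfect matchings seen through their partner maps. The cycles of the union are the
  orbits of the dihedral group generated by \<open>f\<close> and \<open>g\<close>; the two may agree
  at a point, which gives a 2-cycle.\<close>

locale involution_pair =
  fixes X :: "'a set" and f g :: "'a \<Rightarrow> 'a"
  assumes fin: "finite X"
    and f_in: "x \<in> X \<Longrightarrow> f x \<in> X" and ff: "x \<in> X \<Longrightarrow> f (f x) = x" and f_neq: "x \<in> X \<Longrightarrow> f x \<noteq> x"
    and g_in: "x \<in> X \<Longrightarrow> g x \<in> X" and gg: "x \<in> X \<Longrightarrow> g (g x) = x" and g_neq: "x \<in> X \<Longrightarrow> g x \<noteq> x"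
begin

definition rot :: "'a \<Rightarrow> 'a" where "rot x = g (f x)"

definition edges :: "('a \<times> 'a) set" where "edges = {(a, b). a \<in> X \<and> (b = f a \<or> b = g a)}"

definition comp :: "'a \<Rightarrow> 'a set" where "comp x = {y. (x, y) \<in> edges\<^sup>*}"

lemma rot_in: "x \<in> X \<Longrightarrow> (rot ^^ k) x \<in> X"
  by (induction k) (auto simp: rot_def f_in g_in)

lemma rot_inj: "x \<in> X \<Longrightarrow> y \<in> X \<Longrightarrow> (rot ^^ k) x = (rot ^^ k) y \<Longrightarrow> x = y"
proof (induction k)
  case (Suc k)
  have "rot ((rot ^^ k) x) = rot ((rot ^^ k) y)" using Suc.prems by simp
  then have "(rot ^^ k) x = (rot ^^ k) y"
    using rot_in[OF Suc.prems(1), of k] rot_in[OF Suc.prems(2), of k]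
      rot_def[of "(rot ^^ k) x"] rot_def[of "(rot ^^ k) y"] by (metis f_in ff gg)
  then show ?case using Suc by blast
qed auto

text \<open>The dihedral relation: conjugation by the reflection \<open>f\<close> inverts the
  rotation \<open>rot\<close>.\<close>

lemma rot_reflect: "x \<in> X \<Longrightarrow> (rot ^^ k) (f ((rot ^^ k) x)) = f x"
proof (induction k)
  case (Suc k)
  let ?y = "(rot ^^ k) x"
  have y: "?y \<in> X" using Suc rot_in by auto
  have "rot (f (rot ?y)) = f ?y" using y by (simp add: rot_def f_in ff gg g_in del: funpow.simps)
  moreover have "(rot ^^ Suc k) (f ((rot ^^ Suc k) x)) = (rot ^^ k) (rot (f (rot ?y)))"
    by (simp add: funpow_swap1)
  ultimately show ?case using Suc by simp
qed auto

text \<open>Halving the exponent by \<open>rot_reflect\<close> moves a coincidence to the middle of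
  the path from \<open>x\<close> to \<open>f x\<close>. There it becomes a fixed point of
  \<open>f\<close> (even exponent) or of \<open>g\<close> (odd exponent). So \<open>x\<close> and
  \<open>f x\<close> lie in different orbits of \<open>rot\<close>, which is why cycles are even and
  alternate.\<close>

lemma f_not_rot: assumes "x \<in> X" shows "f x \<noteq> (rot ^^ k) x"
proof
  assume eq: "f x = (rot ^^ k) x"
  obtain j where j: "k = j + j \<or> k = j + Suc j" by (metis add_Suc_right evenE mult_2 oddE Suc_eq_plus1)
  let ?y = "(rot ^^ j) x"
  have y: "?y \<in> X" using assms rot_in by auto
  have fx: "f x = (rot ^^ j) (f ?y)" using rot_reflect[OF assms] by simp
  from j show False
  proof
    assume "k = j + j"
    then have "(rot ^^ j) (f ?y) = (rot ^^ j) ?y" using eq fx by (simp add: funpow_add)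
    then have "f ?y = ?y" by (rule rot_inj[rotated 2]) (use y f_in in auto)
    then show False using f_neq y by blast
  next
    assume "k = j + Suc j"
    then have "(rot ^^ j) (f ?y) = (rot ^^ j) (rot ?y)" using eq fx by (simp only: funpow_add comp_apply funpow.simps)
    then have "f ?y = rot ?y"
      by (rule rot_inj[rotated 2]) (use y f_in rot_in[of ?y 1] in auto)
    then have "g (f ?y) = f ?y" by (simp only: rot_def[of ?y])
    then show False using g_neq[OF f_in[OF y]] by contradiction
  qed
qed

lemma f_rot_not_rot: assumes "x \<in> X" shows "f ((rot ^^ i) x) \<noteq> (rot ^^ j) x"
proof
  assume "f ((rot ^^ i) x) = (rot ^^ j) x"
  then have "f x = (rot ^^ (i + j)) x" using rot_reflect[OF assms, of i] by (simp add: funpow_add)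
  then show False using f_not_rot assms by blast
qed

lemma rot_periodic: assumes "x \<in> X" shows "\<exists>k>0. (rot ^^ k) x = x"
proof -
  have "\<not> inj (\<lambda>k. (rot ^^ k) x)"
  proof
    assume "inj (\<lambda>k. (rot ^^ k) x)"
    then have "infinite (range (\<lambda>k. (rot ^^ k) x))" using finite_imageD by blast
    moreover have "range (\<lambda>k. (rot ^^ k) x) \<subseteq> X" using rot_in assms by auto
    ultimately show False using fin finite_subset by blast
  qed
  then obtain i j where ij: "i < j" "(rot ^^ i) x = (rot ^^ j) x"
    unfolding inj_def by (metis linorder_neqE_nat)
  then have "(rot ^^ i) x = (rot ^^ i) ((rot ^^ (j - i)) x)"
    by (metis comp_apply funpow_add le_add_diff_inverse less_imp_le)
  then have "(rot ^^ (j - i)) x = x" using rot_inj[of x _ i] rot_in assms by metis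
  then show ?thesis using ij by (intro exI[of _ "j - i"]) auto
qed

definition period :: "'a \<Rightarrow> nat" where "period x = (LEAST k. 0 < k \<and> (rot ^^ k) x = x)"

lemma period: assumes "x \<in> X" shows "0 < period x" "(rot ^^ period x) x = x"
  using LeastI_ex[OF rot_periodic[OF assms, unfolded]] unfolding period_def by auto

lemma rot_mod_period: assumes "x \<in> X" shows "(rot ^^ (k mod period x)) x = (rot ^^ k) x"
  using period(2)[OF assms] by (rule funpow_mod_eq)

lemma rot_eq_iff:
  assumes "x \<in> X"
  shows "(rot ^^ i) x = (rot ^^ j) x \<longleftrightarrow> i mod period x = j mod period x"
proof -
  have *: "\<not> i < j" if "i < period x" "j < period x" "(rot ^^ i) x = (rot ^^ j) x" for i j
  proof
    assume "i < j"
    then have "(rot ^^ i) x = (rot ^^ i) ((rot ^^ (j - i)) x)"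
      using that by (metis comp_apply funpow_add le_add_diff_inverse less_imp_le)
    then have "(rot ^^ (j - i)) x = x" using rot_inj[of x _ i] rot_in assms by metis
    then have "period x \<le> j - i" unfolding period_def using \<open>i < j\<close> by (intro Least_le) auto
    then show False using that \<open>i < j\<close> by auto
  qed
  show ?thesis
    using *[of "i mod period x" "j mod period x"] *[of "j mod period x" "i mod period x"]
      rot_mod_period[OF assms, of i] rot_mod_period[OF assms, of j] period(1)[OF assms]
    by (metis mod_less_divisor linorder_neqE_nat)
qed

lemma comp_in: "x \<in> X \<Longrightarrow> y \<in> comp x \<Longrightarrow> y \<in> X"
  unfolding comp_def
proof (simp, erule rtrancl_induct)
qed (auto simp: edges_def f_in g_in)

lemma comp_refl [simp]: "x \<in> comp x" by (simp add: comp_def)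

lemma edges_sym: "(a, b) \<in> edges \<Longrightarrow> (b, a) \<in> edges"
  by (auto simp: edges_def f_in g_in ff gg)

lemma comp_eq: assumes "y \<in> comp x" shows "comp y = comp x"
proof -
  have "sym (edges\<^sup>*)" by (rule sym_rtrancl) (rule symI, rule edges_sym)
  then have "(y, x) \<in> edges\<^sup>*" "(x, y) \<in> edges\<^sup>*" using assms by (auto simp: comp_def dest: symD)
  then show ?thesis unfolding comp_def by (auto intro: rtrancl_trans)
qed

lemma comp_step: "x \<in> X \<Longrightarrow> y \<in> comp x \<Longrightarrow> f y \<in> comp x" "x \<in> X \<Longrightarrow> y \<in> comp x \<Longrightarrow> g y \<in> comp x"
proof -
  assume "x \<in> X" "y \<in> comp x"
  moreover from this have "y \<in> X" using comp_in by auto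
  ultimately have "(y, f y) \<in> edges" "(y, g y) \<in> edges" "(x, y) \<in> edges\<^sup>*"
    using \<open>y \<in> comp x\<close> by (auto simp: edges_def comp_def)
  then show "f y \<in> comp x" "g y \<in> comp x"
    unfolding comp_def by (auto intro: rtrancl_into_rtrancl)
qed

lemma g_rot: "x \<in> X \<Longrightarrow> g ((rot ^^ Suc k) x) = f ((rot ^^ k) x)"
  using rot_in[of x k] by (simp add: rot_def f_in gg)

lemma comp_cases: assumes "x \<in> X" "y \<in> comp x"
  obtains k where "y = (rot ^^ Suc k) x" | k where "y = f ((rot ^^ k) x)"
proof -
  \<comment> \<open>Exponents matter only modulo the period. Adding one period makes an exponent
    positive, the form in which \<open>g_rot\<close> computes \<open>g\<close>.\<close>
  have shift: "(rot ^^ k) x = (rot ^^ Suc (k + period x - 1)) x" for k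
    using period[OF assms(1)] by (simp add: funpow_add)
  have "(\<exists>k. y = (rot ^^ Suc k) x) \<or> (\<exists>k. y = f ((rot ^^ k) x))"
    using assms(2)[unfolded comp_def mem_Collect_eq]
  proof (induction rule: rtrancl_induct)
    case base
    have "x = (rot ^^ 0) x" by simp
    then show ?case using shift[of 0] by metis
  next
    case (step y z)
    have y: "y \<in> X" using step.hyps by (auto simp: edges_def)
    have fy: "z = f y \<or> z = g y" using step.hyps by (auto simp: edges_def)
    from step.IH show ?case
    proof
      assume "\<exists>k. y = (rot ^^ Suc k) x"
      then obtain k where k: "y = (rot ^^ Suc k) x" by auto
      then have "g y = f ((rot ^^ k) x)" using g_rot assms by auto
      then show ?thesis using fy k by blast
    next
      assume "\<exists>k. y = f ((rot ^^ k) x)"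
      then obtain k where k: "y = f ((rot ^^ k) x)" by auto
      then have "g y = (rot ^^ Suc k) x" by (simp add: rot_def)
      moreover have "f y = (rot ^^ k) x" using k ff rot_in assms by auto
      ultimately show ?thesis using fy shift[of k] by metis
    qed
  qed
  then show ?thesis using that by blast
qed

lemma rot_in_comp: assumes "x \<in> X" shows "(rot ^^ k) x \<in> comp x"
  by (induction k) (auto simp: rot_def intro!: comp_step assms)

text \<open>A cycle is the disjoint union of the \<open>rot\<close>-orbit of \<open>x\<close> and
  the mirror image of that orbit under \<open>f\<close>, each with \<open>period x\<close>
  elements.\<close>

lemma card_comp: assumes "x \<in> X" shows "card (comp x) = 2 * period x"
proof -
  let ?A = "(\<lambda>k. (rot ^^ k) x) ` {..<period x}"
  have C: "comp x = ?A \<union> f ` ?A"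
  proof
    show "comp x \<subseteq> ?A \<union> f ` ?A"
    proof
      fix y assume "y \<in> comp x"
      have *: "(rot ^^ k) x \<in> ?A" for k
        using rot_mod_period[OF assms, of k] period(1)[OF assms]
        by (intro image_eqI[of _ _ "k mod period x"]) auto
      show "y \<in> ?A \<union> f ` ?A" using comp_cases[OF assms \<open>y \<in> comp x\<close>] * by (metis UnCI imageI)
    qed
    show "?A \<union> f ` ?A \<subseteq> comp x" using rot_in_comp comp_step(1) assms by auto
  qed
  have cA: "card ?A = period x"
    by (subst card_image) (auto simp: inj_on_def rot_eq_iff[OF assms])
  have "?A \<subseteq> X" using rot_in assms by auto
  then have "inj_on f ?A" by (intro inj_on_inverseI[of _ f]) (auto simp: ff)
  then have "card (f ` ?A) = period x" using cA card_image by metis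
  moreover have "?A \<inter> f ` ?A = {}" using f_rot_not_rot[OF assms] by (force dest: sym)
  ultimately show ?thesis unfolding C using cA by (subst card_Un_disjoint) auto
qed

lemma Union_comp: "\<Union> (comp ` X) = X" using comp_in comp_refl by blast

lemma comp_disjoint: "C \<in> comp ` X \<Longrightarrow> D \<in> comp ` X \<Longrightarrow> C \<noteq> D \<Longrightarrow> C \<inter> D = {}"
  using comp_eq by blast

lemma finite_comp: "x \<in> X \<Longrightarrow> finite (comp x)"
  using comp_in fin finite_subset by (metis subsetI)

end

text \<open>The size of a cycle determines its period, and then any choice of base points
  \<open>x\<close>, \<open>y\<close> extends to an isomorphism by following the same words in the
  two involutions.\<close>

lemma component_isomorphism:
  assumes "involution_pair X f g" "involution_pair Y f' g'" "x \<in> X" "y \<in> Y"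
    and card: "card (involution_pair.comp X f g x) = card (involution_pair.comp Y f' g' y)"
  shows "\<exists>h. bij_betw h (involution_pair.comp X f g x) (involution_pair.comp Y f' g' y) \<and>
     (\<forall>z\<in>involution_pair.comp X f g x. h (f z) = f' (h z) \<and> h (g z) = g' (h z))"
proof -
  interpret A: involution_pair X f g by fact
  interpret B: involution_pair Y f' g' by fact
  \<comment> \<open>The two cases exclude each other by \<open>f_rot_not_rot\<close>. The chosen
    exponent is ambiguous only modulo the period, which is the same on both sides.\<close>
  define h where "h z = (if \<exists>k. z = (A.rot ^^ k) x then (B.rot ^^ (SOME k. z = (A.rot ^^ k) x)) y
     else f' ((B.rot ^^ (SOME k. z = f ((A.rot ^^ k) x))) y))" for z
  have per: "A.period x = B.period y"
    using card A.card_comp[OF assms(3)] B.card_comp[OF assms(4)] by simp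
  have h1: "h ((A.rot ^^ k) x) = (B.rot ^^ k) y" for k
  proof -
    have "(A.rot ^^ k) x = (A.rot ^^ (SOME l. (A.rot ^^ k) x = (A.rot ^^ l) x)) x"
      by (rule someI_ex) auto
    then have "(B.rot ^^ (SOME l. (A.rot ^^ k) x = (A.rot ^^ l) x)) y = (B.rot ^^ k) y"
      unfolding A.rot_eq_iff[OF assms(3)] B.rot_eq_iff[OF assms(4)] per by simp
    moreover have "\<exists>l. (A.rot ^^ k) x = (A.rot ^^ l) x" by auto
    ultimately show ?thesis unfolding h_def by (simp only: if_True)
  qed
  have finj: "f ((A.rot ^^ k) x) = f ((A.rot ^^ l) x) \<longleftrightarrow> (A.rot ^^ k) x = (A.rot ^^ l) x" for k l
    using A.ff A.rot_in assms(3) by metis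
  have h2: "h (f ((A.rot ^^ k) x)) = f' ((B.rot ^^ k) y)" for k
  proof -
    have "f ((A.rot ^^ k) x) = f ((A.rot ^^ (SOME l. f ((A.rot ^^ k) x) = f ((A.rot ^^ l) x))) x)"
      by (rule someI_ex) auto
    then have "(B.rot ^^ (SOME l. f ((A.rot ^^ k) x) = f ((A.rot ^^ l) x))) y = (B.rot ^^ k) y"
      unfolding finj A.rot_eq_iff[OF assms(3)] B.rot_eq_iff[OF assms(4)] per by simp
    moreover have "\<not> (\<exists>l. f ((A.rot ^^ k) x) = (A.rot ^^ l) x)" using A.f_rot_not_rot assms(3) by blast
    ultimately show ?thesis unfolding h_def by (simp only: if_False)
  qed
  have h: "h (f z) = f' (h z) \<and> h (g z) = g' (h z) \<and> h z \<in> B.comp y" if "z \<in> A.comp x" for z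
    using assms(3) that
  proof (cases rule: A.comp_cases)
    case (1 k)
    have "g z = f ((A.rot ^^ k) x)" using 1 A.g_rot assms(3) by metis
    then have "h (g z) = f' ((B.rot ^^ k) y)" using h2 by metis
    also have "\<dots> = g' ((B.rot ^^ Suc k) y)" using B.g_rot assms(4) by metis
    finally have "h (g z) = g' (h z)" using h1 1 by metis
    then show ?thesis using h1 h2 1 B.rot_in_comp assms(4) by metis
  next
    case (2 k)
    have "g z = (A.rot ^^ Suc k) x" using 2 by (simp add: A.rot_def)
    then have "h (g z) = (B.rot ^^ Suc k) y" using h1 by metis
    also have "\<dots> = g' (f' ((B.rot ^^ k) y))" by (simp add: B.rot_def)
    finally have "h (g z) = g' (h z)" using h2 2 by metis
    moreover have "f z = (A.rot ^^ k) x" using A.ff 2 A.rot_in assms(3) by metis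
    moreover have "f' (f' ((B.rot ^^ k) y)) = (B.rot ^^ k) y" using B.ff B.rot_in assms(4) by metis
    ultimately show ?thesis using h1 h2 2 B.rot_in_comp B.comp_step assms(4) by metis
  qed
  have "B.comp y \<subseteq> h ` A.comp x"
  proof
    fix w assume w: "w \<in> B.comp y"
    show "w \<in> h ` A.comp x" using assms(4) w
    proof (cases rule: B.comp_cases)
      case (1 k)
      then show ?thesis using h1 A.rot_in_comp assms(3) by (metis image_eqI)
    next
      case (2 k)
      then show ?thesis using h2 A.rot_in_comp A.comp_step assms(3) by (metis image_eqI)
    qed
  qed
  then have "h ` A.comp x = B.comp y" using h by blast
  moreover from this have "inj_on h (A.comp x)"
    using card A.finite_comp assms(3) by (intro eq_card_imp_inj_on) auto
  ultimately show ?thesis using h by (auto simp: bij_betw_def)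
qed

text \<open>The isomorphisms of paired cycles are glued; they fit together because cycles partition
  the set and are closed under both involutions.\<close>

lemma involution_pair_isomorphism:
  assumes "involution_pair X f g" "involution_pair Y f' g'"
    and mset: "image_mset card (mset_set (involution_pair.comp X f g ` X))
      = image_mset card (mset_set (involution_pair.comp Y f' g' ` Y))"
  shows "\<exists>h. bij_betw h X Y \<and> (\<forall>z\<in>X. h (f z) = f' (h z) \<and> h (g z) = g' (h z))"
proof -
  interpret A: involution_pair X f g by fact
  interpret B: involution_pair Y f' g' by fact
  obtain H where H: "bij_betw H (A.comp ` X) (B.comp ` Y)" "\<And>C. C \<in> A.comp ` X \<Longrightarrow> card (H C) = card C"
    using bij_betw_of_image_mset_eq[OF _ _ mset] A.fin B.fin by auto
  have "\<exists>h. bij_betw h C (H C) \<and> (\<forall>z\<in>C. h (f z) = f' (h z) \<and> h (g z) = g' (h z))"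
    if C: "C \<in> A.comp ` X" for C
  proof -
    obtain x where x: "x \<in> X" "C = A.comp x" using C by auto
    have "H C \<in> B.comp ` Y" using H(1) C by (auto simp: bij_betw_def)
    then obtain y where y: "y \<in> Y" "H C = B.comp y" by auto
    show ?thesis using component_isomorphism[OF assms(1,2) x(1) y(1)] H(2)[OF C] x(2) y(2) by simp
  qed
  then obtain k where k: "\<And>C. C \<in> A.comp ` X \<Longrightarrow> bij_betw (k C) C (H C)"
      "\<And>C z. C \<in> A.comp ` X \<Longrightarrow> z \<in> C \<Longrightarrow> k C (f z) = f' (k C z) \<and> k C (g z) = g' (k C z)"
    by metis
  define h where "h z = k (A.comp z) z" for z
  have hin: "h z \<in> H (A.comp z)" if "z \<in> X" for z
    unfolding h_def using k(1)[of "A.comp z"] that A.comp_refl by (auto simp: bij_betw_def)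
  have inj: "inj_on h X"
  proof (rule inj_onI)
    fix z w assume zw: "z \<in> X" "w \<in> X" "h z = h w"
    have "H (A.comp z) \<in> B.comp ` Y" "H (A.comp w) \<in> B.comp ` Y"
      using zw H(1) by (auto simp: bij_betw_def)
    then have "H (A.comp z) = H (A.comp w)"
      using B.comp_disjoint[of "H (A.comp z)" "H (A.comp w)"] hin[of z] hin[of w] zw by auto
    then have e: "A.comp z = A.comp w" using H(1) zw by (auto simp: bij_betw_def inj_on_def)
    then have "z \<in> A.comp w" "w \<in> A.comp w" using A.comp_refl by blast+
    then show "z = w" using k(1)[of "A.comp w"] zw e by (auto simp: bij_betw_def inj_on_def h_def)
  qed
  have "h ` X = Y"
  proof
    show "h ` X \<subseteq> Y"
    proof
      fix y assume "y \<in> h ` X"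
      then obtain x where x: "x \<in> X" "y = h x" by auto
      then have "H (A.comp x) \<in> B.comp ` Y" using H(1) by (auto simp: bij_betw_def)
      then show "y \<in> Y" using hin[OF x(1)] x(2) B.Union_comp by blast
    qed
    show "Y \<subseteq> h ` X"
    proof
      fix y assume "y \<in> Y"
      then have "B.comp y \<in> H ` (A.comp ` X)" using H(1) by (auto simp: bij_betw_def)
      then obtain x where x: "x \<in> X" "H (A.comp x) = B.comp y" by auto
      then have "y \<in> k (A.comp x) ` A.comp x" using k(1)[of "A.comp x"] B.comp_refl by (auto simp: bij_betw_def)
      then obtain z where z: "z \<in> A.comp x" "y = k (A.comp x) z" by auto
      then have "z \<in> X" "y = h z" using A.comp_in x(1) A.comp_eq[OF z(1)] by (auto simp: h_def)
      then show "y \<in> h ` X" by auto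
    qed
  qed
  moreover have "h (f z) = f' (h z) \<and> h (g z) = g' (h z)" if "z \<in> X" for z
  proof -
    have "A.comp (f z) = A.comp z" "A.comp (g z) = A.comp z"
      using A.comp_eq A.comp_step that A.comp_refl by metis+
    then show ?thesis using k(2)[of "A.comp z" z] that A.comp_refl by (simp add: h_def)
  qed
  ultimately show ?thesis using inj by (auto simp: bij_betw_def)
qed

section \<open>Perfect matchings and cycle types\<close>

definition relabel :: "(nat \<Rightarrow> nat) \<Rightarrow> nat set set \<Rightarrow> nat set set" where
  "relabel s m = (\<lambda>e. s ` e) ` m"

lemma act_match_relabel: "act_match s f = (\<lambda>m. f (relabel (inv s) m))"
  by (simp add: act_match_def relabel_def)

lemma relabel_comp: "relabel s (relabel s' m) = relabel (s \<circ> s') m"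
  by (auto simp: relabel_def image_image image_comp)

lemma relabel_id [simp]: "relabel id m = m" by (simp add: relabel_def)

lemma relabel_inv:
  assumes "s permutes X" shows "relabel (inv s) (relabel s m) = m" "relabel s (relabel (inv s) m) = m"
  using assms by (simp_all add: relabel_comp permutes_inv_o)

lemma edge_relabel:
  assumes "s permutes X" shows "{s a, s b} \<in> relabel s m \<longleftrightarrow> {a, b} \<in> m"
proof -
  have "s ` e = s ` e' \<longleftrightarrow> e = e'" for e e' using permutes_inj[OF assms] by (simp add: inj_image_eq_iff)
  moreover have "{s a, s b} = s ` {a, b}" by simp
  ultimately show ?thesis unfolding relabel_def by (metis (no_types, lifting) image_iff)
qed

lemma finite_matchings: "finite (matchings n)"
  by (rule finite_subset[of _ "Pow (Pow {0..<2*n})"]) (auto simp: matchings_def)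

lemma matching_disjoint: "m \<in> matchings n \<Longrightarrow> e \<in> m \<Longrightarrow> e' \<in> m \<Longrightarrow> e \<noteq> e' \<Longrightarrow> e \<inter> e' = {}"
  unfolding matchings_def mem_Collect_eq by blast

lemma relabel_matchings:
  assumes "s permutes {0..<2*n}" "m \<in> matchings n" shows "relabel s m \<in> matchings n"
proof -
  have inj: "inj s" using permutes_inj[OF assms(1)] .
  have "s ` e \<inter> s ` e' = {}" if "e \<in> m" "e' \<in> m" "s ` e \<noteq> s ` e'" for e e'
  proof -
    have "e \<inter> e' = {}" using matching_disjoint[OF assms(2)] that by metis
    then show ?thesis using image_Int[OF inj, of e e'] by simp
  qed
  moreover have "card (s ` e) = 2 \<and> s ` e \<subseteq> {0..<2*n}" if "e \<in> m" for e
  proof -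
    have "card e = 2" "e \<subseteq> {0..<2*n}" using assms(2) that by (auto simp: matchings_def)
    then show ?thesis using image_mono[of e "{0..<2*n}" s] permutes_image[OF assms(1)]
      by (simp add: card_image inj_on_subset[OF inj])
  qed
  moreover have "\<Union> (relabel s m) = {0..<2*n}"
  proof -
    have "\<Union> (relabel s m) = s ` \<Union> m" by (auto simp: relabel_def)
    then show ?thesis using assms(2) permutes_image[OF assms(1)] by (simp add: matchings_def)
  qed
  ultimately show ?thesis unfolding matchings_def relabel_def by blast
qed

lemma relabel_matchings_iff:
  assumes "s permutes {0..<2*n}" shows "relabel s m \<in> matchings n \<longleftrightarrow> m \<in> matchings n"
  using relabel_matchings[OF assms] relabel_matchings[OF permutes_inv[OF assms]] relabel_inv[OF assms]
  by metis

lemma bij_betw_relabel: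
  assumes "s permutes {0..<2*n}" shows "bij_betw (relabel s) (matchings n) (matchings n)"
  by (rule bij_betw_byWitness[where f'="relabel (inv s)"])
    (auto simp: relabel_inv[OF assms] relabel_matchings assms permutes_inv)

lemma matchingsD:
  assumes "m \<in> matchings n" "{x, y} \<in> m" shows "x < 2*n" "y < 2*n" "x \<noteq> y"
  using assms by (force simp: matchings_def)+

lemma matching_unique:
  assumes "m \<in> matchings n" "{x, y} \<in> m" "{x, z} \<in> m" shows "y = z"
proof -
  have "{x, y} \<inter> {x, z} = {}" if "{x, y} \<noteq> {x, z}" using assms that matching_disjoint by metis
  then have "{x, y} = {x, z}" by blast
  then show ?thesis by (metis doubleton_eq_iff)
qed

lemma matching_edge_cases:
  assumes "m \<in> matchings n" "e \<in> m" obtains x y where "e = {x, y}" "x \<noteq> y" "x < 2*n" "y < 2*n"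
proof -
  have "card e = 2" "e \<subseteq> {0..<2*n}" using assms by (auto simp: matchings_def)
  then show ?thesis using that by (auto simp: card_2_iff)
qed

definition partner :: "nat set set \<Rightarrow> nat \<Rightarrow> nat" where "partner m x = (THE y. {x, y} \<in> m)"

lemma partner_iff:
  assumes "m \<in> matchings n" "x < 2*n" shows "{x, y} \<in> m \<longleftrightarrow> y = partner m x"
proof -
  have "x \<in> \<Union> m" using assms by (auto simp: matchings_def)
  then obtain e where e: "e \<in> m" "x \<in> e" by auto
  obtain a b where "e = {a, b}" using matching_edge_cases[OF assms(1) e(1)] by metis
  then have "\<exists>z. {x, z} \<in> m" using e by (auto simp: insert_commute)
  then obtain z where z: "{x, z} \<in> m" ..
  then have "partner m x = z" unfolding partner_def
    using matching_unique[OF assms(1)] by (intro the_equality) auto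
  then show ?thesis using z matching_unique[OF assms(1)] by auto
qed

lemma partner_edge: "m \<in> matchings n \<Longrightarrow> x < 2*n \<Longrightarrow> {x, partner m x} \<in> m"
  using partner_iff by auto

lemma partner_partner: "m \<in> matchings n \<Longrightarrow> x < 2*n \<Longrightarrow> partner m (partner m x) = x"
  using partner_iff partner_edge matchingsD by (metis insert_commute)

lemma matching_eq_edges: "m \<in> matchings n \<Longrightarrow> m = (\<lambda>x. {x, partner m x}) ` {0..<2*n}"
proof (intro equalityI subsetI)
  fix e assume m: "m \<in> matchings n" and e: "e \<in> m"
  obtain x y where "e = {x, y}" "x < 2*n" using matching_edge_cases[OF m e] by metis
  then show "e \<in> (\<lambda>x. {x, partner m x}) ` {0..<2*n}" using e partner_iff[OF m] by auto
qed (auto simp: partner_edge)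

lemma involution_pair_partner:
  assumes "m \<in> matchings n" "m' \<in> matchings n"
  shows "involution_pair {0..<2*n} (partner m) (partner m')"
proof
  fix x assume "x \<in> {0..<2*n}"
  then have x: "x < 2*n" by simp
  note D = matchingsD[OF assms(1) partner_edge[OF assms(1) x]] matchingsD[OF assms(2) partner_edge[OF assms(2) x]]
  show "partner m x \<in> {0..<2*n}" "partner m' x \<in> {0..<2*n}" "partner m x \<noteq> x" "partner m' x \<noteq> x"
    using D by auto
  show "partner m (partner m x) = x" "partner m' (partner m' x) = x"
    using x partner_partner assms by blast+
qed simp

lemma union_components_comp:
  assumes "m \<in> matchings n" "m' \<in> matchings n"
  shows "union_components n m m' = involution_pair.comp {0..<2*n} (partner m) (partner m') ` {0..<2*n}"
proof -
  interpret A: involution_pair "{0..<2*n}" "partner m" "partner m'"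
    using involution_pair_partner[OF assms] .
  have "{(a, b). {a, b} \<in> m \<union> m'} = A.edges"
  proof -
    have "{a, b} \<in> m \<union> m' \<longleftrightarrow> a \<in> {0..<2*n} \<and> (b = partner m a \<or> b = partner m' a)" for a b
    proof (cases "a < 2*n")
      case True
      then show ?thesis using partner_iff[OF assms(1) True] partner_iff[OF assms(2) True] by simp
    next
      case False
      then show ?thesis using matchingsD(1)[OF assms(1)] matchingsD(1)[OF assms(2)] by (metis UnE atLeastLessThan_iff)
    qed
    then show ?thesis unfolding A.edges_def by blast
  qed
  then show ?thesis by (simp add: union_components_def A.comp_def)
qed

lemma union_components_card:
  assumes "m \<in> matchings n" "m' \<in> matchings n" "C \<in> union_components n m m'"
  shows "even (card C)" "card C \<noteq> 0"
proof -
  interpret A: involution_pair "{0..<2*n}" "partner m" "partner m'"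
    using involution_pair_partner[OF assms(1,2)] .
  show "even (card C)" "card C \<noteq> 0"
    using assms(3) A.card_comp A.period(1) by (auto simp: union_components_comp[OF assms(1,2)])
qed

lemma finite_union_components: "finite (union_components n m m')"
  by (simp add: union_components_def)

lemma mset_cycle_type: "mset (cycle_type n m m') = image_mset (\<lambda>C. card C div 2) (mset_set (union_components n m m'))"
  by (simp add: cycle_type_def)

lemma cycle_type_commute: "cycle_type n m m' = cycle_type n m' m"
  by (simp add: cycle_type_def union_components_def Un_commute)

lemma cycle_type_partitions:
  assumes "m \<in> matchings n" "m' \<in> matchings n" shows "cycle_type n m m' \<in> partitions n"
proof -
  interpret A: involution_pair "{0..<2*n}" "partner m" "partner m'"
    using involution_pair_partner[OF assms] .
  let ?U = "union_components n m m'"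
  have U: "?U = A.comp ` {0..<2*n}" using union_components_comp[OF assms] .
  have "2 * sum_list (cycle_type n m m') = 2 * sum_mset (mset (cycle_type n m m'))"
    by (simp only: sum_mset_sum_list)
  also have "\<dots> = 2 * (\<Sum>C\<in>?U. card C div 2)"
    by (simp only: mset_cycle_type sum_unfold_sum_mset)
  also have "\<dots> = (\<Sum>C\<in>?U. card C)"
    using union_components_card[OF assms] by (simp add: sum_distrib_left)
  also have "\<dots> = card (\<Union> ?U)"
    using A.comp_disjoint A.finite_comp unfolding U
    by (subst card_Union_disjoint) (auto simp: pairwise_def disjnt_def)
  also have "\<dots> = 2 * n" using A.Union_comp U by simp
  finally have "sum_list (cycle_type n m m') = n" by simp
  moreover have "0 \<notin> set (cycle_type n m m')"
  proof
    assume "0 \<in> set (cycle_type n m m')"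
    then have "0 \<in># mset (cycle_type n m m')" by simp
    then obtain C where "C \<in> ?U" "card C div 2 = 0"
      unfolding mset_cycle_type using finite_union_components by auto
    then show False using union_components_card[OF assms] by (metis dvd_div_eq_0_iff)
  qed
  moreover have "sorted_wrt (\<ge>) (cycle_type n m m')"
    by (simp add: cycle_type_def sorted_wrt_rev)
  ultimately show ?thesis by (simp add: partitions_def)
qed

definition union_edges :: "nat set set \<Rightarrow> nat set set \<Rightarrow> (nat \<times> nat) set" where
  "union_edges m m' = {(a, b). {a, b} \<in> m \<union> m'}"

lemma union_edges_rtrancl_relabel:
  assumes "s permutes X" "(a, b) \<in> (union_edges m m')\<^sup>*"
  shows "(s a, s b) \<in> (union_edges (relabel s m) (relabel s m'))\<^sup>*"
  using assms(2)
proof (induction rule: rtrancl_induct)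
  case (step y z)
  then have "(s y, s z) \<in> union_edges (relabel s m) (relabel s m')"
    using edge_relabel[OF assms(1)] by (auto simp: union_edges_def)
  with step.IH show ?case by (rule rtrancl_into_rtrancl)
qed auto

lemma union_components_relabel:
  assumes "s permutes {0..<2*n}"
  shows "union_components n (relabel s m) (relabel s m') = (`) s ` union_components n m m'"
proof -
  have *: "{y. (s x, y) \<in> (union_edges (relabel s m) (relabel s m'))\<^sup>*}
      = s ` {y. (x, y) \<in> (union_edges m m')\<^sup>*}" for x
  proof (intro equalityI subsetI)
    fix y assume "y \<in> {y. (s x, y) \<in> (union_edges (relabel s m) (relabel s m'))\<^sup>*}"
    then have "(inv s (s x), inv s y) \<in> (union_edges m m')\<^sup>*"
      using union_edges_rtrancl_relabel[OF permutes_inv[OF assms], of "s x" y "relabel s m" "relabel s m'"]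
      by (simp add: relabel_inv[OF assms])
    then have "(x, inv s y) \<in> (union_edges m m')\<^sup>*" by (simp add: permutes_inverses[OF assms])
    moreover have "y = s (inv s y)" by (simp add: permutes_inverses[OF assms])
    ultimately show "y \<in> s ` {y. (x, y) \<in> (union_edges m m')\<^sup>*}" by blast
  qed (auto intro: union_edges_rtrancl_relabel[OF assms])
  have "union_components n (relabel s m) (relabel s m')
      = (\<lambda>x. {y. (x, y) \<in> (union_edges (relabel s m) (relabel s m'))\<^sup>*}) ` (s ` {0..<2*n})"
    unfolding union_components_def union_edges_def permutes_image[OF assms] ..
  also have "\<dots> = (`) s ` union_components n m m'"
    unfolding image_image * unfolding union_components_def union_edges_def image_image ..
  finally show ?thesis .
qed

lemma cycle_type_relabel:
  assumes "s permutes {0..<2*n}"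
  shows "cycle_type n (relabel s m) (relabel s m') = cycle_type n m m'"
proof -
  have inj: "inj s" using permutes_inj[OF assms] .
  have "inj ((`) s)" using inj by (simp add: inj_def inj_image_eq_iff)
  then have "mset_set (union_components n (relabel s m) (relabel s m'))
      = image_mset ((`) s) (mset_set (union_components n m m'))"
    unfolding union_components_relabel[OF assms]
    by (intro image_mset_mset_set[symmetric]) (auto intro: inj_on_subset)
  moreover have "card (s ` C) = card C" for C using inj by (simp add: card_image inj_on_subset)
  ultimately show ?thesis by (simp add: cycle_type_def multiset.map_comp comp_def)
qed

text \<open>The cycle type is a complete invariant of a pair of matchings up to relabelling: a
  bijection that commutes with both partner maps carries both edge sets. This makes invariant
  kernels functions of the cycle type.\<close>

lemma same_cycle_type_conjugate:
  assumes M: "m \<in> matchings n" "m' \<in> matchings n" "k \<in> matchings n" "k' \<in> matchings n"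
    and eq: "cycle_type n m m' = cycle_type n k k'"
  shows "\<exists>s. s permutes {0..<2*n} \<and> relabel s m = k \<and> relabel s m' = k'"
proof -
  let ?X = "{0..<2*n}"
  have card: "image_mset card (mset_set (union_components n m m'))
      = image_mset ((*) 2) (mset (cycle_type n m m'))"
    if "m \<in> matchings n" "m' \<in> matchings n" for m m'
    unfolding mset_cycle_type multiset.map_comp comp_def
    using union_components_card(1)[OF that] by (intro image_mset_cong) (auto simp: finite_union_components)
  have "image_mset card (mset_set (union_components n m m'))
      = image_mset card (mset_set (union_components n k k'))"
    using card[OF M(1,2)] card[OF M(3,4)] eq by simp
  then obtain h where h: "bij_betw h ?X ?X"
      "\<And>z. z \<in> ?X \<Longrightarrow> h (partner m z) = partner k (h z)"
      "\<And>z. z \<in> ?X \<Longrightarrow> h (partner m' z) = partner k' (h z)"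
    using involution_pair_isomorphism[OF involution_pair_partner[OF M(1,2)] involution_pair_partner[OF M(3,4)]]
    unfolding union_components_comp[OF M(1,2)] union_components_comp[OF M(3,4)] by blast
  define s where "s x = (if x \<in> ?X then h x else x)" for x
  have "bij_betw s ?X ?X" using h(1) by (subst bij_betw_cong[of ?X s h]) (auto simp: s_def)
  then have s: "s permutes ?X" by (intro bij_imp_permutes) (auto simp: s_def)
  have "relabel s p = q" if "p \<in> matchings n" "q \<in> matchings n"
     "\<And>z. z \<in> ?X \<Longrightarrow> h (partner p z) = partner q (h z)" for p q
  proof -
    have "relabel s p = (\<lambda>x. {s x, s (partner p x)}) ` ?X"
      by (subst matching_eq_edges[OF that(1)]) (simp add: relabel_def image_image)
    also have "\<dots> = (\<lambda>x. {s x, partner q (s x)}) ` ?X"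
    proof (intro image_cong refl)
      fix x assume x: "x \<in> ?X"
      then have "partner p x \<in> ?X" using matchingsD[OF that(1) partner_edge[OF that(1)]] by auto
      then show "{s x, s (partner p x)} = {s x, partner q (s x)}" using x that(3) by (simp add: s_def)
    qed
    also have "\<dots> = (\<lambda>y. {y, partner q y}) ` (s ` ?X)" by (simp only: image_image)
    also have "\<dots> = q" unfolding permutes_image[OF s] using matching_eq_edges[OF that(2)] by simp
    finally show ?thesis .
  qed
  then show ?thesis using s M h by blast
qed

section \<open>Counting matchings through fixed edges\<close>

definition edge_blocks :: "nat \<Rightarrow> nat set set" where
  "edge_blocks k = (\<lambda>i. {2*i, 2*i+1}) ` {..<k}"

definition extensions :: "nat \<Rightarrow> nat \<Rightarrow> nat set set set" where
  "extensions n k = {m \<in> matchings n. edge_blocks k \<subseteq> m}"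

text \<open>The matchings are sorted by the partner \<open>y\<close> of the vertex
  \<open>2*k\<close>. The earlier vertices are used up by the blocks, which leaves
  \<open>2*n - 2*k - 1\<close> values of \<open>y\<close>, and the transposition of \<open>y\<close>
  with \<open>2*k+1\<close> identifies each class with the extensions by one more block.\<close>

lemma card_extensions_Suc:
  assumes "k < n" shows "card (extensions n k) = (2*n - 2*k - 1) * card (extensions n (Suc k))"
proof -
  let ?Y = "{2*k+1..<2*n}"
  define F where "F y = {m \<in> extensions n k. {2*k, y} \<in> m}" for y
  have "extensions n k = (\<Union>y\<in>?Y. F y)"
  proof (intro equalityI subsetI)
    fix m assume m: "m \<in> extensions n k"
    then have mm: "m \<in> matchings n" by (auto simp: extensions_def)
    define y where "y = partner m (2*k)"
    have y: "{2*k, y} \<in> m" using partner_edge[OF mm] assms by (simp add: y_def)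
    have "\<not> y < 2*k"
    proof
      assume "y < 2*k"
      then have "{2*(y div 2), 2*(y div 2)+1} \<in> edge_blocks k"
        unfolding edge_blocks_def by (intro image_eqI[of _ _ "y div 2"]) auto
      then have "{2*(y div 2), 2*(y div 2)+1} \<in> m" using m by (auto simp: extensions_def)
      then have e: "{y, if even y then y + 1 else y - 1} \<in> m"
        by (cases "even y") (auto elim!: evenE oddE simp: insert_commute)
      have "{y, 2*k} \<in> m" using y by (simp add: insert_commute)
      then have "2*k = (if even y then y + 1 else y - 1)" using matching_unique[OF mm e] by simp
      then show False using \<open>y < 2*k\<close> by (cases "even y") (simp, presburger, simp)
    qed
    moreover have "y \<noteq> 2*k" "y < 2*n" using matchingsD[OF mm y] by auto
    ultimately show "m \<in> (\<Union>y\<in>?Y. F y)" using m y by (auto simp: F_def intro!: bexI[of _ y])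
  qed (auto simp: F_def)
  moreover have "card (F y) = card (extensions n (Suc k))" if y: "y \<in> ?Y" for y
  proof -
    let ?s = "transpose (2*k+1) y"
    have s: "?s permutes {0..<2*n}" using y by (intro permutes_swap_id) auto
    have inv: "relabel ?s (relabel ?s m) = m" for m by (simp add: relabel_comp)
    have img: "?s ` e = e" if "e \<in> edge_blocks k" for e
      using that y by (auto simp: edge_blocks_def transpose_def)
    have blocks: "edge_blocks k \<subseteq> relabel ?s m" if "edge_blocks k \<subseteq> m" for m
    proof
      fix e assume e: "e \<in> edge_blocks k"
      then have "?s ` e \<in> relabel ?s m" unfolding relabel_def using that by (intro imageI) auto
      then show "e \<in> relabel ?s m" using img[OF e] by simp
    qed
    have new: "{2*k, ?s z} \<in> relabel ?s m" if "{2*k, z} \<in> m" for m z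
      using edge_relabel[OF s, of "2*k" z m] that y by (simp add: transpose_def)
    have E: "extensions n (Suc k) = {m \<in> extensions n k. {2*k, 2*k+1} \<in> m}"
      by (auto simp: extensions_def edge_blocks_def lessThan_Suc)
    have "bij_betw (relabel ?s) (F y) (extensions n (Suc k))"
    proof (rule bij_betw_byWitness[where f'="relabel ?s"])
      show "relabel ?s ` F y \<subseteq> extensions n (Suc k)" "relabel ?s ` extensions n (Suc k) \<subseteq> F y"
        unfolding E F_def using relabel_matchings[OF s] blocks new[of y] new[of "2*k+1"]
        by (auto simp: extensions_def)
    qed (intro ballI, rule inv)+
    then show ?thesis by (rule bij_betw_same_card)
  qed
  moreover have "card (\<Union>y\<in>?Y. F y) = (\<Sum>y\<in>?Y. card (F y))"
  proof (rule card_UN_disjoint)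
    show "\<forall>y\<in>?Y. finite (F y)"
      using finite_matchings by (auto simp: F_def extensions_def)
    show "\<forall>i\<in>?Y. \<forall>j\<in>?Y. i \<noteq> j \<longrightarrow> F i \<inter> F j = {}"
      using matching_unique by (fastforce simp: F_def extensions_def)
  qed simp
  ultimately show ?thesis by simp
qed

lemma card_matchings_extensions:
  assumes "t \<le> n"
  shows "real (card (matchings n)) = (\<Prod>k\<in>{1..t}. real (2*n - 2*k + 1)) * real (card (extensions n t))"
  using assms
proof (induction t)
  case 0
  then show ?case by (simp add: extensions_def edge_blocks_def)
next
  case (Suc t)
  have "2*n - 2*t - 1 = 2*n - 2 * Suc t + 1" using Suc.prems by auto
  then have "card (extensions n t) = (2*n - 2 * Suc t + 1) * card (extensions n (Suc t))"
    using card_extensions_Suc[of t n] Suc.prems by simp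
  then have "real (card (extensions n t)) = real (2*n - 2 * Suc t + 1) * real (card (extensions n (Suc t)))"
    by (simp only: of_nat_mult)
  then show ?case using Suc by (simp del: of_nat_add of_nat_Suc)
qed

section \<open>Tableaux and polytabloids\<close>

lemma lin_span_zero: "(\<lambda>_. 0) \<in> lin_span G"
  unfolding lin_span_def by (intro CollectI exI[of _ "{}"]) auto

lemma lin_span_superset: "g \<in> G \<Longrightarrow> g \<in> lin_span G"
  unfolding lin_span_def by (intro CollectI exI[of _ "{g}"] exI[of _ "\<lambda>_. 1"]) auto

lemma lin_span_lincomb:
  assumes "u \<in> lin_span G" "v \<in> lin_span G" shows "(\<lambda>x. a * u x + b * v x) \<in> lin_span G"
proof -
  obtain S c where S: "finite S" "S \<subseteq> G" "u = (\<lambda>x. \<Sum>g\<in>S. c g * g x)"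
    using assms(1) by (auto simp: lin_span_def)
  obtain S' c' where S': "finite S'" "S' \<subseteq> G" "v = (\<lambda>x. \<Sum>g\<in>S'. c' g * g x)"
    using assms(2) by (auto simp: lin_span_def)
  let ?c = "\<lambda>g. a * (if g \<in> S then c g else 0) + b * (if g \<in> S' then c' g else 0)"
  have "u x = (\<Sum>g\<in>S \<union> S'. (if g \<in> S then c g else 0) * g x)" for x
    unfolding S(3) using S S' by (intro sum.mono_neutral_cong_left) auto
  moreover have "v x = (\<Sum>g\<in>S \<union> S'. (if g \<in> S' then c' g else 0) * g x)" for x
    unfolding S'(3) using S S' by (intro sum.mono_neutral_cong_left) auto
  ultimately have "a * u x + b * v x = (\<Sum>g\<in>S \<union> S'. ?c g * g x)" for x
    by (simp only: sum_distrib_left sum.distrib distrib_right mult.assoc)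
  then show ?thesis unfolding lin_span_def using S S'
    by (intro CollectI exI[of _ "S \<union> S'"] exI[of _ ?c]) auto
qed

lemma lin_span_sum:
  assumes "finite I" "\<And>i. i \<in> I \<Longrightarrow> f i \<in> lin_span G"
  shows "(\<lambda>x. \<Sum>i\<in>I. c i * f i x) \<in> lin_span G"
  using assms
proof (induction I rule: finite_induct)
  case (insert i I)
  then have "(\<lambda>x. c i * f i x + 1 * (\<Sum>i\<in>I. c i * f i x)) \<in> lin_span G"
    by (intro lin_span_lincomb) auto
  then show ?case using insert by simp
qed (simp add: lin_span_zero)

lemma lin_span_induct [consumes 1, case_names zero step]:
  assumes "u \<in> lin_span G" "Q (\<lambda>_. 0)"
    and step: "\<And>u g c. u \<in> lin_span G \<Longrightarrow> Q u \<Longrightarrow> g \<in> G \<Longrightarrow> Q (\<lambda>x. u x + c * g x)"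
  shows "Q u"
proof -
  obtain S c where S: "finite S" "S \<subseteq> G" "u = (\<lambda>x. \<Sum>g\<in>S. c g * g x)"
    using assms(1) by (auto simp: lin_span_def)
  have "Q (\<lambda>x. \<Sum>g\<in>S. c g * g x)" using S(1,2)
  proof (induction S rule: finite_induct)
    case (insert g S)
    have "(\<lambda>x. \<Sum>g\<in>S. c g * g x) \<in> lin_span G"
      using insert by (intro lin_span_sum lin_span_superset) auto
    then have "Q (\<lambda>x. (\<Sum>g\<in>S. c g * g x) + c g * g x)" using insert by (intro step) auto
    then show ?case using insert by (simp add: add.commute)
  qed (simp add: assms)
  then show ?thesis using S by simp
qed

definition row_of :: "nat list \<Rightarrow> (nat \<times> nat \<Rightarrow> nat) \<Rightarrow> nat \<Rightarrow> nat" where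
  "row_of mu T x = fst (inv_into (cells mu) T x)"

definition col_of :: "nat list \<Rightarrow> (nat \<times> nat \<Rightarrow> nat) \<Rightarrow> nat \<Rightarrow> nat" where
  "col_of mu T x = snd (inv_into (cells mu) T x)"

lemma finite_cells: "finite (cells mu)"
  by (rule finite_subset[of _ "Sigma {..<length mu} (\<lambda>i. {..<mu ! i})"]) (auto simp: cells_def)

lemma card_cells: "card (cells mu) = sum_list mu"
proof -
  have "cells mu = Sigma {..<length mu} (\<lambda>i. {..<mu ! i})" by (auto simp: cells_def)
  then show ?thesis by (simp add: sum_list_sum_nth lessThan_atLeast0)
qed

lemma tableaux_nonempty: assumes "mu \<in> partitions N" shows "\<exists>T. T \<in> tableaux mu N"
proof -
  have "card (cells mu) = card {0..<N}" using assms by (simp add: card_cells partitions_def)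
  then show ?thesis using finite_same_card_bij[OF finite_cells, of "{0..<N}" mu] by (auto simp: tableaux_def)
qed

context
  fixes mu :: "nat list" and N :: nat and T :: "nat \<times> nat \<Rightarrow> nat"
  assumes T: "T \<in> tableaux mu N"
begin

lemma tableau_cell:
  assumes "x < N" shows "(row_of mu T x, col_of mu T x) \<in> cells mu" "T (row_of mu T x, col_of mu T x) = x"
proof -
  have "x \<in> T ` cells mu" using assms T by (auto simp: tableaux_def bij_betw_def)
  then show "(row_of mu T x, col_of mu T x) \<in> cells mu" "T (row_of mu T x, col_of mu T x) = x"
    by (simp_all add: row_of_def col_of_def inv_into_into f_inv_into_f)
qed

lemma tableau_entry:
  assumes "(i, j) \<in> cells mu" shows "T (i, j) < N" "row_of mu T (T (i, j)) = i" "col_of mu T (T (i, j)) = j"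
proof -
  have "inj_on T (cells mu)" "T ` cells mu = {0..<N}" using T by (auto simp: tableaux_def bij_betw_def)
  then show "T (i, j) < N" "row_of mu T (T (i, j)) = i" "col_of mu T (T (i, j)) = j"
    using assms by (auto simp: row_of_def col_of_def inv_into_f_f)
qed

lemma tableau_cell_unique:
  assumes "(i, j) \<in> cells mu" "T (i, j) = x" shows "row_of mu T x = i" "col_of mu T x = j"
  using tableau_entry[OF assms(1)] assms(2) by auto

lemma permuted_tableau:
  assumes s: "s permutes {0..<N}" shows "s \<circ> T \<in> tableaux mu N"
  using T permutes_imp_bij[OF s] by (auto simp: tableaux_def intro: bij_betw_trans)

lemma tabloid_of_row: "tabloid_of mu N T = (\<lambda>x. if x < N then row_of mu T x else 0)"
  unfolding tabloid_of_def row_of_def ..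

lemma column_group_iff:
  "s \<in> column_group mu N T \<longleftrightarrow> s permutes {0..<N} \<and> (\<forall>x<N. col_of mu T (s x) = col_of mu T x)"
  by (auto simp: column_group_def col_of_def)

lemma finite_column_group: "finite (column_group mu N T)"
  by (rule finite_subset[of _ "{s. s permutes {0..<N}}"]) (auto simp: column_group_def finite_permutations)

lemma column_group_comp:
  assumes "s \<in> column_group mu N T" "s' \<in> column_group mu N T" shows "s \<circ> s' \<in> column_group mu N T"
proof -
  have s: "s permutes {0..<N}" "s' permutes {0..<N}" using assms by (auto simp: column_group_iff)
  have "s' x < N" if "x < N" for x using permutes_in_image[OF s(2), of x] that by auto
  then show ?thesis using assms permutes_compose[OF s(2,1)] by (auto simp: column_group_iff)
qed

lemma column_group_inv:
  assumes "s \<in> column_group mu N T" shows "inv s \<in> column_group mu N T"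
proof -
  have s: "s permutes {0..<N}" using assms by (auto simp: column_group_iff)
  have "col_of mu T (inv s x) = col_of mu T x" if "x < N" for x
  proof -
    have "inv s x < N" using permutes_in_image[OF permutes_inv[OF s], of x] that by auto
    then have "col_of mu T (s (inv s x)) = col_of mu T (inv s x)" using assms by (auto simp: column_group_iff)
    then show ?thesis by (simp add: permutes_inverses[OF s])
  qed
  then show ?thesis using permutes_inv[OF s] by (simp add: column_group_iff)
qed

lemma column_group_id: "id \<in> column_group mu N T" by (simp add: column_group_iff permutes_id)

end

lemma row_of_permuted:
  assumes T: "T \<in> tableaux mu N" and s: "s permutes {0..<N}" and "x < N"
  shows "row_of mu (s \<circ> T) x = row_of mu T (inv s x)" "col_of mu (s \<circ> T) x = col_of mu T (inv s x)"
proof -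
  have x: "inv s x < N" using permutes_in_image[OF permutes_inv[OF s], of x] assms(3) by auto
  have "(s \<circ> T) (row_of mu T (inv s x), col_of mu T (inv s x)) = x"
    using tableau_cell(2)[OF T x] permutes_inverses[OF s] by simp
  then show "row_of mu (s \<circ> T) x = row_of mu T (inv s x)" "col_of mu (s \<circ> T) x = col_of mu T (inv s x)"
    using tableau_cell_unique[OF permuted_tableau[OF T s] tableau_cell(1)[OF T x]] by auto
qed

lemma tabloid_of_permuted:
  assumes T: "T \<in> tableaux mu N" and s: "s permutes {0..<N}"
  shows "tabloid_of mu N (s \<circ> T) = tabloid_of mu N T \<circ> inv s"
proof
  fix x
  show "tabloid_of mu N (s \<circ> T) x = (tabloid_of mu N T \<circ> inv s) x"
  proof (cases "x < N")
    case True
    have "inv s x < N" using permutes_in_image[OF permutes_inv[OF s], of x] True by auto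
    then show ?thesis using True row_of_permuted[OF T s True]
      by (simp add: tabloid_of_row[OF T] tabloid_of_row[OF permuted_tableau[OF T s]])
  next
    case False
    then have "inv s x = x" using permutes_not_in[OF permutes_inv[OF s], of x] by auto
    then show ?thesis using False by (simp add: tabloid_of_def)
  qed
qed

lemma sign_compose_permutes:
  assumes "s permutes {0..<N::nat}" "s' permutes {0..<N}" shows "sign (s \<circ> s') = sign s * sign s'"
  using assms by (intro sign_compose permutes_imp_permutation[of "{0..<N}"]) auto

lemma sign_inv_permutes:
  assumes "s permutes {0..<N::nat}" shows "sign (inv s) = sign s"
  using assms by (intro sign_inverse permutes_imp_permutation[of "{0..<N}"]) auto

lemma sign_square: "of_int (sign s) * of_int (sign s) = (1::real)"
  by (simp add: sign_def)

section \<open>The column antisymmetrizer\<close>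

definition point :: "'a \<Rightarrow> 'a \<Rightarrow> real" where "point a = (\<lambda>b. if b = a then 1 else 0)"

text \<open>The signed column sum of James, usually written kappa_T. Since \<open>act_tab s\<close>
  precomposes with \<open>s\<close>, it moves \<open>point r0\<close> to the point at
  \<open>r0 \<circ> inv s\<close>.\<close>

definition antisymmetrize :: "nat list \<Rightarrow> nat \<Rightarrow> (nat \<times> nat \<Rightarrow> nat) \<Rightarrow> ((nat \<Rightarrow> nat) \<Rightarrow> real) \<Rightarrow> ((nat \<Rightarrow> nat) \<Rightarrow> real)" where
  "antisymmetrize mu N T v = (\<lambda>r. \<Sum>s\<in>column_group mu N T. of_int (sign s) * act_tab s v r)"

lemma comp_inv_eq_iff: assumes "s permutes X" shows "r = r' \<circ> inv s \<longleftrightarrow> r \<circ> s = r'"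
  using permutes_inv_o[OF assms] by (metis comp_assoc comp_id)

lemma polytabloid_antisymmetrize:
  assumes T: "T \<in> tableaux mu N"
  shows "polytabloid mu N T = antisymmetrize mu N T (point (tabloid_of mu N T))"
proof
  fix r
  show "polytabloid mu N T r = antisymmetrize mu N T (point (tabloid_of mu N T)) r"
    unfolding polytabloid_def antisymmetrize_def act_tab_def point_def
  proof (intro sum.cong refl)
    fix s assume "s \<in> column_group mu N T"
    then have s: "s permutes {0..<N}" using column_group_iff[OF T] by auto
    show "of_int (sign s) * (if r = tabloid_of mu N (s \<circ> T) then 1 else 0)
      = of_int (sign s) * (if r \<circ> s = tabloid_of mu N T then 1 else (0::real))"
      unfolding tabloid_of_permuted[OF T s] comp_inv_eq_iff[OF s] ..
  qed
qed

lemma bij_betw_column_group: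
  assumes T: "T \<in> tableaux mu N" and p: "p \<in> column_group mu N T"
  shows "bij_betw (\<lambda>s. s \<circ> p) (column_group mu N T) (column_group mu N T)"
    "bij_betw (\<lambda>s. p \<circ> s) (column_group mu N T) (column_group mu N T)"
proof -
  have pp: "p permutes {0..<N}" using p column_group_iff[OF T] by auto
  show "bij_betw (\<lambda>s. s \<circ> p) (column_group mu N T) (column_group mu N T)"
    using column_group_comp[OF T] column_group_inv[OF T] p permutes_inv_o[OF pp]
    by (intro bij_betw_byWitness[where f'="\<lambda>s. s \<circ> inv p"]) (auto simp: comp_assoc)
  show "bij_betw (\<lambda>s. p \<circ> s) (column_group mu N T) (column_group mu N T)"
    using column_group_comp[OF T] column_group_inv[OF T] p permutes_inv_o[OF pp]
    by (intro bij_betw_byWitness[where f'="\<lambda>s. inv p \<circ> s"]) (auto simp: comp_assoc[symmetric])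
qed

lemma antisymmetrize_point_comp:
  assumes T: "T \<in> tableaux mu N" and p: "p \<in> column_group mu N T"
  shows "antisymmetrize mu N T (point (r0 \<circ> p)) r = of_int (sign p) * antisymmetrize mu N T (point r0) r"
proof -
  have pp: "p permutes {0..<N}" using p column_group_iff[OF T] by auto
  have eq: "r \<circ> (s \<circ> p) = r0 \<circ> p \<longleftrightarrow> r \<circ> s = r0" for s
  proof
    assume h: "r \<circ> (s \<circ> p) = r0 \<circ> p"
    show "r \<circ> s = r0"
    proof
      fix y show "(r \<circ> s) y = r0 y"
        using fun_cong[OF h, of "inv p y"] by (simp add: permutes_inverses[OF pp])
    qed
  qed (simp add: comp_assoc[symmetric])
  have "antisymmetrize mu N T (point (r0 \<circ> p)) r
      = (\<Sum>s\<in>column_group mu N T. of_int (sign (s \<circ> p)) * act_tab (s \<circ> p) (point (r0 \<circ> p)) r)"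
    unfolding antisymmetrize_def by (rule sum.reindex_bij_betw[OF bij_betw_column_group(1)[OF T p], symmetric])
  also have "\<dots> = (\<Sum>s\<in>column_group mu N T. of_int (sign p) * (of_int (sign s) * act_tab s (point r0) r))"
    using sign_compose_permutes[OF _ pp] column_group_iff[OF T]
    by (intro sum.cong) (auto simp: act_tab_def point_def eq)
  finally show ?thesis by (simp add: antisymmetrize_def sum_distrib_left)
qed

text \<open>The transposition of \<open>x\<close> and \<open>y\<close> is an odd column permutation
  that fixes the tabloid \<open>r0\<close>, so the value equals its own negative.\<close>

lemma antisymmetrize_point_collision:
  assumes T: "T \<in> tableaux mu N" and xy: "x < N" "y < N" "x \<noteq> y" "col_of mu T x = col_of mu T y" "r0 x = r0 y"
  shows "antisymmetrize mu N T (point r0) r = 0"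
proof -
  have "transpose x y \<in> column_group mu N T"
    using xy by (auto simp: column_group_iff[OF T] transpose_def intro!: permutes_swap_id)
  moreover have "r0 \<circ> transpose x y = r0" using xy(5) by (auto simp: transpose_def)
  moreover have "sign (transpose x y) = -1" using xy(3) by (simp add: sign_swap_id)
  ultimately show ?thesis using antisymmetrize_point_comp[OF T, of "transpose x y" r0 r] by simp
qed

lemma act_tab_polytabloid_column:
  assumes T: "T \<in> tableaux mu N" and p: "p \<in> column_group mu N T"
  shows "act_tab p (polytabloid mu N T) r = of_int (sign p) * polytabloid mu N T r"
proof -
  have pp: "p permutes {0..<N}" using p column_group_iff[OF T] by auto
  have "polytabloid mu N T r = (\<Sum>s\<in>column_group mu N T. of_int (sign (p \<circ> s)) * act_tab (p \<circ> s) (point (tabloid_of mu N T)) r)"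
    unfolding polytabloid_antisymmetrize[OF T] antisymmetrize_def
    by (rule sum.reindex_bij_betw[OF bij_betw_column_group(2)[OF T p], symmetric])
  also have "\<dots> = (\<Sum>s\<in>column_group mu N T. of_int (sign p) * (of_int (sign s) * act_tab s (point (tabloid_of mu N T)) (r \<circ> p)))"
    using sign_compose_permutes[OF pp] column_group_iff[OF T]
    by (intro sum.cong) (auto simp: act_tab_def comp_assoc)
  finally have "of_int (sign p) * polytabloid mu N T r = of_int (sign p) * (of_int (sign p) * polytabloid mu N T (r \<circ> p))"
    by (simp add: polytabloid_antisymmetrize[OF T] antisymmetrize_def sum_distrib_left)
  then show ?thesis unfolding act_tab_def mult.assoc[symmetric] sign_square by simp
qed

text \<open>The column group of \<open>p \<circ> T\<close> is the conjugate by \<open>p\<close> of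
  the column group of \<open>T\<close>, and conjugation preserves signs.\<close>

lemma polytabloid_permuted:
  assumes T: "T \<in> tableaux mu N" and p: "p permutes {0..<N}"
  shows "polytabloid mu N (p \<circ> T) = act_tab p (polytabloid mu N T)"
proof
  fix r
  let ?c = "\<lambda>s. p \<circ> s \<circ> inv p"
  have in_range: "q x < N \<longleftrightarrow> x < N" if "q permutes {0..<N}" for q x
    using permutes_in_image[OF that, of x] by auto
  have conj: "?c s \<in> column_group mu N (p \<circ> T)" if "s \<in> column_group mu N T" for s
  proof -
    have s: "s permutes {0..<N}" using that column_group_iff[OF T] by auto
    have cp: "?c s permutes {0..<N}" using s p permutes_inv[OF p] by (intro permutes_compose)
    have "col_of mu (p \<circ> T) (?c s x) = col_of mu (p \<circ> T) x" if x: "x < N" for x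
    proof -
      have "col_of mu (p \<circ> T) (?c s x) = col_of mu T (s (inv p x))"
        using row_of_permuted(2)[OF T p] in_range[OF cp] x by (simp add: permutes_inverses[OF p])
      then show ?thesis
        using row_of_permuted(2)[OF T p x] in_range[OF permutes_inv[OF p]] x \<open>s \<in> _\<close> column_group_iff[OF T] by simp
    qed
    then show ?thesis using cp column_group_iff[OF permuted_tableau[OF T p]] by blast
  qed
  have unconj: "inv p \<circ> s \<circ> p \<in> column_group mu N T" if "s \<in> column_group mu N (p \<circ> T)" for s
  proof -
    have s: "s permutes {0..<N}" using that column_group_iff[OF permuted_tableau[OF T p]] by auto
    have cp: "inv p \<circ> s \<circ> p permutes {0..<N}" using s p permutes_inv[OF p] by (intro permutes_compose)
    have "col_of mu T ((inv p \<circ> s \<circ> p) x) = col_of mu T x" if x: "x < N" for x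
    proof -
      have px: "p x < N" "s (p x) < N" using x in_range[OF p] in_range[OF s] by auto
      have "col_of mu T ((inv p \<circ> s \<circ> p) x) = col_of mu (p \<circ> T) (s (p x))"
        using row_of_permuted(2)[OF T p px(2)] by simp
      also have "\<dots> = col_of mu (p \<circ> T) (p x)"
        using px \<open>s \<in> _\<close> column_group_iff[OF permuted_tableau[OF T p]] by simp
      finally show ?thesis using row_of_permuted(2)[OF T p px(1)] by (simp add: permutes_inverses[OF p])
    qed
    then show ?thesis using cp column_group_iff[OF T] by blast
  qed
  have bij: "bij_betw ?c (column_group mu N T) (column_group mu N (p \<circ> T))"
  proof (rule bij_betw_byWitness[where f'="\<lambda>s. inv p \<circ> s \<circ> p"])
    show "\<forall>s\<in>column_group mu N T. inv p \<circ> ?c s \<circ> p = s"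
      using permutes_inverses[OF p] by (auto simp: fun_eq_iff)
    show "\<forall>s\<in>column_group mu N (p \<circ> T). ?c (inv p \<circ> s \<circ> p) = s"
      using permutes_inverses[OF p] by (auto simp: fun_eq_iff)
  qed (use conj unconj in auto)
  have "polytabloid mu N (p \<circ> T) r = (\<Sum>s\<in>column_group mu N T. of_int (sign (?c s)) *
      act_tab (?c s) (point (tabloid_of mu N T \<circ> inv p)) r)"
    unfolding polytabloid_antisymmetrize[OF permuted_tableau[OF T p]] antisymmetrize_def
      tabloid_of_permuted[OF T p] by (rule sum.reindex_bij_betw[OF bij, symmetric])
  also have "\<dots> = (\<Sum>s\<in>column_group mu N T. of_int (sign s) * act_tab s (point (tabloid_of mu N T)) (r \<circ> p))"
  proof (intro sum.cong refl)
    fix s assume "s \<in> column_group mu N T"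
    then have s: "s permutes {0..<N}" using column_group_iff[OF T] by auto
    have "sign (?c s) = sign s"
      using sign_compose_permutes[OF permutes_compose[OF s p] permutes_inv[OF p]] sign_compose_permutes[OF p s]
        sign_inv_permutes[OF p] by (simp add: sign_def)
    moreover have "r \<circ> ?c s = tabloid_of mu N T \<circ> inv p \<longleftrightarrow> r \<circ> p \<circ> s = tabloid_of mu N T"
      using comp_inv_eq_iff[OF p, of "r \<circ> ?c s" "tabloid_of mu N T"] permutes_inv_o[OF p]
      by (simp add: comp_assoc)
    ultimately show "of_int (sign (?c s)) * act_tab (?c s) (point (tabloid_of mu N T \<circ> inv p)) r
      = of_int (sign s) * act_tab s (point (tabloid_of mu N T)) (r \<circ> p)"
      by (simp add: act_tab_def point_def)
  qed
  finally show "polytabloid mu N (p \<circ> T) r = act_tab p (polytabloid mu N T) r"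
    unfolding polytabloid_antisymmetrize[OF T] antisymmetrize_def by (simp add: act_tab_def)
qed

text \<open>A tableau is a total function, so two representatives of the same filling may differ
  outside the shape.\<close>

lemma polytabloid_cong:
  assumes T: "T \<in> tableaux mu N" "T' \<in> tableaux mu N" and eq: "\<And>c. c \<in> cells mu \<Longrightarrow> T c = T' c"
  shows "polytabloid mu N T = polytabloid mu N T'"
proof -
  have *: "row_of mu T x = row_of mu T' x \<and> col_of mu T x = col_of mu T' x" if "x < N" for x
    using tableau_cell_unique[OF T(1) tableau_cell(1)[OF T(2) that]] tableau_cell[OF T(2) that] eq by auto
  have "s x < N" if "s permutes {0..<N}" "x < N" for s x using permutes_in_image[OF that(1), of x] that(2) by auto
  then have "column_group mu N T = column_group mu N T'"
    using * by (auto simp: column_group_iff[OF T(1)] column_group_iff[OF T(2)])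
  moreover have "tabloid_of mu N T = tabloid_of mu N T'"
    using * by (auto simp: tabloid_of_row[OF T(1)] tabloid_of_row[OF T(2)])
  ultimately show ?thesis by (simp add: polytabloid_antisymmetrize T antisymmetrize_def)
qed

text \<open>All tableaux of one shape form a single orbit, so one polytabloid generates the Specht
  module.\<close>

lemma polytabloid_conjugate:
  assumes T: "T \<in> tableaux mu N" "T' \<in> tableaux mu N"
  shows "\<exists>p. p permutes {0..<N} \<and> polytabloid mu N T' = act_tab p (polytabloid mu N T)"
proof -
  define p where "p x = (if x < N then T' (row_of mu T x, col_of mu T x) else x)" for x
  have pT: "p (T c) = T' c" if "c \<in> cells mu" for c
    using tableau_entry[OF T(1), of "fst c" "snd c"] that by (simp add: p_def)
  have "bij_betw (T' \<circ> inv_into (cells mu) T) {0..<N} {0..<N}"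
    using T bij_betw_inv_into bij_betw_trans unfolding tableaux_def by blast
  then have "bij_betw p {0..<N} {0..<N}"
    by (rule bij_betw_cong[THEN iffD1, rotated]) (auto simp: p_def row_of_def col_of_def)
  then have p: "p permutes {0..<N}" by (intro bij_imp_permutes) (auto simp: p_def)
  have "polytabloid mu N T' = polytabloid mu N (p \<circ> T)"
    using pT by (intro polytabloid_cong[OF T(2) permuted_tableau[OF T(1) p]]) auto
  then show ?thesis using polytabloid_permuted[OF T(1) p] p by auto
qed

section \<open>Dominance and the action of the antisymmetrizer on Specht modules\<close>

text \<open>The partial sums of the parts, i.e. the quantities compared in the dominance
  order.\<close>

definition row_count :: "nat list \<Rightarrow> nat \<Rightarrow> nat" where
  "row_count mu k = card {c \<in> cells mu. fst c < k}"

lemma row_count_Suc: "row_count mu (Suc k) = row_count mu k + (if k < length mu then mu ! k else 0)"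
proof -
  have "{c \<in> cells mu. fst c < Suc k} = {c \<in> cells mu. fst c < k} \<union> {c \<in> cells mu. fst c = k}" by auto
  moreover have "card ({c \<in> cells mu. fst c < k} \<union> {c \<in> cells mu. fst c = k})
      = row_count mu k + card {c \<in> cells mu. fst c = k}"
    unfolding row_count_def using finite_cells by (intro card_Un_disjoint) auto
  moreover have "{c \<in> cells mu. fst c = k} = (if k < length mu then Pair k ` {..<mu ! k} else {})"
    by (auto simp: cells_def)
  moreover have "card (Pair k ` {..<mu ! k}) = mu ! k" by (simp add: card_image inj_on_def)
  ultimately show ?thesis by (auto simp: row_count_def)
qed

text \<open>Consecutive differences of the partial sums are the parts padded by zeros, and as parts
  are positive the padding can be recognised.\<close>

lemma row_count_inject:
  assumes "mu \<in> partitions N" "nu \<in> partitions N'" and eq: "\<And>k. row_count mu k = row_count nu k"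
  shows "mu = nu"
proof -
  have *: "(if k < length mu then mu ! k else 0) = (if k < length nu then nu ! k else 0)" for k
    using eq[of k] eq[of "Suc k"] by (simp add: row_count_Suc)
  have pos: "mu ! k \<noteq> 0" if "k < length mu" for k
    using assms(1) nth_mem[OF that] unfolding partitions_def by (metis (mono_tags) mem_Collect_eq)
  have pos': "nu ! k \<noteq> 0" if "k < length nu" for k
    using assms(2) nth_mem[OF that] unfolding partitions_def by (metis (mono_tags) mem_Collect_eq)
  have "k < length mu \<longleftrightarrow> k < length nu" for k using *[of k] pos[of k] pos'[of k] by (auto split: if_splits)
  then have "length mu = length nu" by (metis linorder_neqE_nat less_irrefl)
  then show ?thesis using * by (intro nth_equalityI) (auto, metis)
qed

lemma card_tabloid_rows:
  assumes T: "T \<in> tableaux mu N" shows "card {x \<in> {0..<N}. row_of mu T x < k} = row_count mu k"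
  unfolding row_count_def
  by (rule bij_betw_same_card[where f="\<lambda>x. (row_of mu T x, col_of mu T x)"],
      rule bij_betw_byWitness[where f'=T])
    (auto simp: tableau_cell[OF T] tableau_entry[OF T])

lemma partition_nth_mono:
  assumes "mu \<in> partitions N" "i \<le> j" "j < length mu" shows "mu ! j \<le> mu ! i"
  using assms sorted_wrt_nth_less[of "(\<ge>)" mu i j] by (cases "i = j") (auto simp: partitions_def)

text \<open>The parts decrease weakly, so the rows met by a column form an initial segment.\<close>

lemma column_rows:
  assumes mu: "mu \<in> partitions N" and T: "T \<in> tableaux mu N"
  defines "X \<equiv> \<lambda>j. {x \<in> {0..<N}. col_of mu T x = j}"
  shows "bij_betw (row_of mu T) (X j) {..<card (X j)}"
proof -
  have inj: "inj_on (row_of mu T) (X j)"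
    unfolding X_def by (intro inj_onI) (auto, metis tableau_cell(2)[OF T])
  define R where "R = row_of mu T ` X j"
  have fin: "finite R" by (simp add: R_def X_def)
  have R: "R = {i. (i, j) \<in> cells mu}"
    unfolding R_def X_def using tableau_cell(1)[OF T] tableau_entry[OF T] by (force simp: image_iff)
  have "R = {..<card R}"
  proof -
    have down: "i \<in> R" if "i' \<in> R" "i \<le> i'" for i i'
      using that partition_nth_mono[OF mu that(2)] unfolding R cells_def by fastforce
    show ?thesis
    proof (cases "R = {}")
      case False
      have "R = {..Max R}"
      proof
        show "R \<subseteq> {..Max R}" using fin by auto
        show "{..Max R} \<subseteq> R" using down[OF Max_in[OF fin False]] by auto
      qed
      then have "card R = Suc (Max R)" by (metis card_atMost)
      then show ?thesis using \<open>R = {..Max R}\<close> by (simp add: lessThan_Suc_atMost)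
    qed simp
  qed
  then show ?thesis using inj card_image[OF inj] unfolding R_def by (simp add: bij_betw_def)
qed

lemma sum_over_columns:
  assumes "finite A" shows "card {x \<in> A. Q x} = (\<Sum>j\<in>c ` A. card {x \<in> {x \<in> A. c x = j}. Q x})"
proof -
  have "(\<Sum>x\<in>A. if Q x then 1 else 0) = (\<Sum>j\<in>c ` A. \<Sum>x\<in>{x \<in> A. c x = j}. if Q x then 1 else (0::nat))"
    using assms by (rule sum.image_gen)
  moreover have "(\<Sum>x\<in>B. if Q x then 1 else 0) = card {x \<in> B. Q x}" if "finite B" for B
    using that by (simp add: sum.If_cases Int_def)
  ultimately show ?thesis using assms by simp
qed

text \<open>A column of h cells admits at most min(h, k) distinct labels below \<open>k\<close>, and
  the row numbers of \<open>T\<close> attain this bound.\<close>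

lemma column_row_count_le:
  assumes mu: "mu \<in> partitions N" and T: "T \<in> tableaux mu N"
    and inj: "\<And>x y. x < N \<Longrightarrow> y < N \<Longrightarrow> col_of mu T x = col_of mu T y \<Longrightarrow> r x = r y \<Longrightarrow> x = y"
  defines "X \<equiv> \<lambda>j. {x \<in> {0..<N}. col_of mu T x = j}"
  shows "card {x \<in> X j. r x < (k::nat)} \<le> card {x \<in> X j. row_of mu T x < k}"
proof -
  have "bij_betw (row_of mu T) {x \<in> X j. row_of mu T x < k} {..<min (card (X j)) k}"
  proof -
    have "inj_on (row_of mu T) (X j)" "row_of mu T ` X j = {..<card (X j)}"
      using column_rows[OF mu T, of j] unfolding X_def bij_betw_def by blast+
    moreover have "row_of mu T ` {x \<in> X j. row_of mu T x < k} = row_of mu T ` X j \<inter> {..<k}" by auto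
    moreover have "{..<card (X j)} \<inter> {..<k} = {..<min (card (X j)) k}" by auto
    ultimately show ?thesis by (auto simp: bij_betw_def intro: inj_on_subset)
  qed
  then have "card {x \<in> X j. row_of mu T x < k} = min (card (X j)) k"
    by (simp add: bij_betw_same_card)
  moreover have "card {x \<in> X j. r x < k} \<le> card (X j)" by (intro card_mono) (auto simp: X_def)
  moreover have "card {x \<in> X j. r x < k} \<le> card {..<k}"
    by (rule card_inj_on_le[where f=r]) (auto simp: inj_on_def X_def intro: inj)
  ultimately show ?thesis by simp
qed

lemma no_collision_dominates:
  assumes mu: "mu \<in> partitions N" and T: "T \<in> tableaux mu N"
    and inj: "\<And>x y. x < N \<Longrightarrow> y < N \<Longrightarrow> col_of mu T x = col_of mu T y \<Longrightarrow> r x = r y \<Longrightarrow> x = y"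
  shows "card {x \<in> {0..<N}. r x < k} \<le> row_count mu k"
proof -
  let ?X = "\<lambda>j. {x \<in> {0..<N}. col_of mu T x = j}"
  have "card {x \<in> {0..<N}. r x < k} = (\<Sum>j\<in>col_of mu T ` {0..<N}. card {x \<in> ?X j. r x < k})"
    by (rule sum_over_columns) simp
  also have "\<dots> \<le> (\<Sum>j\<in>col_of mu T ` {0..<N}. card {x \<in> ?X j. row_of mu T x < k})"
    by (intro sum_mono column_row_count_le[OF mu T inj])
  also have "\<dots> = card {x \<in> {0..<N}. row_of mu T x < k}"
    by (rule sum_over_columns[symmetric]) simp
  finally show ?thesis by (simp only: card_tabloid_rows[OF T])
qed

text \<open>Equality of the totals forces equality in every column, so the labels in a column of h
  cells are exactly 0, ..., h-1. The tabloid \<open>r\<close> then differs from that of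
  \<open>T\<close> only by a rearrangement within columns.\<close>

lemma no_collision_same_shape:
  assumes mu: "mu \<in> partitions N" and T: "T \<in> tableaux mu N"
    and inj: "\<And>x y. x < N \<Longrightarrow> y < N \<Longrightarrow> col_of mu T x = col_of mu T y \<Longrightarrow> r x = r y \<Longrightarrow> x = y"
    and eq: "\<And>k. card {x \<in> {0..<N}. r x < k} = row_count mu k"
    and outside: "\<And>x. x \<ge> N \<Longrightarrow> r x = 0"
  shows "\<exists>p\<in>column_group mu N T. r = tabloid_of mu N T \<circ> p"
proof -
  let ?c = "col_of mu T"
  let ?X = "\<lambda>j. {x \<in> {0..<N}. ?c x = j}"
  have cell: "(r x, ?c x) \<in> cells mu" if x: "x < N" for x
  proof -
    let ?h = "card (?X (?c x))"
    have "(\<Sum>j\<in>?c ` {0..<N}. card {x \<in> ?X j. r x < ?h}) = card {x \<in> {0..<N}. r x < ?h}"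
      by (rule sum_over_columns[symmetric]) simp
    also have "\<dots> = card {x \<in> {0..<N}. row_of mu T x < ?h}"
      by (simp only: eq card_tabloid_rows[OF T])
    also have "\<dots> = (\<Sum>j\<in>?c ` {0..<N}. card {x \<in> ?X j. row_of mu T x < ?h})"
      by (rule sum_over_columns) simp
    finally have "(\<Sum>j\<in>?c ` {0..<N}. card {x \<in> ?X j. r x < ?h}) = (\<Sum>j\<in>?c ` {0..<N}. card {x \<in> ?X j. row_of mu T x < ?h})" .
    then have "card {y \<in> ?X (?c x). r y < ?h} = card {y \<in> ?X (?c x). row_of mu T y < ?h}"
      \<comment> \<open>A sum of termwise inequalities with equal totals is termwise an
        equality.\<close>
      by (rule sum_mono_inv[OF _ column_row_count_le[OF mu T inj], where I="?c ` {0..<N}"]) (use x in simp_all)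
    also have "{y \<in> ?X (?c x). row_of mu T y < ?h} = ?X (?c x)"
      using bij_betwE[OF column_rows[OF mu T, of "?c x"]] by auto
    finally have "{y \<in> ?X (?c x). r y < ?h} = ?X (?c x)" by (intro card_subset_eq) auto
    moreover have "x \<in> ?X (?c x)" using x by simp
    ultimately have "x \<in> {y \<in> ?X (?c x). r y < ?h}" by metis
    then have "r x < ?h" by simp
    then have "r x \<in> row_of mu T ` ?X (?c x)"
      using column_rows[OF mu T, of "?c x"] by (simp add: bij_betw_def)
    then show ?thesis using tableau_cell(1)[OF T] by force
  qed
  \<comment> \<open>The column permutation sends \<open>x\<close> to the entry of \<open>T\<close>
    that lies in the column of \<open>x\<close> and in the row \<open>r x\<close>.\<close>
  define p where "p x = (if x < N then T (r x, ?c x) else x)" for x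
  have p: "p x < N" "row_of mu T (p x) = r x" "?c (p x) = ?c x" if "x < N" for x
    using tableau_entry[OF T cell[OF that]] that by (auto simp: p_def)
  have "inj_on p {0..<N}"
  proof (rule inj_onI)
    fix x y assume "x \<in> {0..<N}" "y \<in> {0..<N}" "p x = p y"
    then show "x = y" using p[of x] p[of y] inj by auto
  qed
  moreover have "p ` {0..<N} \<subseteq> {0..<N}" using p(1) by auto
  ultimately have "bij_betw p {0..<N} {0..<N}" by (simp add: bij_betw_def endo_inj_surj)
  then have "p permutes {0..<N}" by (intro bij_imp_permutes) (auto simp: p_def)
  then have "p \<in> column_group mu N T" using p(3) column_group_iff[OF T] by simp
  moreover have "r = tabloid_of mu N T \<circ> p"
  proof
    fix x
    show "r x = (tabloid_of mu N T \<circ> p) x"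
    proof (cases "x < N")
      case True
      then show ?thesis using p[OF True] by (simp add: tabloid_of_row[OF T])
    next
      case False
      then show ?thesis using outside[of x] by (simp add: tabloid_of_row[OF T] p_def)
    qed
  qed
  ultimately show ?thesis by blast
qed

lemma antisymmetrize_lincomb:
  "antisymmetrize mu N T (\<lambda>r. u r + c * v r) r = antisymmetrize mu N T u r + c * antisymmetrize mu N T v r"
  by (simp add: antisymmetrize_def act_tab_def sum.distrib sum_distrib_left algebra_simps)

lemma antisymmetrize_sum:
  "antisymmetrize mu N T (\<lambda>r. \<Sum>i\<in>I. c i * f i r) r = (\<Sum>i\<in>I. c i * antisymmetrize mu N T (f i) r)"
  unfolding antisymmetrize_def act_tab_def sum_distrib_left
  by (subst sum.swap) (simp add: algebra_simps)

text \<open>Linearity reduces the claim to single tabloids. The target \<open>E\<close> will be the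
  polytabloid of \<open>T\<close> for equal shapes and zero when dominance fails.\<close>

lemma antisymmetrize_specht:
  assumes pt: "\<And>Q. Q \<in> tableaux nu N \<Longrightarrow> \<exists>c. \<forall>r. antisymmetrize mu N T (point (tabloid_of nu N Q)) r = c * E r"
    and "v \<in> specht nu N"
  shows "\<exists>c. \<forall>r. antisymmetrize mu N T v r = c * E r"
  using assms(2) unfolding specht_def
proof (induction rule: lin_span_induct)
  case zero
  then show ?case by (intro exI[of _ 0]) (simp add: antisymmetrize_def act_tab_def)
next
  case (step u g c)
  then obtain a Q where a: "\<forall>r. antisymmetrize mu N T u r = a * E r" and Q: "Q \<in> tableaux nu N" "g = polytabloid nu N Q"
    by auto
  let ?pt = "\<lambda>s. point (tabloid_of nu N (s \<circ> Q))"
  have "s \<circ> Q \<in> tableaux nu N" if "s \<in> column_group nu N Q" for s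
    using permuted_tableau[OF Q(1)] that column_group_iff[OF Q(1)] by auto
  then have "\<forall>s\<in>column_group nu N Q. \<exists>b. \<forall>r. antisymmetrize mu N T (?pt s) r = b * E r"
    using pt by blast
  then obtain b where b: "\<And>s r. s \<in> column_group nu N Q \<Longrightarrow> antisymmetrize mu N T (?pt s) r = b s * E r"
    using bchoice[of "column_group nu N Q" "\<lambda>s b. \<forall>r. antisymmetrize mu N T (?pt s) r = b * E r"] by blast
  have g: "g = (\<lambda>r. \<Sum>s\<in>column_group nu N Q. of_int (sign s) * ?pt s r)"
    by (simp add: Q polytabloid_def point_def)
  have "antisymmetrize mu N T g r = (\<Sum>s\<in>column_group nu N Q. of_int (sign s) * b s) * E r" for r
    unfolding g antisymmetrize_sum using b by (simp add: sum_distrib_right mult.assoc)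
  then show ?case using a unfolding antisymmetrize_lincomb
    by (intro exI[of _ "a + c * (\<Sum>s\<in>column_group nu N Q. of_int (sign s) * b s)"])
      (simp add: algebra_simps)
qed

text \<open>A tabloid of shape \<open>mu\<close> with two entries of one column of \<open>T\<close>
  in the same row is annihilated. A tabloid without such entries is a column rearrangement of that
  of \<open>T\<close> and yields the polytabloid up to sign.\<close>

lemma antisymmetrize_specht_same_shape:
  assumes mu: "mu \<in> partitions N" and T: "T \<in> tableaux mu N" and v: "v \<in> specht mu N"
  shows "\<exists>c. \<forall>r. antisymmetrize mu N T v r = c * polytabloid mu N T r"
proof (rule antisymmetrize_specht[OF _ v])
  fix Q assume Q: "Q \<in> tableaux mu N"
  let ?r = "tabloid_of mu N Q"
  show "\<exists>c. \<forall>r. antisymmetrize mu N T (point ?r) r = c * polytabloid mu N T r"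
  proof (cases "\<exists>x y. x < N \<and> y < N \<and> x \<noteq> y \<and> col_of mu T x = col_of mu T y \<and> ?r x = ?r y")
    case True
    then show ?thesis using antisymmetrize_point_collision[OF T] by (metis mult_zero_left)
  next
    case False
    have "card {x \<in> {0..<N}. ?r x < k} = row_count mu k" for k
    proof -
      have "{x \<in> {0..<N}. ?r x < k} = {x \<in> {0..<N}. row_of mu Q x < k}" by (auto simp: tabloid_of_row[OF Q])
      then show ?thesis using card_tabloid_rows[OF Q] by simp
    qed
    then obtain p where "p \<in> column_group mu N T" "?r = tabloid_of mu N T \<circ> p"
      using no_collision_same_shape[OF mu T, of ?r] False by (auto simp: tabloid_of_def)
    then show ?thesis using antisymmetrize_point_comp[OF T] polytabloid_antisymmetrize[OF T] by metis
  qed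
qed

text \<open>The first \<open>k\<close> rows of a tabloid of shape \<open>nu\<close> contain more
  entries than the columns of \<open>T\<close> can accommodate without a collision, so every tabloid
  is annihilated.\<close>

lemma antisymmetrize_specht_not_dominated:
  assumes mu: "mu \<in> partitions N" and T: "T \<in> tableaux mu N" and v: "v \<in> specht nu N"
    and k: "row_count mu k < row_count nu k"
  shows "antisymmetrize mu N T v r = 0"
proof -
  have "\<exists>c. \<forall>r. antisymmetrize mu N T v r = c * (\<lambda>_. 0) r"
  proof (rule antisymmetrize_specht[OF _ v])
    fix Q assume Q: "Q \<in> tableaux nu N"
    let ?r = "tabloid_of nu N Q"
    have "{x \<in> {0..<N}. ?r x < k} = {x \<in> {0..<N}. row_of nu Q x < k}" by (auto simp: tabloid_of_row[OF Q])
    then have "row_count mu k < card {x \<in> {0..<N}. ?r x < k}" using card_tabloid_rows[OF Q] k by simp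
    then obtain x y where "x < N" "y < N" "x \<noteq> y" "col_of mu T x = col_of mu T y" "?r x = ?r y"
      using no_collision_dominates[OF mu T, of ?r k] by (metis not_le)
    then show "\<exists>c. \<forall>r. antisymmetrize mu N T (point ?r) r = c * (\<lambda>_. 0) r"
      using antisymmetrize_point_collision[OF T] by simp
  qed
  then show ?thesis by auto
qed

lemma not_mutually_dominating:
  assumes "mu \<in> partitions N" "nu \<in> partitions N" "mu \<noteq> nu"
  shows "\<exists>k. row_count mu k < row_count nu k \<or> row_count nu k < row_count mu k"
  using row_count_inject[OF assms(1,2)] assms(3) by (metis linorder_neqE_nat)

section \<open>Equivariant maps from Specht modules\<close>

abbreviation perms :: "nat \<Rightarrow> (nat \<Rightarrow> nat) set" where "perms N \<equiv> {s. s permutes {0..<N}}"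

lemma finite_perms: "finite (perms N)" by (simp add: finite_permutations)

definition matching_inner :: "nat \<Rightarrow> (nat set set \<Rightarrow> real) \<Rightarrow> (nat set set \<Rightarrow> real) \<Rightarrow> real" where
  "matching_inner n f g = (\<Sum>m\<in>matchings n. f m * g m)"

lemma matching_inner_commute: "matching_inner n f g = matching_inner n g f"
  by (simp add: matching_inner_def mult.commute)

lemma matching_inner_sum_right:
  "matching_inner n f (\<lambda>m. \<Sum>i\<in>I. c i * h i m) = (\<Sum>i\<in>I. c i * matching_inner n f (h i))"
  unfolding matching_inner_def sum_distrib_left by (subst sum.swap) (simp add: algebra_simps)

lemma matching_inner_sum_left:
  "matching_inner n (\<lambda>m. \<Sum>i\<in>I. c i * h i m) f = (\<Sum>i\<in>I. c i * matching_inner n (h i) f)"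
  using matching_inner_sum_right by (simp add: matching_inner_commute)

lemma matching_inner_scale:
  "matching_inner n f (\<lambda>m. c * h m) = c * matching_inner n f h"
  "matching_inner n (\<lambda>m. c * h m) f = c * matching_inner n h f"
  by (simp_all add: matching_inner_def sum_distrib_left algebra_simps)

lemma matching_inner_add_left:
  "matching_inner n (\<lambda>m. f m + g m) h = matching_inner n f h + matching_inner n g h"
  by (simp add: matching_inner_def sum.distrib algebra_simps)

lemma matching_inner_pos:
  assumes "m \<in> matchings n" "f m \<noteq> 0" shows "matching_inner n f f > 0"
proof -
  have "0 < f m * f m" using assms(2) by (simp add: zero_less_mult_iff linorder_neq_iff) auto
  then show ?thesis unfolding matching_inner_def
    using assms(1) finite_matchings by (intro sum_pos2[of _ m]) auto
qed

lemma matching_inner_act: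
  assumes "s permutes {0..<2*n}"
  shows "matching_inner n (act_match s f) (act_match s g) = matching_inner n f g"
  unfolding matching_inner_def act_match_relabel
  by (rule sum.reindex_bij_betw[OF bij_betw_relabel[OF permutes_inv[OF assms]]])

lemma act_match_act:
  assumes "s permutes X" "s' permutes X"
  shows "act_match s (act_match s' f) = act_match (s \<circ> s') f"
  using assms by (simp add: act_match_relabel relabel_comp o_inv_distrib permutes_bij)

lemma act_match_id: "act_match id f = f" by (simp add: act_match_relabel)

lemma matching_inner_act_left:
  assumes "s permutes {0..<2*n}"
  shows "matching_inner n f (act_match s g) = matching_inner n (act_match (inv s) f) g"
  using matching_inner_act[OF permutes_inv[OF assms], of f "act_match s g"]
    act_match_act[OF permutes_inv[OF assms] assms, of g]
  by (simp add: permutes_inv_o[OF assms] act_match_id)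

lemma polytabloid_in_specht: "T \<in> tableaux mu N \<Longrightarrow> polytabloid mu N T \<in> specht mu N"
  by (simp add: specht_def lin_span_superset)

lemma act_tab_specht:
  assumes "u \<in> specht mu N" "s permutes {0..<N}" shows "act_tab s u \<in> specht mu N"
  using assms(1) unfolding specht_def
proof (induction rule: lin_span_induct)
  case zero
  then show ?case using lin_span_zero by (simp add: act_tab_def)
next
  case (step u g c)
  then obtain Q where Q: "Q \<in> tableaux mu N" "g = polytabloid mu N Q" by auto
  have "act_tab s g \<in> polytabloid mu N ` tableaux mu N"
    using polytabloid_permuted[OF Q(1) assms(2)] permuted_tableau[OF Q(1) assms(2)] Q(2) by (metis imageI)
  then have "(\<lambda>r. 1 * act_tab s u r + c * act_tab s g r) \<in> lin_span (polytabloid mu N ` tableaux mu N)"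
    by (intro lin_span_lincomb[OF step.IH lin_span_superset])
  then show ?case by (simp add: act_tab_def)
qed

lemma specht_sum:
  assumes "finite I" "\<And>i. i \<in> I \<Longrightarrow> f i \<in> specht mu N"
  shows "(\<lambda>r. \<Sum>i\<in>I. c i * f i r) \<in> specht mu N"
  using assms unfolding specht_def by (rule lin_span_sum)

lemma specht_orbit_combination:
  assumes T: "T \<in> tableaux mu N" and u: "u \<in> specht mu N"
  shows "\<exists>c. u = (\<lambda>r. \<Sum>s\<in>perms N. c s * act_tab s (polytabloid mu N T) r)"
  using u unfolding specht_def
proof (induction rule: lin_span_induct)
  case zero
  then show ?case by (intro exI[of _ "\<lambda>_. 0"]) simp
next
  case (step u g k)
  then obtain c where c: "u = (\<lambda>r. \<Sum>s\<in>perms N. c s * act_tab s (polytabloid mu N T) r)" by auto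
  obtain p where p: "p permutes {0..<N}" "g = act_tab p (polytabloid mu N T)"
    using step polytabloid_conjugate[OF T] by auto
  have "(\<Sum>s\<in>perms N. (if s = p then k else 0) * act_tab s (polytabloid mu N T) r) = k * g r" for r
    using p finite_perms by (subst sum.mono_neutral_right[of _ "{p}"]) auto
  then show ?case
    by (intro exI[of _ "\<lambda>s. c s + (if s = p then k else 0)"])
      (simp only: c distrib_right sum.distrib)
qed

lemma hom_lincomb:
  assumes "equiv_hom n mu phi" "u \<in> specht mu (2*n)" "v \<in> specht mu (2*n)"
  shows "phi (\<lambda>r. a * u r + b * v r) = (\<lambda>m. a * phi u m + b * phi v m)"
  using assms unfolding equiv_hom_def by blast

lemma hom_act:
  assumes "equiv_hom n mu phi" "s permutes {0..<2*n}" "u \<in> specht mu (2*n)"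
  shows "phi (act_tab s u) = act_match s (phi u)"
  using assms unfolding equiv_hom_def by blast

lemma hom_outside:
  assumes "equiv_hom n mu phi" "u \<in> specht mu (2*n)" "m \<notin> matchings n" shows "phi u m = 0"
  using assms unfolding equiv_hom_def by blast

lemma specht_zero: "(\<lambda>_. 0) \<in> specht mu N" unfolding specht_def by (rule lin_span_zero)

lemma hom_zero: assumes "equiv_hom n mu phi" shows "phi (\<lambda>_. 0) = (\<lambda>_. 0)"
  using hom_lincomb[OF assms specht_zero specht_zero, of 0 0] by simp

lemma hom_sum:
  assumes h: "equiv_hom n mu phi" and "finite I" "\<And>i. i \<in> I \<Longrightarrow> f i \<in> specht mu (2*n)"
  shows "phi (\<lambda>r. \<Sum>i\<in>I. c i * f i r) = (\<lambda>m. \<Sum>i\<in>I. c i * phi (f i) m)"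
  using assms(2,3)
proof (induction I rule: finite_induct)
  case (insert i I)
  have "(\<lambda>r. \<Sum>i\<in>I. c i * f i r) \<in> specht mu (2*n)" using insert by (intro specht_sum) auto
  then have "phi (\<lambda>r. c i * f i r + 1 * (\<Sum>i\<in>I. c i * f i r))
      = (\<lambda>m. c i * phi (f i) m + 1 * phi (\<lambda>r. \<Sum>i\<in>I. c i * f i r) m)"
    using insert by (intro hom_lincomb[OF h]) auto
  then show ?case using insert by simp
qed (simp add: hom_zero[OF h])

lemma hom_scale:
  assumes h: "equiv_hom n mu phi" and u: "u \<in> specht mu (2*n)"
  shows "phi (\<lambda>r. c * u r) = (\<lambda>m. c * phi u m)"
  using hom_lincomb[OF h u u, of c 0] by simp

lemma hom_antisymmetrize:
  assumes h: "equiv_hom n nu psi" and T: "T \<in> tableaux mu (2*n)" and v: "v \<in> specht nu (2*n)"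
  shows "psi (antisymmetrize mu (2*n) T v)
    = (\<lambda>m. \<Sum>s\<in>column_group mu (2*n) T. of_int (sign s) * act_match s (psi v) m)"
proof -
  have C: "s permutes {0..<2*n}" if "s \<in> column_group mu (2*n) T" for s
    using that column_group_iff[OF T] by auto
  have "psi (antisymmetrize mu (2*n) T v)
    = (\<lambda>m. \<Sum>s\<in>column_group mu (2*n) T. of_int (sign s) * psi (act_tab s v) m)"
    unfolding antisymmetrize_def
    using C by (intro hom_sum[OF h] finite_column_group[OF T] act_tab_specht[OF v])
  also have "\<dots> = (\<lambda>m. \<Sum>s\<in>column_group mu (2*n) T. of_int (sign s) * act_match s (psi v) m)"
    using C hom_act[OF h _ v] by simp
  finally show ?thesis .
qed

text \<open>The signed column sum can be moved across the invariant inner product onto the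
  polytabloid, on which each column permutation acts by its sign.\<close>

lemma inner_antisymmetrize:
  assumes h: "equiv_hom n mu phi" "equiv_hom n nu psi" and T: "T \<in> tableaux mu (2*n)" and v: "v \<in> specht nu (2*n)"
  shows "matching_inner n (phi (polytabloid mu (2*n) T)) (psi (antisymmetrize mu (2*n) T v))
    = card (column_group mu (2*n) T) * matching_inner n (phi (polytabloid mu (2*n) T)) (psi v)"
proof -
  let ?e = "polytabloid mu (2*n) T"
  have "of_int (sign s) * matching_inner n (phi ?e) (act_match s (psi v)) = matching_inner n (phi ?e) (psi v)"
    if s: "s \<in> column_group mu (2*n) T" for s
  proof -
    have sp: "s permutes {0..<2*n}" using s column_group_iff[OF T] by auto
    have "act_match s (phi ?e) = phi (act_tab s ?e)"
      using hom_act[OF h(1) sp polytabloid_in_specht[OF T]] by simp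
    also have "act_tab s ?e = (\<lambda>r. of_int (sign s) * ?e r)"
      using act_tab_polytabloid_column[OF T s] by blast
    also have "phi \<dots> = (\<lambda>m. of_int (sign s) * phi ?e m)"
      by (rule hom_scale[OF h(1) polytabloid_in_specht[OF T]])
    finally have "matching_inner n (phi ?e) (psi v)
        = matching_inner n (\<lambda>m. of_int (sign s) * phi ?e m) (act_match s (psi v))"
      using matching_inner_act[OF sp, of "phi ?e" "psi v"] by simp
    then show ?thesis by (simp add: matching_inner_scale)
  qed
  then show ?thesis unfolding hom_antisymmetrize[OF h(2) T v] matching_inner_sum_right by simp
qed

text \<open>Pairing with the image of a polytabloid factors through its antisymmetrizer, which
  annihilates the other Specht module if some partial sum is too small. Distinct partitions differ
  in some partial sum, and the symmetry of the inner product allows either shape to play the smaller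
  one.\<close>

lemma hom_orthogonal:
  assumes mu: "mu \<in> partitions (2*n)" and nu: "nu \<in> partitions (2*n)" and "mu \<noteq> nu"
    and phi: "equiv_hom n mu phi" and psi: "equiv_hom n nu psi"
    and u: "u \<in> specht mu (2*n)" and v: "v \<in> specht nu (2*n)"
  shows "matching_inner n (phi u) (psi v) = 0"
proof -
  have main: "matching_inner n (phi u) (psi v) = 0"
    if phi: "equiv_hom n mu phi" and psi: "equiv_hom n nu psi" and mu: "mu \<in> partitions (2*n)"
      and u: "u \<in> specht mu (2*n)" and v: "v \<in> specht nu (2*n)"
      and k: "row_count mu k < row_count nu k" for mu nu phi psi u v k
    using u unfolding specht_def
  proof (induction rule: lin_span_induct)
    case zero
    then show ?case by (simp add: hom_zero[OF phi] matching_inner_def)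
  next
    case (step w g c)
    obtain T where T: "T \<in> tableaux mu (2*n)" "g = polytabloid mu (2*n) T" using step by auto
    have "antisymmetrize mu (2*n) T v = (\<lambda>_. 0)"
      using antisymmetrize_specht_not_dominated[OF mu T(1) v k] by blast
    then have "card (column_group mu (2*n) T) * matching_inner n (phi g) (psi v) = 0"
      using inner_antisymmetrize[OF phi psi T(1) v] unfolding T(2)
      by (simp add: hom_zero[OF psi] matching_inner_def)
    moreover have "card (column_group mu (2*n) T) \<noteq> 0"
      using column_group_id[OF T(1)] finite_column_group[OF T(1)] by auto
    ultimately have "matching_inner n (phi g) (psi v) = 0" by simp
    moreover have "phi (\<lambda>r. 1 * w r + c * g r) = (\<lambda>m. 1 * phi w m + c * phi g m)"
      using step T polytabloid_in_specht by (intro hom_lincomb[OF phi]) (auto simp: specht_def)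
    ultimately show ?case using step by (simp add: matching_inner_add_left matching_inner_scale)
  qed
  obtain k where "row_count mu k < row_count nu k \<or> row_count nu k < row_count mu k"
    using not_mutually_dominating[OF mu nu \<open>mu \<noteq> nu\<close>] by blast
  then show ?thesis
    using main[OF phi psi mu u v] main[OF psi phi nu v u] matching_inner_commute by metis
qed

section \<open>Invariant kernels and multiplicity one\<close>

text \<open>The unnormalised group average of the rank-one kernel \<open>a m * b m'\<close>.\<close>

definition orbit_kernel :: "nat \<Rightarrow> (nat set set \<Rightarrow> real) \<Rightarrow> (nat set set \<Rightarrow> real) \<Rightarrow> nat set set \<Rightarrow> nat set set \<Rightarrow> real" where
  "orbit_kernel n a b m m' = (\<Sum>s\<in>perms (2*n). act_match s a m * act_match s b m')"

definition invariant_kernel :: "nat \<Rightarrow> (nat set set \<Rightarrow> nat set set \<Rightarrow> real) \<Rightarrow> bool" where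
  "invariant_kernel n K \<longleftrightarrow> (\<forall>s m m'. s permutes {0..<2*n} \<longrightarrow> K (relabel s m) (relabel s m') = K m m')"

text \<open>The value 0 outside the matchings is what \<open>equiv_hom\<close> demands of every
  image.\<close>

definition kernel_op :: "nat \<Rightarrow> (nat set set \<Rightarrow> nat set set \<Rightarrow> real) \<Rightarrow> (nat set set \<Rightarrow> real) \<Rightarrow> nat set set \<Rightarrow> real" where
  "kernel_op n K f m = (if m \<in> matchings n then \<Sum>m'\<in>matchings n. K m m' * f m' else 0)"

lemma bij_betw_perms_comp:
  assumes "p permutes {0..<N}" shows "bij_betw (\<lambda>s. p \<circ> s) (perms N) (perms N)"
  using assms permutes_compose[OF _ assms] permutes_compose[OF _ permutes_inv[OF assms]] permutes_inv_o[OF assms]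
  by (intro bij_betw_byWitness[where f'="\<lambda>s. inv p \<circ> s"]) (auto simp: comp_assoc[symmetric])

lemma orbit_kernel_invariant: "invariant_kernel n (orbit_kernel n a b)"
  unfolding invariant_kernel_def
proof (intro allI impI)
  fix p m m' assume p: "p permutes {0..<2*n}"
  have eq: "act_match (p \<circ> s) a (relabel p m) = act_match s a m" if s: "s permutes {0..<2*n}" for s a m
  proof -
    have "act_match (p \<circ> s) a = act_match p (act_match s a)" using act_match_act[OF p s] by simp
    then show ?thesis by (simp add: act_match_relabel relabel_inv[OF p])
  qed
  have "orbit_kernel n a b (relabel p m) (relabel p m')
      = (\<Sum>s\<in>perms (2*n). act_match (p \<circ> s) a (relabel p m) * act_match (p \<circ> s) b (relabel p m'))"
    unfolding orbit_kernel_def by (rule sum.reindex_bij_betw[OF bij_betw_perms_comp[OF p], symmetric])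
  also have "\<dots> = orbit_kernel n a b m m'"
    unfolding orbit_kernel_def by (intro sum.cong) (auto simp: eq)
  finally show "orbit_kernel n a b (relabel p m) (relabel p m') = orbit_kernel n a b m m'" .
qed

lemma invariant_kernel_cycle_type:
  assumes "invariant_kernel n K" "m \<in> matchings n" "m' \<in> matchings n" "k \<in> matchings n" "k' \<in> matchings n"
    and "cycle_type n m m' = cycle_type n k k'"
  shows "K m m' = K k k'"
  using same_cycle_type_conjugate[OF assms(2-6)] assms(1) unfolding invariant_kernel_def by metis

text \<open>Exchanging the two matchings preserves the cycle type, so the exchanged pair is a
  relabelling of the original one. This is the Gelfand pair property behind multiplicity
  one.\<close>

lemma invariant_kernel_symmetric:
  assumes "invariant_kernel n K" "m \<in> matchings n" "m' \<in> matchings n"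
  shows "K m m' = K m' m"
  using invariant_kernel_cycle_type[OF assms(1,2,3,3,2)] cycle_type_commute by blast

lemma kernel_op_orbit_kernel:
  assumes "m \<in> matchings n"
  shows "kernel_op n (orbit_kernel n a b) f m = (\<Sum>s\<in>perms (2*n). matching_inner n (act_match s b) f * act_match s a m)"
  using assms unfolding kernel_op_def orbit_kernel_def matching_inner_def sum_distrib_right
  by (subst sum.swap) (simp add: algebra_simps)

lemma kernel_op_act:
  assumes K: "invariant_kernel n K" and s: "s permutes {0..<2*n}"
  shows "kernel_op n K (act_match s f) = act_match s (kernel_op n K f)"
proof
  fix m
  note si = permutes_inv[OF s]
  have "(\<Sum>m'\<in>matchings n. K m m' * f (relabel (inv s) m'))
    = (\<Sum>m'\<in>matchings n. K (relabel (inv s) m) (relabel (inv s) m') * f (relabel (inv s) m'))"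
    using K si by (simp add: invariant_kernel_def)
  also have "\<dots> = (\<Sum>m'\<in>matchings n. K (relabel (inv s) m) m' * f m')"
    by (rule sum.reindex_bij_betw[OF bij_betw_relabel[OF si]])
  finally show "kernel_op n K (act_match s f) m = act_match s (kernel_op n K f) m"
    using relabel_matchings_iff[OF si, of m] by (simp add: kernel_op_def act_match_relabel)
qed

lemma kernel_op_lincomb: "kernel_op n K (\<lambda>m. a * f m + b * g m) = (\<lambda>m. a * kernel_op n K f m + b * kernel_op n K g m)"
  by (auto simp: kernel_op_def fun_eq_iff sum.distrib sum_distrib_left algebra_simps)

lemma kernel_op_sum: "kernel_op n K (\<lambda>m. \<Sum>i\<in>I. c i * h i m) = (\<lambda>m. \<Sum>i\<in>I. c i * kernel_op n K (h i) m)"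
  unfolding kernel_op_def fun_eq_iff
  by (auto simp: sum_distrib_left algebra_simps intro: sum.swap)

lemma equiv_hom_kernel_op:
  assumes h: "equiv_hom n mu phi" and K: "invariant_kernel n K"
  shows "equiv_hom n mu (\<lambda>u. kernel_op n K (phi u))"
  unfolding equiv_hom_def
  using hom_lincomb[OF h] hom_act[OF h] kernel_op_act[OF K]
  by (auto simp: kernel_op_lincomb) (simp_all add: kernel_op_def)

text \<open>Summing the product of act_match s a and act_match s b over all permutations s gives an invariant, hence
  symmetric, kernel; applied to b its two forms compare phi with psi.\<close>

lemma hom_unique:
  assumes mu: "mu \<in> partitions (2*n)" and T: "T \<in> tableaux mu (2*n)"
    and phi: "equiv_hom n mu phi" and psi: "equiv_hom n mu psi"
    and nz: "psi (polytabloid mu (2*n) T) m0 \<noteq> 0"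
  shows "\<exists>k. \<forall>u\<in>specht mu (2*n). phi u = (\<lambda>m. k * psi u m)"
proof -
  define e where "e = polytabloid mu (2*n) T"
  define C where "C = column_group mu (2*n) T"
  have e: "e \<in> specht mu (2*n)" using polytabloid_in_specht[OF T] by (simp add: e_def)
  define a where "a = phi e"
  define b where "b = psi e"
  let ?ip = "matching_inner n"
  let ?S = "perms (2*n)"
  have cC: "real (card C) > 0"
    using column_group_id[OF T] finite_column_group[OF T] by (auto simp: C_def card_gt_0_iff)
  have m0: "m0 \<in> matchings n" using nz hom_outside[OF psi e] unfolding e_def by blast
  have bb: "?ip b b > 0" using matching_inner_pos[OF m0] nz by (simp add: b_def e_def)
  have "\<forall>s\<in>?S. \<exists>c. \<forall>r. antisymmetrize mu (2*n) T (act_tab s e) r = c * e r"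
    using antisymmetrize_specht_same_shape[OF mu T] act_tab_specht[OF e] unfolding e_def by blast
  then obtain d where d: "\<And>s r. s \<in> ?S \<Longrightarrow> antisymmetrize mu (2*n) T (act_tab s e) r = d s * e r"
    using bchoice[of ?S "\<lambda>s c. \<forall>r. antisymmetrize mu (2*n) T (act_tab s e) r = c * e r"] by blast
  \<comment> \<open>A matrix coefficient that depends only on the Specht module: the pairing of
    \<open>f e\<close> with \<open>act_match s (f' e)\<close> is \<open>g s\<close> times that of
    \<open>f e\<close> with \<open>f' e\<close>, whichever homomorphisms \<open>f\<close> and
    \<open>f'\<close> are used.\<close>
  define g where "g s = d s / card C" for s
  have g: "?ip (f e) (act_match s (f' e)) = g s * ?ip (f e) (f' e)"
    if f: "equiv_hom n mu f" "equiv_hom n mu f'" and s: "s \<in> ?S" for f f' s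
  proof -
    have se: "act_tab s e \<in> specht mu (2*n)" using act_tab_specht[OF e] s by auto
    have "antisymmetrize mu (2*n) T (act_tab s e) = (\<lambda>r. d s * e r)" using d[OF s] by blast
    then have "card C * ?ip (f e) (f' (act_tab s e)) = ?ip (f e) (f' (\<lambda>r. d s * e r))"
      using inner_antisymmetrize[OF f T se] unfolding C_def e_def by simp
    also have "\<dots> = d s * ?ip (f e) (f' e)" by (simp add: hom_scale[OF f(2) e] matching_inner_scale)
    finally show ?thesis using cC hom_act[OF f(2) _ e] s by (simp add: g_def field_simps)
  qed
  \<comment> \<open>Applied to \<open>b\<close>, the kernel built from \<open>a\<close> and
    \<open>b\<close> gives \<open>?ip b b\<close> times \<open>phi y\<close>, and the kernel with
    \<open>a\<close> and \<open>b\<close> exchanged gives \<open>?ip b a\<close> times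
    \<open>psi y\<close>. Symmetry of the kernel equates them.\<close>
  define y where "y = (\<lambda>r. \<Sum>s\<in>?S. g s * act_tab s e r)"
  have y: "y \<in> specht mu (2*n)"
    unfolding y_def using act_tab_specht[OF e] by (intro specht_sum finite_perms) auto
  have fy: "f y = (\<lambda>m. \<Sum>s\<in>?S. g s * act_match s (f e) m)" if f: "equiv_hom n mu f" for f
  proof -
    have "f y = (\<lambda>m. \<Sum>s\<in>?S. g s * f (act_tab s e) m)"
      unfolding y_def using act_tab_specht[OF e] by (intro hom_sum[OF f] finite_perms) auto
    then show ?thesis using hom_act[OF f _ e] by simp
  qed
  \<comment> \<open>The relation at \<open>y\<close> is carried back to the generator
    \<open>e\<close> by antisymmetrizing; this loses nothing provided that \<open>c\<close> is
    nonzero.\<close>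
  obtain c where c: "antisymmetrize mu (2*n) T y = (\<lambda>r. c * e r)"
    using antisymmetrize_specht_same_shape[OF mu T y] unfolding e_def by blast
  have key: "?ip b b * phi y m = ?ip b a * psi y m" for m
  proof (cases "m \<in> matchings n")
    case True
    have "kernel_op n (orbit_kernel n a b) b m = kernel_op n (orbit_kernel n b a) b m"
    proof -
      have "orbit_kernel n a b m m' = orbit_kernel n b a m m'" if "m' \<in> matchings n" for m'
      proof -
        have "orbit_kernel n a b m m' = orbit_kernel n a b m' m"
          by (rule invariant_kernel_symmetric[OF orbit_kernel_invariant True that])
        then show ?thesis by (simp add: orbit_kernel_def mult.commute)
      qed
      then show ?thesis by (simp add: kernel_op_def)
    qed
    moreover have "?ip (act_match s b) b = g s * ?ip b b" "?ip (act_match s a) b = g s * ?ip b a" if "s \<in> ?S" for s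
      using g[OF psi psi that] g[OF psi phi that] matching_inner_commute unfolding a_def b_def by metis+
    ultimately have "(\<Sum>s\<in>?S. g s * ?ip b b * act_match s a m) = (\<Sum>s\<in>?S. g s * ?ip b a * act_match s b m)"
      unfolding kernel_op_orbit_kernel[OF True] by simp
    then show ?thesis unfolding fy[OF phi] fy[OF psi] a_def[symmetric] b_def[symmetric] sum_distrib_left
      by (simp add: algebra_simps)
  next
    case False
    then show ?thesis using hom_outside[OF phi y] hom_outside[OF psi y] by simp
  qed
  have "?ip b b * (c * a m) = ?ip b a * (c * b m)" for m
  proof -
    have "phi (antisymmetrize mu (2*n) T y) = (\<lambda>m. c * a m)" "psi (antisymmetrize mu (2*n) T y) = (\<lambda>m. c * b m)"
      unfolding c a_def b_def by (simp_all only: hom_scale[OF phi e] hom_scale[OF psi e])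
    then have a: "c * a m = (\<Sum>s\<in>C. of_int (sign s) * act_match s (phi y) m)"
       and b: "c * b m = (\<Sum>s\<in>C. of_int (sign s) * act_match s (psi y) m)"
      unfolding hom_antisymmetrize[OF phi T y] hom_antisymmetrize[OF psi T y] C_def by metis+
    have "?ip b b * (of_int (sign s) * act_match s (phi y) m) = ?ip b a * (of_int (sign s) * act_match s (psi y) m)" for s
      using key unfolding act_match_relabel by (metis mult.left_commute)
    then show ?thesis unfolding a b sum_distrib_left by (intro sum.cong refl)
  qed
  \<comment> \<open>Pairing with \<open>b\<close> evaluates \<open>c\<close> as the order of the
    column group times the sum of the squares of \<open>g\<close>, and
    \<open>g id = 1\<close>.\<close>
  moreover have "c \<noteq> 0"
  proof -
    have "c * ?ip b b = ?ip b (psi (antisymmetrize mu (2*n) T y))"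
      by (simp add: c hom_scale[OF psi e] matching_inner_scale b_def)
    also have "\<dots> = card C * ?ip b (psi y)"
      using inner_antisymmetrize[OF psi psi T y] by (simp add: b_def e_def C_def)
    also have "?ip b (psi y) = (\<Sum>s\<in>?S. (g s)\<^sup>2) * ?ip b b"
      unfolding fy[OF psi] matching_inner_sum_right sum_distrib_right b_def using g[OF psi psi]
      by (intro sum.cong) (auto simp: power2_eq_square)
    finally have "c = card C * (\<Sum>s\<in>?S. (g s)\<^sup>2)" using bb by simp
    moreover have "g id = 1" using g[OF psi psi, of id] bb by (simp add: act_match_id b_def permutes_id)
    then have "(\<Sum>s\<in>?S. (g s)\<^sup>2) > 0"
      using finite_perms by (intro sum_pos2[of _ id]) (auto simp: permutes_id)
    ultimately show ?thesis using cC by simp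
  qed
  ultimately have ab: "a m = ?ip b a / ?ip b b * b m" for m using bb by (simp add: field_simps)
  show ?thesis
  proof (intro exI ballI)
    fix u assume "u \<in> specht mu (2*n)"
    then obtain c where u: "u = (\<lambda>r. \<Sum>s\<in>?S. c s * act_tab s e r)"
      using specht_orbit_combination[OF T] unfolding e_def by blast
    have f: "f u = (\<lambda>m. \<Sum>s\<in>?S. c s * act_match s (f e) m)" if f: "equiv_hom n mu f" for f
    proof -
      have "f u = (\<lambda>m. \<Sum>s\<in>?S. c s * f (act_tab s e) m)"
        unfolding u using act_tab_specht[OF e] by (intro hom_sum[OF f] finite_perms) auto
      then show ?thesis using hom_act[OF f _ e] by simp
    qed
    show "phi u = (\<lambda>m. ?ip b a / ?ip b b * psi u m)"
      unfolding f[OF phi] f[OF psi] a_def[symmetric] b_def[symmetric]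
      by (simp add: act_match_relabel ab sum_distrib_left algebra_simps)
  qed
qed

section \<open>The embedding of the Specht modules into functions on matchings\<close>

definition row_compatible :: "(nat \<Rightarrow> nat) \<Rightarrow> nat set set \<Rightarrow> bool" where
  "row_compatible r m \<longleftrightarrow> (\<forall>e\<in>m. \<forall>x\<in>e. \<forall>y\<in>e. r x = r y)"

lemma row_compatible_relabel:
  assumes "s permutes X" shows "row_compatible (r \<circ> s) (relabel (inv s) m) \<longleftrightarrow> row_compatible r m"
  by (auto simp: row_compatible_def relabel_def permutes_inverses[OF assms])

definition tabloids :: "nat list \<Rightarrow> nat \<Rightarrow> (nat \<Rightarrow> nat) set" where
  "tabloids mu N = tabloid_of mu N ` tableaux mu N"

lemma finite_tabloids: "finite (tabloids mu N)"
proof (rule finite_subset)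
  show "tabloids mu N \<subseteq> {f. \<forall>x. (x \<in> {0..<N} \<longrightarrow> f x \<in> {..<length mu}) \<and> (x \<notin> {0..<N} \<longrightarrow> f x = 0)}"
  proof
    fix r assume "r \<in> tabloids mu N"
    then obtain T where T: "T \<in> tableaux mu N" "r = tabloid_of mu N T" by (auto simp: tabloids_def)
    then show "r \<in> {f. \<forall>x. (x \<in> {0..<N} \<longrightarrow> f x \<in> {..<length mu}) \<and> (x \<notin> {0..<N} \<longrightarrow> f x = 0)}"
      using tableau_cell(1)[OF T(1)] by (auto simp: tabloid_of_row[OF T(1)] cells_def)
  qed
  show "finite {f. \<forall>x. (x \<in> {0..<N} \<longrightarrow> f x \<in> {..<length mu}) \<and> (x \<notin> {0..<N} \<longrightarrow> f x = 0)}"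
    by (rule finite_set_of_finite_funs) auto
qed

lemma tabloids_comp:
  assumes "r \<in> tabloids mu N" "s permutes {0..<N}" shows "r \<circ> s \<in> tabloids mu N"
proof -
  obtain T where T: "T \<in> tableaux mu N" "r = tabloid_of mu N T" using assms(1) by (auto simp: tabloids_def)
  have "r \<circ> s = tabloid_of mu N (inv s \<circ> T)"
    using tabloid_of_permuted[OF T(1) permutes_inv[OF assms(2)]] T(2) by (simp add: permutes_inv_inv[OF assms(2)])
  then show ?thesis using permuted_tableau[OF T(1) permutes_inv[OF assms(2)]] by (auto simp: tabloids_def)
qed

lemma bij_betw_tabloids_comp:
  assumes "s permutes {0..<N}" shows "bij_betw (\<lambda>r. r \<circ> s) (tabloids mu N) (tabloids mu N)"
  using tabloids_comp assms permutes_inv[OF assms] permutes_inv_o[OF assms]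
  by (intro bij_betw_byWitness[where f'="\<lambda>r. r \<circ> inv s"]) (auto simp: comp_assoc)

definition row_matchings :: "nat \<Rightarrow> (nat \<Rightarrow> nat) \<Rightarrow> nat set set \<Rightarrow> real" where
  "row_matchings n r m = (if m \<in> matchings n \<and> row_compatible r m then 1 else 0)"

text \<open>The linear map that sends a tabloid to the sum of the matchings whose edges stay inside
  its rows. It is defined on all tabloid functions and used on the Specht module.\<close>

definition row_matching_hom :: "nat \<Rightarrow> nat list \<Rightarrow> ((nat \<Rightarrow> nat) \<Rightarrow> real) \<Rightarrow> nat set set \<Rightarrow> real" where
  "row_matching_hom n mu u m = (\<Sum>r\<in>tabloids mu (2*n). u r * row_matchings n r m)"

lemma act_match_row_matchings:
  assumes "s permutes {0..<2*n}" shows "act_match s (row_matchings n r) = row_matchings n (r \<circ> inv s)"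
proof
  fix m
  have "row_compatible (r \<circ> inv s) m \<longleftrightarrow> row_compatible r (relabel (inv s) m)"
    using row_compatible_relabel[OF assms, of "r \<circ> inv s" m] by (simp add: comp_assoc permutes_inv_o[OF assms])
  then show "act_match s (row_matchings n r) m = row_matchings n (r \<circ> inv s) m"
    using relabel_matchings_iff[OF permutes_inv[OF assms], of m] by (simp add: act_match_relabel row_matchings_def)
qed

lemma equiv_hom_row_matching_hom: "equiv_hom n mu (row_matching_hom n mu)"
  unfolding equiv_hom_def
proof (intro conjI ballI allI impI)
  fix u v a b
  show "row_matching_hom n mu (\<lambda>r. a * u r + b * v r)
      = (\<lambda>m. a * row_matching_hom n mu u m + b * row_matching_hom n mu v m)"
    by (rule ext) (simp add: row_matching_hom_def sum.distrib sum_distrib_left algebra_simps)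
next
  fix s u assume "s permutes {0..<2*n} \<and> u \<in> specht mu (2*n)"
  then have s: "s permutes {0..<2*n}" by simp
  show "row_matching_hom n mu (act_tab s u) = act_match s (row_matching_hom n mu u)"
  proof
    fix m
    have "row_matchings n r m = row_matchings n (r \<circ> s) (relabel (inv s) m)" for r
      using fun_cong[OF act_match_row_matchings[OF s, of "r \<circ> s"], of m]
      by (simp add: act_match_relabel comp_assoc permutes_inv_o[OF s])
    then have "row_matching_hom n mu (act_tab s u) m
      = (\<Sum>r\<in>tabloids mu (2*n). u (r \<circ> s) * row_matchings n (r \<circ> s) (relabel (inv s) m))"
      by (simp add: row_matching_hom_def act_tab_def)
    also have "\<dots> = (\<Sum>r\<in>tabloids mu (2*n). u r * row_matchings n r (relabel (inv s) m))"
      by (rule sum.reindex_bij_betw[OF bij_betw_tabloids_comp[OF s]])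
    finally show "row_matching_hom n mu (act_tab s u) m = act_match s (row_matching_hom n mu u) m"
      by (simp add: row_matching_hom_def act_match_relabel)
  qed
next
  fix u m assume "m \<notin> matchings n"
  then show "row_matching_hom n mu u m = 0" by (simp add: row_matching_hom_def row_matchings_def)
qed

lemma row_matching_hom_polytabloid:
  assumes T: "T \<in> tableaux mu (2*n)"
  shows "row_matching_hom n mu (polytabloid mu (2*n) T) = (\<lambda>m. \<Sum>s\<in>column_group mu (2*n) T.
    of_int (sign s) * act_match s (row_matchings n (tabloid_of mu (2*n) T)) m)"
proof
  fix m
  let ?C = "column_group mu (2*n) T"
  have C: "s permutes {0..<2*n}" if "s \<in> ?C" for s using that column_group_iff[OF T] by auto
  have "row_matching_hom n mu (polytabloid mu (2*n) T) m
      = (\<Sum>s\<in>?C. of_int (sign s) * (\<Sum>r\<in>tabloids mu (2*n). (if r = tabloid_of mu (2*n) (s \<circ> T) then row_matchings n r m else 0)))"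
    unfolding row_matching_hom_def polytabloid_def sum_distrib_right sum_distrib_left
    by (subst sum.swap) (intro sum.cong refl, simp)
  also have "\<dots> = (\<Sum>s\<in>?C. of_int (sign s) * row_matchings n (tabloid_of mu (2*n) (s \<circ> T)) m)"
  proof (intro sum.cong refl)
    fix s assume "s \<in> ?C"
    then have "tabloid_of mu (2*n) (s \<circ> T) \<in> tabloids mu (2*n)"
      using permuted_tableau[OF T] C by (auto simp: tabloids_def)
    then show "of_int (sign s) * (\<Sum>r\<in>tabloids mu (2*n). (if r = tabloid_of mu (2*n) (s \<circ> T) then row_matchings n r m else 0))
       = of_int (sign s) * row_matchings n (tabloid_of mu (2*n) (s \<circ> T)) m"
      using finite_tabloids by (simp add: sum.delta)
  qed
  also have "\<dots> = (\<Sum>s\<in>?C. of_int (sign s) * act_match s (row_matchings n (tabloid_of mu (2*n) T)) m)"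
    using C by (intro sum.cong refl) (simp add: tabloid_of_permuted[OF T] act_match_row_matchings)
  finally show "row_matching_hom n mu (polytabloid mu (2*n) T) m
    = (\<Sum>s\<in>?C. of_int (sign s) * act_match s (row_matchings n (tabloid_of mu (2*n) T)) m)" .
qed

lemma involution_matching:
  assumes "\<And>x. x < 2*n \<Longrightarrow> f x < 2*n" "\<And>x. x < 2*n \<Longrightarrow> f (f x) = x" "\<And>x. x < 2*n \<Longrightarrow> f x \<noteq> x"
  shows "(\<lambda>x. {x, f x}) ` {0..<2*n} \<in> matchings n"
proof -
  have "{x, f x} \<inter> {y, f y} = {}" if "x < 2*n" "y < 2*n" "{x, f x} \<noteq> {y, f y}" for x y
  proof (rule ccontr)
    assume "{x, f x} \<inter> {y, f y} \<noteq> {}"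
    then consider "x = y" | "x = f y" | "f x = y" | "f x = f y" by auto
    then have "x = y \<or> x = f y" using assms(2)[OF that(1)] assms(2)[OF that(2)] by cases metis+
    then have "{x, f x} = {y, f y}" using assms(2)[OF that(2)] by auto
    then show False using that(3) by simp
  qed
  moreover have "card {x, f x} = 2" if "x < 2*n" for x using assms(3)[OF that] by simp
  ultimately show ?thesis using assms(1) unfolding matchings_def by auto
qed

lemma double_partitions: "la \<in> partitions n \<Longrightarrow> double la \<in> partitions (2*n)"
proof -
  assume "la \<in> partitions n"
  moreover have "sum_list (map (\<lambda>k. 2 * k) la) = 2 * sum_list la" by (simp add: sum_list_const_mult)
  ultimately show ?thesis
    by (auto simp: partitions_def double_def sorted_wrt_map)
qed

lemma double_cells: "(i, j) \<in> cells (double la) \<Longrightarrow> (i, if even j then j + 1 else j - 1) \<in> cells (double la)"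
proof -
  assume "(i, j) \<in> cells (double la)"
  then have "i < length la" "j < 2 * la ! i" by (auto simp: cells_def double_def)
  moreover from this have "even j \<Longrightarrow> j + 1 < 2 * la ! i" by presburger
  ultimately show ?thesis by (auto simp: cells_def double_def)
qed

text \<open>Conjugates have equal signs. In the application \<open>a\<close> is the part of a column
  permutation on the even columns and its conjugate is the part on the odd columns.\<close>

lemma conjugate_split_sign:
  assumes "a permutes {0..<N::nat}" "f permutes {0..<N}"
  shows "sign (a \<circ> (f \<circ> a \<circ> inv f)) = (1::int)"
proof -
  have c: "a \<circ> inv f permutes {0..<N}" by (rule permutes_compose[OF permutes_inv[OF assms(2)] assms(1)])
  then have c': "f \<circ> (a \<circ> inv f) permutes {0..<N}" by (rule permutes_compose[OF _ assms(2)])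
  have "sign (a \<circ> (f \<circ> (a \<circ> inv f))) = sign a * (sign f * (sign a * sign f))"
    using sign_compose_permutes[OF assms(1) c'] sign_compose_permutes[OF assms(2) c]
      sign_compose_permutes[OF assms(1) permutes_inv[OF assms(2)]] sign_inv_permutes[OF assms(2)] by simp
  also have "\<dots> = 1" by (simp add: sign_def)
  finally show ?thesis by (simp add: comp_assoc)
qed

text \<open>The witness is the matching joining the cells (i, 2j) and (i, 2j+1) of T. A column permutation that
  keeps it inside the rows acts in the same way on the columns 2j and 2j+1, so it is even and no
  cancellation occurs.\<close>

lemma row_matching_hom_nonzero:
  assumes T: "T \<in> tableaux (double la) (2*n)"
  shows "\<exists>m\<in>matchings n. row_matching_hom n (double la) (polytabloid (double la) (2*n) T) m \<noteq> 0"
proof -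
  let ?mu = "double la" and ?N = "2*n"
  let ?row = "row_of ?mu T" and ?col = "col_of ?mu T" and ?C = "column_group (double la) (2*n) T"
  define flip where "flip j = (if even j then j + 1 else j - 1)" for j :: nat
  have flip: "flip (flip j) = j" "flip j \<noteq> j" "even (flip j) \<longleftrightarrow> odd j" for j
    by (auto simp: flip_def elim: oddE)
  define f where "f x = (if x < ?N then T (?row x, flip (?col x)) else x)" for x
  have cell: "(?row x, flip (?col x)) \<in> cells ?mu" if "x < ?N" for x
    using double_cells[OF tableau_cell(1)[OF T that]] by (simp add: flip_def)
  have f: "f x < ?N" "?row (f x) = ?row x" "?col (f x) = flip (?col x)" if "x < ?N" for x
    using tableau_entry[OF T cell[OF that]] that by (auto simp: f_def)
  have ff: "f (f x) = x" for x
  proof (cases "x < ?N")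
    case True
    then have "f (f x) = T (?row (f x), flip (?col (f x)))" using f(1) by (subst f_def) simp
    then show ?thesis using f(2,3)[OF True] flip tableau_cell(2)[OF T True] by simp
  qed (simp add: f_def)
  have fneq: "f x \<noteq> x" if "x < ?N" for x using f(3)[OF that] flip by metis
  have fperm: "f permutes {0..<?N}"
  proof (rule bij_imp_permutes)
    show "bij_betw f {0..<?N} {0..<?N}" by (rule bij_betw_byWitness[where f'=f]) (auto simp: ff f)
  qed (simp add: f_def)
  have invf: "inv f = f" using ff by (intro inv_unique_comp) (auto simp: fun_eq_iff)
  define m where "m = (\<lambda>x. {x, f x}) ` {0..<?N}"
  have m: "m \<in> matchings n" unfolding m_def using f ff fneq by (intro involution_matching) auto
  have sign1: "sign s = 1" if s: "s \<in> ?C" and c: "row_compatible (tabloid_of ?mu ?N T \<circ> inv s) m" for s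
  proof -
    define p where "p = inv s"
    have sp: "s permutes {0..<?N}" using s column_group_iff[OF T] by auto
    have pC: "p \<in> ?C" using column_group_inv[OF T s] by (simp add: p_def)
    have p: "p permutes {0..<?N}" "\<And>x. x < ?N \<Longrightarrow> ?col (p x) = ?col x"
      using pC column_group_iff[OF T] by auto
    have pN: "p x < ?N \<longleftrightarrow> x < ?N" for x using permutes_in_image[OF p(1), of x] by simp
    \<comment> \<open>\<open>p\<close> keeps columns because it lies in the column group, and it
      keeps \<open>x\<close> and \<open>f x\<close> in a common row because the matching is
      compatible. Row and column determine an entry.\<close>
    have pf: "p (f x) = f (p x)" if x: "x < ?N" for x
    proof -
      have "{x, f x} \<in> m" using x by (auto simp: m_def)
      then have "tabloid_of ?mu ?N T (p (f x)) = tabloid_of ?mu ?N T (p x)"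
        using c[unfolded row_compatible_def, rule_format, of "{x, f x}" "f x" x] by (simp add: p_def)
      then have "?row (p (f x)) = ?row (p x)" using f(1)[OF x] x pN by (simp add: tabloid_of_row[OF T])
      then have "?row (p (f x)) = ?row (f (p x))" "?col (p (f x)) = ?col (f (p x))"
        using f x pN p(2) by auto
      then show ?thesis using tableau_cell(2)[OF T, of "p (f x)"] tableau_cell(2)[OF T, of "f (p x)"]
        f(1) x pN by metis
    qed
    define a where "a x = (if x < ?N \<and> even (?col x) then p x else x)" for x
    have aperm: "a permutes {0..<?N}"
    proof (rule bij_imp_permutes)
      have "inj_on a {0..<?N}"
      proof (rule inj_onI)
        fix x y assume xy: "x \<in> {0..<?N}" "y \<in> {0..<?N}" "a x = a y"
        have "?col (a z) = ?col z" if "z \<in> {0..<?N}" for z using p(2)[of z] that by (simp add: a_def)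
        then have "?col (a x) = ?col x" "?col (a y) = ?col y" using xy by blast+
        then have "even (?col x) = even (?col y)" using xy(3) by simp
        then show "x = y" using xy injD[OF permutes_inj[OF p(1)], of x y]
          by (cases "even (?col x)") (simp_all add: a_def)
      qed
      moreover have "a ` {0..<?N} \<subseteq> {0..<?N}"
        using pN unfolding a_def by (intro image_subsetI) simp
      ultimately show "bij_betw a {0..<?N} {0..<?N}" by (simp add: bij_betw_def endo_inj_surj)
    qed (simp add: a_def)
    have "p = a \<circ> (f \<circ> a \<circ> inv f)"
    proof
      fix x
      show "p x = (a \<circ> (f \<circ> a \<circ> inv f)) x"
      proof (cases "x < ?N")
        case True
        show ?thesis
        proof (cases "even (?col x)")
          case True
          then show ?thesis using \<open>x < ?N\<close> f[of x] flip ff by (simp add: a_def invf)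
        next
          case False
          have "f (p (f x)) = p x" using pf[OF \<open>x < ?N\<close>] ff by simp
          then show ?thesis using False \<open>x < ?N\<close> f[of x] flip ff p(2) pN by (simp add: a_def invf)
        qed
      next
        case False
        then have "f x = x" "p x = x" using permutes_not_in[OF p(1), of x] by (auto simp: f_def)
        then show ?thesis using False by (simp add: a_def invf)
      qed
    qed
    then have "sign p = 1" using conjugate_split_sign[OF aperm fperm] by simp
    then show ?thesis using sign_inv_permutes[OF sp] by (simp add: p_def)
  qed
  have "row_compatible (tabloid_of ?mu ?N T) m"
    using f by (auto simp: row_compatible_def m_def tabloid_of_row[OF T])
  then have pos: "act_match id (row_matchings n (tabloid_of ?mu ?N T)) m = 1"
    using m by (simp add: act_match_id row_matchings_def)
  \<comment> \<open>Only even permutations contribute, so all summands are nonnegative, and the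
    identity contributes 1.\<close>
  have nonneg: "0 \<le> of_int (sign s) * act_match s (row_matchings n (tabloid_of ?mu ?N T)) m" if "s \<in> ?C" for s
  proof -
    have s: "s permutes {0..<?N}" using that column_group_iff[OF T] by auto
    show ?thesis using sign1[OF that] unfolding act_match_row_matchings[OF s] by (auto simp: row_matchings_def)
  qed
  have "0 < (\<Sum>s\<in>?C. of_int (sign s) * act_match s (row_matchings n (tabloid_of ?mu ?N T)) m)"
    by (rule sum_pos2[OF finite_column_group[OF T] column_group_id[OF T]]) (use pos nonneg in auto)
  then show ?thesis using m unfolding row_matching_hom_polytabloid[OF T] by force
qed

section \<open>The isotypic decomposition\<close>

lemma finite_partitions: "finite (partitions n)"
proof (rule finite_subset)
  have len: "length l \<le> sum_list l" if "0 \<notin> set l" for l :: "nat list"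
    using that by (induction l) auto
  show "partitions n \<subseteq> {l. set l \<subseteq> {..n} \<and> length l \<le> n}"
    using len member_le_sum_list by (fastforce simp: partitions_def)
  show "finite {l. set l \<subseteq> {..n} \<and> length l \<le> n}" by (intro finite_lists_length_le) simp
qed

definition cycle_kernel :: "nat \<Rightarrow> nat list \<Rightarrow> nat set set \<Rightarrow> nat set set \<Rightarrow> real" where
  "cycle_kernel n rho m m' = (if cycle_type n m m' = rho then 1 else 0)"

lemma cycle_kernel_invariant: "invariant_kernel n (cycle_kernel n rho)"
  by (simp add: invariant_kernel_def cycle_kernel_def cycle_type_relabel)

lemma assoc_op_kernel_op: "assoc_op n rho = kernel_op n (cycle_kernel n rho)"
  by (auto simp: assoc_op_def kernel_op_def cycle_kernel_def fun_eq_iff)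

text \<open>The tableaux are a parameter so that the one for the hook can later be chosen to fit the
  fixed edges.\<close>

locale tableau_family =
  fixes n :: nat and tab :: "nat list \<Rightarrow> nat \<times> nat \<Rightarrow> nat"
  assumes tab: "la \<in> partitions n \<Longrightarrow> tab la \<in> tableaux (double la) (2*n)"
begin

abbreviation poly :: "nat list \<Rightarrow> (nat \<Rightarrow> nat) \<Rightarrow> real" where
  "poly la \<equiv> polytabloid (double la) (2*n) (tab la)"

abbreviation hom :: "nat list \<Rightarrow> ((nat \<Rightarrow> nat) \<Rightarrow> real) \<Rightarrow> nat set set \<Rightarrow> real" where
  "hom la \<equiv> row_matching_hom n (double la)"

definition gen :: "nat list \<Rightarrow> nat set set \<Rightarrow> real" where "gen la = hom la (poly la)"

lemma poly_specht: "la \<in> partitions n \<Longrightarrow> poly la \<in> specht (double la) (2*n)"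
  by (intro polytabloid_in_specht tab)

lemma gen_nonzero: "la \<in> partitions n \<Longrightarrow> \<exists>m\<in>matchings n. gen la m \<noteq> 0"
  unfolding gen_def by (intro row_matching_hom_nonzero tab)

lemma gen_inner_pos: "la \<in> partitions n \<Longrightarrow> matching_inner n (gen la) (gen la) > 0"
  using gen_nonzero matching_inner_pos by blast

lemma act_gen:
  "la \<in> partitions n \<Longrightarrow> s permutes {0..<2*n} \<Longrightarrow> act_match s (gen la) = hom la (act_tab s (poly la))"
  unfolding gen_def using hom_act[OF equiv_hom_row_matching_hom _ poly_specht] by simp

lemma act_gen_isotypic:
  assumes "la \<in> partitions n" "s permutes {0..<2*n}" shows "act_match s (gen la) \<in> isotypic n (double la)"
  unfolding isotypic_def act_gen[OF assms] using assms equiv_hom_row_matching_hom poly_specht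
  by (intro lin_span_superset CollectI exI[of _ "hom la"] exI[of _ "act_tab s (poly la)"])
    (auto intro: act_tab_specht)

lemma gen_isotypic: "la \<in> partitions n \<Longrightarrow> gen la \<in> isotypic n (double la)"
  using act_gen_isotypic[of la id] by (simp add: act_match_id permutes_id)

text \<open>Multiplicity one: \<open>hom la\<close> spans the equivariant maps on this Specht
  module.\<close>

lemma hom_multiple:
  assumes "la \<in> partitions n" "equiv_hom n (double la) phi"
  shows "\<exists>k. \<forall>u\<in>specht (double la) (2*n). phi u = (\<lambda>m. k * hom la u m)"
proof -
  obtain m where "gen la m \<noteq> 0" using gen_nonzero assms(1) by blast
  then show ?thesis unfolding gen_def
    using hom_unique[OF double_partitions tab assms(2) equiv_hom_row_matching_hom] assms(1) by blast
qed

text \<open>Every equivariant map is a multiple of \<open>hom la\<close> and the Specht module is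
  generated by one polytabloid, so the relabellings of \<open>gen la\<close> span the
  component.\<close>

lemma isotypic_combination:
  assumes la: "la \<in> partitions n" and "f \<in> isotypic n (double la)"
  shows "\<exists>c. f = (\<lambda>m. \<Sum>s\<in>perms (2*n). c s * act_match s (gen la) m)"
  using assms(2) unfolding isotypic_def
proof (induction rule: lin_span_induct)
  case zero
  then show ?case by (intro exI[of _ "\<lambda>_. 0"]) simp
next
  case (step u g c)
  obtain phi v where g: "g = phi v" "equiv_hom n (double la) phi" "v \<in> specht (double la) (2*n)"
    using step by auto
  obtain k where k: "phi v = (\<lambda>m. k * hom la v m)" using hom_multiple[OF la g(2)] g(3) by blast
  obtain b where b: "v = (\<lambda>r. \<Sum>s\<in>perms (2*n). b s * act_tab s (poly la) r)"
    using specht_orbit_combination[OF tab[OF la] g(3)] by blast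
  have "hom la v = (\<lambda>m. \<Sum>s\<in>perms (2*n). b s * hom la (act_tab s (poly la)) m)"
    unfolding b using act_tab_specht[OF poly_specht[OF la]]
    by (intro hom_sum[OF equiv_hom_row_matching_hom] finite_perms) auto
  also have "\<dots> = (\<lambda>m. \<Sum>s\<in>perms (2*n). b s * act_match s (gen la) m)"
    using act_gen[OF la] by simp
  finally have hv: "hom la v = \<dots>" .
  obtain a where a: "u = (\<lambda>m. \<Sum>s\<in>perms (2*n). a s * act_match s (gen la) m)" using step by blast
  show ?case unfolding a g(1) k hv
    by (intro exI[of _ "\<lambda>s. a s + c * (k * b s)"])
      (simp add: distrib_right sum.distrib sum_distrib_left mult.assoc)
qed

lemma isotypic_outside:
  assumes "la \<in> partitions n" "f \<in> isotypic n (double la)" "m \<notin> matchings n" shows "f m = 0"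
proof -
  obtain c where c: "f = (\<lambda>m. \<Sum>s\<in>perms (2*n). c s * act_match s (gen la) m)"
    using isotypic_combination[OF assms(1,2)] by blast
  have "act_match s (gen la) m = 0" if "s permutes {0..<2*n}" for s
    using relabel_matchings_iff[OF permutes_inv[OF that], of m] assms(3)
    by (simp add: act_match_relabel gen_def row_matching_hom_def row_matchings_def)
  then show ?thesis by (simp add: c)
qed

lemma isotypic_orthogonal:
  assumes la: "la \<in> partitions n" and mu: "mu \<in> partitions n" and "la \<noteq> mu"
    and f: "f \<in> isotypic n (double la)" and g: "g \<in> isotypic n (double mu)"
  shows "matching_inner n f g = 0"
proof -
  obtain c where c: "f = (\<lambda>m. \<Sum>s\<in>perms (2*n). c s * act_match s (gen la) m)"
    using isotypic_combination[OF la f] by blast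
  obtain d where d: "g = (\<lambda>m. \<Sum>s\<in>perms (2*n). d s * act_match s (gen mu) m)"
    using isotypic_combination[OF mu g] by blast
  have "double la \<noteq> double mu" using \<open>la \<noteq> mu\<close> by (auto simp: double_def inj_map_eq_map inj_def)
  have "matching_inner n (act_match s (gen la)) (act_match p (gen mu)) = 0"
    if "s permutes {0..<2*n}" "p permutes {0..<2*n}" for s p
    unfolding act_gen[OF la that(1)] act_gen[OF mu that(2)]
    by (rule hom_orthogonal[OF double_partitions[OF la] double_partitions[OF mu] \<open>double la \<noteq> double mu\<close>
          equiv_hom_row_matching_hom equiv_hom_row_matching_hom
          act_tab_specht[OF poly_specht[OF la] that(1)] act_tab_specht[OF poly_specht[OF mu] that(2)]])
  then show ?thesis unfolding c d matching_inner_sum_left matching_inner_sum_right by simp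
qed

text \<open>Following \<open>hom la\<close> by an invariant kernel gives again an equivariant map,
  hence a multiple of \<open>hom la\<close>.\<close>

lemma kernel_op_eigen:
  assumes la: "la \<in> partitions n" and K: "invariant_kernel n K"
  shows "\<exists>b. \<forall>f\<in>isotypic n (double la). kernel_op n K f = (\<lambda>m. b * f m)"
proof -
  obtain b where b: "\<And>u. u \<in> specht (double la) (2*n) \<Longrightarrow> kernel_op n K (hom la u) = (\<lambda>m. b * hom la u m)"
    using hom_multiple[OF la equiv_hom_kernel_op[OF equiv_hom_row_matching_hom K]] by blast
  have "kernel_op n K f = (\<lambda>m. b * f m)" if f: "f \<in> isotypic n (double la)" for f
  proof -
    obtain c where c: "f = (\<lambda>m. \<Sum>s\<in>perms (2*n). c s * act_match s (gen la) m)"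
      using isotypic_combination[OF la f] by blast
    have "kernel_op n K (act_match s (gen la)) = (\<lambda>m. b * act_match s (gen la) m)" if "s \<in> perms (2*n)" for s
      using that act_gen[OF la] b[OF act_tab_specht[OF poly_specht[OF la]]] by auto
    then show ?thesis unfolding c kernel_op_sum by (simp add: sum_distrib_left algebra_simps)
  qed
  then show ?thesis by blast
qed

text \<open>The description in \<open>P\<close> denotes: the eigenvalue exists by
  \<open>kernel_op_eigen\<close> and is unique because the component contains the nonzero vector
  \<open>gen la\<close>.\<close>

lemma assoc_op_P:
  assumes la: "la \<in> partitions n" and f: "f \<in> isotypic n (double la)"
  shows "assoc_op n rho f = (\<lambda>m. P n la rho * f m)"
proof -
  define Q where "Q b \<longleftrightarrow> (\<forall>f\<in>isotypic n (double la). assoc_op n rho f = (\<lambda>m. b * f m))" for b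
  obtain b where b: "Q b"
    using kernel_op_eigen[OF la cycle_kernel_invariant] unfolding assoc_op_kernel_op Q_def by blast
  obtain m where m: "gen la m \<noteq> 0" using gen_nonzero[OF la] by blast
  have "Q (The Q)"
  proof (rule theI[of Q b])
    fix c assume "Q c"
    then have "assoc_op n rho (gen la) = (\<lambda>m. b * gen la m)" "assoc_op n rho (gen la) = (\<lambda>m. c * gen la m)"
      using b gen_isotypic[OF la] unfolding Q_def by blast+
    then have "b * gen la m = c * gen la m" by metis
    then show "c = b" using m by simp
  qed (rule b)
  moreover have "The Q = P n la rho" unfolding P_def Q_def ..
  ultimately show ?thesis using f unfolding Q_def by metis
qed

text \<open>Up to a positive factor, the kernel of the orthogonal projection onto the component of
  \<open>la\<close>.\<close>

definition ker :: "nat list \<Rightarrow> nat set set \<Rightarrow> nat set set \<Rightarrow> real" where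
  "ker la = orbit_kernel n (gen la) (gen la)"

lemma kernel_op_ker:
  assumes la: "la \<in> partitions n"
  shows "kernel_op n (ker la) f = (\<lambda>m. \<Sum>s\<in>perms (2*n). matching_inner n (act_match s (gen la)) f * act_match s (gen la) m)"
proof
  fix m
  show "kernel_op n (ker la) f m = (\<Sum>s\<in>perms (2*n). matching_inner n (act_match s (gen la)) f * act_match s (gen la) m)"
  proof (cases "m \<in> matchings n")
    case True
    then show ?thesis unfolding ker_def by (rule kernel_op_orbit_kernel)
  next
    case False
    then show ?thesis using isotypic_outside[OF la act_gen_isotypic[OF la]] by (simp add: kernel_op_def)
  qed
qed

lemma kernel_op_ker_isotypic: "la \<in> partitions n \<Longrightarrow> kernel_op n (ker la) f \<in> isotypic n (double la)"
  unfolding kernel_op_ker isotypic_def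
  by (intro lin_span_sum finite_perms) (use act_gen_isotypic in \<open>auto simp: isotypic_def\<close>)

lemma kernel_op_ker_gen_other:
  assumes "la \<in> partitions n" "mu \<in> partitions n" "la \<noteq> mu" shows "kernel_op n (ker la) (gen mu) m = 0"
  unfolding kernel_op_ker[OF assms(1)]
  using isotypic_orthogonal[OF assms act_gen_isotypic[OF assms(1)] gen_isotypic[OF assms(2)]] by simp

text \<open>As a sum of squares, this form vanishes exactly when \<open>f\<close> is orthogonal to
  all relabellings of \<open>gen la\<close>. It decides which components of U are zero.\<close>

lemma inner_kernel_op_ker:
  assumes "la \<in> partitions n"
  shows "matching_inner n (kernel_op n (ker la) f) f = (\<Sum>s\<in>perms (2*n). (matching_inner n (act_match s (gen la)) f)\<^sup>2)"
  unfolding kernel_op_ker[OF assms] matching_inner_sum_left by (simp add: power2_eq_square)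

lemma kernel_op_ker_gen:
  assumes la: "la \<in> partitions n"
  shows "\<exists>k>0. kernel_op n (ker la) (gen la) = (\<lambda>m. k * gen la m)"
proof -
  obtain k where k: "kernel_op n (ker la) (gen la) = (\<lambda>m. k * gen la m)"
    using kernel_op_eigen[OF la, of "ker la"] orbit_kernel_invariant gen_isotypic[OF la] unfolding ker_def by blast
  have "0 < (\<Sum>s\<in>perms (2*n). (matching_inner n (act_match s (gen la)) (gen la))\<^sup>2)"
    using gen_inner_pos[OF la] by (intro sum_pos2[of _ id] finite_perms) (auto simp: permutes_id act_match_id)
  then have "0 < k * matching_inner n (gen la) (gen la)"
    unfolding inner_kernel_op_ker[OF la, symmetric] k matching_inner_scale .
  then show ?thesis using k gen_inner_pos[OF la] by (auto simp: zero_less_mult_iff)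
qed

text \<open>The identity together with the kernels of the isotypic components gives one invariant kernel more
  than there are cycle types, and the kernels of the components are independent.\<close>

lemma identity_resolution:
  "\<exists>d. (\<forall>la\<in>partitions n. d la \<noteq> 0) \<and>
     (\<forall>f. (\<forall>m. m \<notin> matchings n \<longrightarrow> f m = 0) \<longrightarrow>
        f = (\<lambda>m. \<Sum>la\<in>partitions n. d la * kernel_op n (ker la) f m))"
proof -
  let ?L = "partitions n"
  let ?J = "insert None (Some ` ?L)"
  define K :: "nat list option \<Rightarrow> nat set set \<Rightarrow> nat set set \<Rightarrow> real"
    where "K j = (case j of None \<Rightarrow> (\<lambda>m m'. if m = m' then 1 else 0) | Some la \<Rightarrow> ker la)" for j
  have Kinv: "invariant_kernel n (K j)" for j
  proof (cases j)
    case None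
    have "relabel s m = relabel s m' \<longleftrightarrow> m = m'" if "s permutes {0..<2*n}" for s m m'
      using relabel_inv[OF that] by metis
    then show ?thesis using None by (simp add: K_def invariant_kernel_def)
  qed (simp add: K_def ker_def orbit_kernel_invariant)
  \<comment> \<open>One equation per partition suffices, since an invariant kernel is determined by
    its values at representatives. Should no pair have type \<open>rho\<close>, the representative
    is arbitrary and merely adds an equation, within the same count.\<close>
  define pr where "pr rho = (SOME p. fst p \<in> matchings n \<and> snd p \<in> matchings n \<and> cycle_type n (fst p) (snd p) = rho)" for rho
  have "card ?L < card ?J" using finite_partitions by (simp add: card_image)
  then obtain c where c: "\<exists>j\<in>?J. c j \<noteq> 0" "\<forall>rho\<in>?L. (\<Sum>j\<in>?J. K j (fst (pr rho)) (snd (pr rho)) * c j) = 0"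
    using homogeneous_system_nontrivial[OF finite_partitions, of ?J n "\<lambda>rho j. K j (fst (pr rho)) (snd (pr rho))"]
      finite_partitions by blast
  have zero: "(\<Sum>j\<in>?J. K j m m' * c j) = 0" if m: "m \<in> matchings n" "m' \<in> matchings n" for m m'
  proof -
    let ?rho = "cycle_type n m m'"
    have pr: "fst (pr ?rho) \<in> matchings n \<and> snd (pr ?rho) \<in> matchings n \<and> cycle_type n (fst (pr ?rho)) (snd (pr ?rho)) = ?rho"
      unfolding pr_def by (rule someI[of _ "(m, m')"]) (use m in simp)
    have "K j m m' = K j (fst (pr ?rho)) (snd (pr ?rho))" for j
      using pr by (intro invariant_kernel_cycle_type[OF Kinv m]) auto
    then show ?thesis using c(2) cycle_type_partitions[OF m] by simp
  qed
  have expand: "c None * f m + (\<Sum>la\<in>?L. c (Some la) * kernel_op n (ker la) f m) = 0" if m: "m \<in> matchings n" for f m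
  proof -
    have "(\<Sum>m'\<in>matchings n. (\<Sum>j\<in>?J. K j m m' * c j) * f m') = 0" using zero[OF m] by simp
    also have "(\<Sum>m'\<in>matchings n. (\<Sum>j\<in>?J. K j m m' * c j) * f m') = (\<Sum>j\<in>?J. c j * (\<Sum>m'\<in>matchings n. K j m m' * f m'))"
      unfolding sum_distrib_right sum_distrib_left by (subst sum.swap) (simp add: mult_ac)
    also have "\<dots> = c None * (\<Sum>m'\<in>matchings n. K None m m' * f m')
        + (\<Sum>la\<in>?L. c (Some la) * (\<Sum>m'\<in>matchings n. K (Some la) m m' * f m'))"
      using finite_partitions by (subst sum.insert) (auto simp: sum.reindex)
    also have "(\<Sum>m'\<in>matchings n. K None m m' * f m') = f m"
    proof -
      have "(\<Sum>m'\<in>matchings n. K None m m' * f m') = (\<Sum>m'\<in>matchings n. if m = m' then f m' else 0)"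
        by (intro sum.cong) (auto simp: K_def)
      then show ?thesis using m finite_matchings by simp
    qed
    finally show ?thesis using m by (simp add: K_def kernel_op_def)
  qed
  \<comment> \<open>Evaluating the relation on \<open>gen la\<close> removes all kernels but the
    identity and that of \<open>la\<close>. This ties every coefficient to \<open>c None\<close>, so
    \<open>c None = 0\<close> would make the relation trivial.\<close>
  have ck: "\<exists>k>0. c None + c (Some la) * k = 0" if la: "la \<in> ?L" for la
  proof -
    obtain k where k: "k > 0" "kernel_op n (ker la) (gen la) = (\<lambda>m. k * gen la m)"
      using kernel_op_ker_gen[OF la] by blast
    obtain m where m: "m \<in> matchings n" "gen la m \<noteq> 0" using gen_nonzero[OF la] by blast
    have "(\<Sum>mu\<in>?L. c (Some mu) * kernel_op n (ker mu) (gen la) m) = c (Some la) * kernel_op n (ker la) (gen la) m"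
      using la finite_partitions kernel_op_ker_gen_other[OF _ la]
      by (subst sum.mono_neutral_right[of _ "{la}"]) auto
    then have "(c None + c (Some la) * k) * gen la m = 0"
      using expand[OF m(1), of "gen la"] k by (simp add: algebra_simps)
    then show ?thesis using m k by auto
  qed
  have c0: "c None \<noteq> 0"
  proof
    assume "c None = 0"
    then have "c (Some la) = 0" if "la \<in> ?L" for la using ck[OF that] by auto
    then show False using c(1) \<open>c None = 0\<close> by auto
  qed
  define d where "d la = - c (Some la) / c None" for la
  have "d la \<noteq> 0" if "la \<in> ?L" for la using ck[OF that] c0 by (auto simp: d_def)
  moreover have "f = (\<lambda>m. \<Sum>la\<in>?L. d la * kernel_op n (ker la) f m)" if f: "\<And>m. m \<notin> matchings n \<Longrightarrow> f m = 0" for f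
  proof
    fix m
    show "f m = (\<Sum>la\<in>?L. d la * kernel_op n (ker la) f m)"
    proof (cases "m \<in> matchings n")
      case True
      have "(\<Sum>la\<in>?L. d la * kernel_op n (ker la) f m) = - (\<Sum>la\<in>?L. c (Some la) * kernel_op n (ker la) f m) / c None"
        by (simp add: d_def sum_divide_distrib sum_negf)
      also have "\<dots> = f m" using expand[OF True, of f] c0 by (simp add: field_simps)
      finally show ?thesis by simp
    qed (use f in \<open>simp add: kernel_op_def\<close>)
  qed
  ultimately show ?thesis by blast
qed

end

section \<open>Fat partitions\<close>

lemma partition_Cons:
  assumes "a # l \<in> partitions n"
  shows "l \<in> partitions (n - a)" "a \<le> n" "a > 0" "\<And>b. b \<in> set l \<Longrightarrow> b \<le> a" "sum_list l = n - a"
  using assms by (auto simp: partitions_def)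

text \<open>A positive entry cannot be below 1, so the list can precede a list of ones only as a
  proper prefix of it.\<close>

lemma sum_list_lexord_replicate:
  assumes "0 \<notin> set l" "(l, replicate k (1::nat)) \<in> lexord {(a, b). a < b}"
  shows "sum_list l < k"
  using assms
proof (induction l arbitrary: k)
  case Nil
  then show ?case by (cases k) auto
next
  case (Cons a l)
  then show ?case by (cases k) auto
qed

text \<open>Among the partitions of \<open>t\<close> the one with all parts 1 is the least, so a
  first part of at least \<open>n - t\<close> is enough to be fat.\<close>

lemma replicate_lexord_partition:
  assumes "l \<in> partitions t" "l \<noteq> replicate t 1"
  shows "(replicate t 1, l) \<in> lexord {(a, b). a < b}"
proof -
  have "\<forall>a b. (a, b) \<in> {(a, b). a < b} \<or> a = b \<or> (b, a) \<in> {(a, b :: nat). a < b}" by auto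
  from lexord_linear[OF this, of l "replicate t 1"] show ?thesis
    using assms sum_list_lexord_replicate[of l t] by (auto simp: partitions_def)
qed

lemma partition_above_hook:
  assumes "la \<in> partitions n" "t < n" "la \<noteq> hook n t" "n - t \<le> la ! 0"
  shows "revlex_less (hook n t) la"
proof -
  obtain a l where la: "la = a # l" using assms(1,2) by (cases la) (auto simp: partitions_def)
  note P = partition_Cons[OF assms(1)[unfolded la]]
  show ?thesis
  proof (cases "a = n - t")
    case True
    then have "l \<in> partitions t" using P(1) assms(2) by simp
    moreover have "l \<noteq> replicate t 1" using assms(3) True la by (simp add: hook_def)
    ultimately show ?thesis using replicate_lexord_partition True la by (simp add: revlex_less_def hook_def)
  next
    case False
    then show ?thesis using assms(4) la by (simp add: revlex_less_def hook_def)
  qed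
qed

text \<open>A partition above the hook has first part at least \<open>n - t > 1\<close>, so all its
  ones lie in the tail, whose sum is at most \<open>t\<close>. With \<open>t\<close> ones the tail
  consists of ones only and the partition is the hook itself.\<close>

lemma many_ones_not_above_hook:
  assumes rho: "rho \<in> partitions n" and t: "0 < t" "2 * t < n" and c: "t \<le> count (mset rho) 1"
  shows "\<not> revlex_less (hook n t) rho"
proof -
  obtain a l where l: "rho = a # l" using rho t by (cases rho) (auto simp: partitions_def)
  note P = partition_Cons[OF rho[unfolded l]]
  show ?thesis
  proof (cases "a = 1")
    case True
    then show ?thesis using t by (auto simp: revlex_less_def hook_def l)
  next
    case False
    then have "t \<le> count (mset l) 1" using c l by simp
    then have "replicate_mset t 1 \<subseteq># mset l" by (simp add: count_le_replicate_mset_subset_eq)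
    then obtain R where R: "mset l = replicate_mset t 1 + R" by (metis subset_mset.le_iff_add)
    have "sum_list l = sum_mset (mset l)" by (simp add: sum_mset_sum_list)
    then have s: "sum_list l = t + sum_mset R" unfolding R by simp
    show ?thesis
    proof
      assume "revlex_less (hook n t) rho"
      then have *: "n - t < a \<or> n - t = a \<and> (replicate t 1, l) \<in> lexord {(a, b). a < b}"
        by (simp add: revlex_less_def hook_def l)
      then have "n - t = a" "(replicate t 1, l) \<in> lexord {(a, b). a < b}" using s P t by auto
      then have "sum_mset R = 0" using s P t by auto
      moreover have "0 \<notin># R"
      proof
        assume "0 \<in># R"
        then have "0 \<in># mset l" unfolding R by simp
        then show False using P(1) by (simp add: partitions_def)
      qed
      ultimately have "R = {#}" by (metis multiset_nonemptyE sum_mset_0_iff)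
      then have "set_mset (mset l) \<subseteq> {1}" "length l = t"
        using R size_mset[of l] by (auto split: if_splits)
      then have "l = replicate t 1" by (metis replicate_length_same set_mset_mset singletonD subsetD)
      then show False using \<open>(replicate t 1, l) \<in> _\<close> lexord_irreflexive[of "{(a, b). a < b}" l] by auto
    qed
  qed
qed

lemma list_le_single_partition: assumes "la \<in> partitions n" shows "la \<le> [n]"
proof (cases la)
  case (Cons a l)
  note P = partition_Cons[OF assms[unfolded Cons]]
  have "l = []" if "a = n" using P(1) that by (cases l) (auto simp: partitions_def)
  then show ?thesis using P(2) Cons by (auto simp: list_le_def list_less_def)
qed (simp add: list_le_def list_less_def)

lemma set_fat_list: "set (fat_list n t) = {mu \<in> partitions n. revlex_less (hook n t) mu}"
  using finite_partitions by (simp add: fat_list_def)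

lemma single_partition: "0 < n \<Longrightarrow> [n] \<in> partitions n" by (simp add: partitions_def)

lemma hook_partition: assumes "t < n" shows "hook n t \<in> partitions n"
proof -
  have "sorted_wrt (\<ge>) (replicate t (1::nat))" by (induction t) auto
  then show ?thesis using assms by (auto simp: partitions_def hook_def sum_list_replicate)
qed

text \<open>Identifies the index 1 of the hypothesis, with right-hand side 1, with the trivial
  component.\<close>

lemma fat_list_hd:
  assumes "0 < t" "t < n" shows "fat_list n t \<noteq> []" "fat_list n t ! 0 = [n]"
proof -
  let ?S = "{mu \<in> partitions n. revlex_less (hook n t) mu}"
  let ?xs = "sorted_list_of_set ?S"
  have "finite ?S" using finite_partitions by simp
  moreover have "[n] \<in> ?S" using assms single_partition by (simp add: revlex_less_def hook_def)
  ultimately have xs: "[n] \<in> set ?xs" by simp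
  then have ne: "?xs \<noteq> []" by auto
  then show "fat_list n t \<noteq> []" by (simp add: fat_list_def)
  obtain k where k: "k < length ?xs" "?xs ! k = [n]" using xs by (auto simp: in_set_conv_nth)
  have "[n] \<le> last ?xs"
    using sorted_nth_mono[of ?xs k "length ?xs - 1"] k ne by (simp add: last_conv_nth)
  moreover have "last ?xs \<in> ?S" using ne last_in_set \<open>finite ?S\<close> set_sorted_list_of_set by metis
  then have "last ?xs \<le> [n]" using list_le_single_partition by blast
  ultimately have "last ?xs = [n]" by simp
  then show "fat_list n t ! 0 = [n]"
    using ne hd_conv_nth[of "rev ?xs"] by (simp add: fat_list_def hd_rev)
qed

text \<open>Each prescribed edge is common to both matchings and is therefore a component of two
  points.\<close>

lemma cycle_type_extensions:
  assumes m: "m \<in> extensions n t" "m' \<in> extensions n t" and "t \<le> n"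
  shows "t \<le> count (mset (cycle_type n m m')) 1"
proof -
  let ?U = "union_components n m m'"
  have M: "m \<in> matchings n" "m' \<in> matchings n" using m by (auto simp: extensions_def)
  interpret A: involution_pair "{0..<2*n}" "partner m" "partner m'"
    using involution_pair_partner[OF M] .
  have comp: "A.comp (2*i) = {2*i, 2*i+1}" if i: "i < t" for i
  proof -
    have p: "partner k (2*i) = 2*i+1 \<and> partner k (2*i+1) = 2*i" if k: "k \<in> extensions n t" for k
    proof -
      have e: "{2*i, 2*i+1} \<in> k" "{2*i+1, 2*i} \<in> k"
        using k i by (auto simp: extensions_def edge_blocks_def insert_commute)
      have kM: "k \<in> matchings n" using k by (simp add: extensions_def)
      have "2*i < 2*n" "2*i+1 < 2*n" using i \<open>t \<le> n\<close> by auto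
      then show ?thesis using e partner_iff[OF kM] by simp
    qed
    have "y \<in> {2*i, 2*i+1}" if "(2*i, y) \<in> A.edges\<^sup>*" for y
      using that by (induction rule: rtrancl_induct) (use p[OF m(1)] p[OF m(2)] in \<open>auto simp: A.edges_def\<close>)
    then have "A.comp (2*i) \<subseteq> {2*i, 2*i+1}" by (auto simp: A.comp_def)
    moreover have "2*i \<in> {0..<2*n}" using i \<open>t \<le> n\<close> by auto
    then have "2*i+1 \<in> A.comp (2*i)" using A.comp_step(1)[of "2*i" "2*i"] p[OF m(1)] by auto
    ultimately show ?thesis by auto
  qed
  have "t = card ((\<lambda>i. {2*i, 2*i+1}) ` {..<t})"
    by (subst card_image) (auto simp: inj_on_def doubleton_eq_iff)
  also have "\<dots> \<le> card {C \<in> ?U. card C div 2 = 1}"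
  proof (intro card_mono)
    show "(\<lambda>i. {2*i, 2*i+1}) ` {..<t} \<subseteq> {C \<in> ?U. card C div 2 = 1}"
    proof
      fix C assume "C \<in> (\<lambda>i. {2*i, 2*i+1}) ` {..<t}"
      then obtain i where i: "i < t" "C = {2*i, 2*i+1}" by auto
      then have "C = A.comp (2*i)" "2*i \<in> {0..<2*n}" using comp \<open>t \<le> n\<close> by auto
      then have "C \<in> ?U" unfolding union_components_comp[OF M] by blast
      moreover have "card C = 2" using i(2) by simp
      ultimately show "C \<in> {C \<in> ?U. card C div 2 = 1}" by simp
    qed
  qed (simp add: finite_union_components)
  also have "\<dots> = count (mset (cycle_type n m m')) 1"
    unfolding mset_cycle_type count_image_mset
    by (subst card_eq_sum, rule sum.cong) (auto simp: finite_union_components)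
  finally show ?thesis .
qed

section \<open>The tabloid behind the fixed edges\<close>

text \<open>The long row takes the free points 2t, ..., 2n-1, and each short row takes one of the
  pairs in \<open>edge_blocks t\<close>.\<close>

definition hook_tableau :: "nat \<Rightarrow> nat \<times> nat \<Rightarrow> nat" where
  "hook_tableau t = (\<lambda>(i, j). if i = 0 then 2*t + j else 2*(i-1) + j)"

lemma cells_double_hook:
  "cells (double (hook n t)) = {(i, j). i = 0 \<and> j < 2*(n-t) \<or> 0 < i \<and> i \<le> t \<and> j < 2}"
  by (auto simp: cells_def double_def hook_def nth_Cons map_replicate split: nat.splits)

lemma hook_tableau: assumes "t < n" shows "hook_tableau t \<in> tableaux (double (hook n t)) (2*n)"
  unfolding tableaux_def cells_double_hook mem_Collect_eq
  by (rule bij_betw_byWitness[where f'="\<lambda>x. if x < 2*t then (x div 2 + 1, x mod 2) else (0, x - 2*t)"])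
    (use assms in \<open>auto simp: hook_tableau_def split: if_splits\<close>)

lemma hook_tabloid:
  assumes "t < n"
  shows "tabloid_of (double (hook n t)) (2*n) (hook_tableau t)
    = (\<lambda>x. if x < 2*t then x div 2 + 1 else 0)"
proof
  fix x
  show "tabloid_of (double (hook n t)) (2*n) (hook_tableau t) x = (if x < 2*t then x div 2 + 1 else 0)"
  proof (cases "x < 2*n")
    case True
    let ?c = "if x < 2*t then (x div 2 + 1, x mod 2) else (0, x - 2*t)"
    have "?c \<in> cells (double (hook n t))" "hook_tableau t ?c = x"
      using True by (auto simp: cells_double_hook hook_tableau_def)
    then have "row_of (double (hook n t)) (hook_tableau t) x = fst ?c"
      using tableau_cell_unique(1)[OF hook_tableau[OF assms], of "fst ?c" "snd ?c" x] by (simp del: fst_conv snd_conv)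
    then show ?thesis using True by (simp add: tabloid_of_row[OF hook_tableau[OF assms]])
  next
    case False
    then show ?thesis using assms by (simp add: tabloid_of_def)
  qed
qed

text \<open>A row of two points forces the edge between them, while the long row imposes no
  condition beyond being matched within itself.\<close>

lemma row_compatible_extensions:
  assumes m: "m \<in> matchings n" and "t \<le> n"
  shows "row_compatible (\<lambda>x. if x < 2*t then x div 2 + 1 else 0) m \<longleftrightarrow> m \<in> extensions n t"
    (is "row_compatible ?r m \<longleftrightarrow> _")
proof
  assume c: "row_compatible ?r m"
  have "{2*i, 2*i+1} \<in> m" if i: "i < t" for i
  proof -
    let ?y = "partner m (2*i)"
    have e: "{2*i, ?y} \<in> m" using partner_edge[OF m, of "2*i"] i \<open>t \<le> n\<close> by auto
    then have "?r (2*i) = ?r ?y" using c[unfolded row_compatible_def, rule_format, OF e, of "2*i" ?y] by simp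
    then have "?y < 2*t" "?y div 2 = i" using i by (auto split: if_splits)
    moreover have "2*i \<noteq> ?y" using matchingsD(3)[OF m e] .
    ultimately have "?y = 2*i+1" by presburger
    then show ?thesis using e by simp
  qed
  then show "m \<in> extensions n t" using m by (auto simp: extensions_def edge_blocks_def)
next
  assume E: "m \<in> extensions n t"
  have small: "x div 2 = y div 2 \<and> y < 2*t" if e: "{x, y} \<in> m" and x: "x < 2*t" for x y
  proof -
    let ?i = "x div 2"
    have "{2*?i, 2*?i+1} \<in> m" using E x by (auto simp: extensions_def edge_blocks_def)
    moreover have "x = 2*?i \<or> x = 2*?i+1" by presburger
    ultimately have "y = 2*?i \<or> y = 2*?i+1"
      using matching_unique[OF m e] by (metis insert_commute)
    moreover have "x div 2 < t" using x by auto
    ultimately show ?thesis by auto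
  qed
  show "row_compatible ?r m"
    unfolding row_compatible_def
  proof (intro ballI)
    fix e x y assume e: "e \<in> m" "x \<in> e" "y \<in> e"
    obtain a b where ab: "e = {a, b}" using matching_edge_cases[OF m e(1)] by metis
    have ba: "{a, b} \<in> m" "{b, a} \<in> m" using e(1) ab by (simp_all add: insert_commute)
    have "?r a = ?r b"
    proof (cases "a < 2*t")
      case True
      then show ?thesis using small[OF ba(1)] by simp
    next
      case False
      then have "\<not> b < 2*t" using small[OF ba(2)] by blast
      then show ?thesis using False by simp
    qed
    moreover have "x = a \<or> x = b" "y = a \<or> y = b" using e ab by auto
    ultimately show "?r x = ?r y" by metis
  qed
qed

lemma partition_entry_le: "mu \<in> partitions N \<Longrightarrow> (i, j) \<in> cells mu \<Longrightarrow> j < mu ! 0"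
  using partition_nth_mono[of mu N 0 i] by (fastforce simp: cells_def)

section \<open>Which components of the indicator vanish\<close>

context tableau_family
begin

text \<open>The set \<open>A\<close> has more points than the shape \<open>double la\<close> has
  columns, so two of its points share a column of the tableau. Their transposition negates the
  polytabloid but fixes \<open>row_matchings n r\<close>, so the inner product is its own
  negative.\<close>

lemma inner_row_matchings_zero:
  assumes la: "la \<in> partitions n" and s: "s permutes {0..<2*n}"
    and A: "A \<subseteq> {0..<2*n}" "\<And>x y. x \<in> A \<Longrightarrow> y \<in> A \<Longrightarrow> r x = r y" "2 * la ! 0 < card A"
  shows "matching_inner n (act_match s (gen la)) (row_matchings n r) = 0"
proof -
  let ?mu = "double la"
  define T where "T = s \<circ> tab la"
  have T: "T \<in> tableaux ?mu (2*n)" unfolding T_def by (rule permuted_tableau[OF tab[OF la] s])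
  define e where "e = polytabloid ?mu (2*n) T"
  have e: "e \<in> specht ?mu (2*n)" unfolding e_def by (rule polytabloid_in_specht[OF T])
  have act: "act_match s (gen la) = hom la e"
    using act_gen[OF la s] polytabloid_permuted[OF tab[OF la] s] by (simp add: e_def T_def)
  have "la \<noteq> []"
  proof
    assume "la = []"
    then have "n = 0" using la by (simp add: partitions_def)
    then show False using A by simp
  qed
  then have "double la ! 0 = 2 * la ! 0" by (simp add: double_def)
  then have "col_of ?mu T ` A \<subseteq> {..<2 * la ! 0}"
    using partition_entry_le[OF double_partitions[OF la] tableau_cell(1)[OF T]] A(1) by fastforce
  then have "\<not> inj_on (col_of ?mu T) A"
    using A(3) card_inj_on_le[of "col_of ?mu T" A "{..<2 * la ! 0}"] by auto
  then obtain x y where xy: "x \<in> A" "y \<in> A" "x \<noteq> y" "col_of ?mu T x = col_of ?mu T y"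
    by (auto simp: inj_on_def)
  let ?t = "transpose x y"
  have tp: "?t permutes {0..<2*n}" using xy A(1) by (intro permutes_swap_id) auto
  have tC: "?t \<in> column_group ?mu (2*n) T"
    using tp xy(4) by (auto simp: column_group_iff[OF T] transpose_def)
  have "act_tab ?t e = (\<lambda>r. (-1) * e r)"
    using act_tab_polytabloid_column[OF T tC] xy(3) by (auto simp: e_def sign_swap_id)
  then have "act_match ?t (hom la e) = (\<lambda>m. (-1) * hom la e m)"
    using hom_act[OF equiv_hom_row_matching_hom tp e] hom_scale[OF equiv_hom_row_matching_hom e] by metis
  moreover have "r \<circ> inv ?t = r" using A(2)[OF xy(1,2)] by (auto simp: transpose_def)
  then have "act_match ?t (row_matchings n r) = row_matchings n r"
    by (simp add: act_match_row_matchings[OF tp])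
  ultimately have "matching_inner n (\<lambda>m. (-1) * hom la e m) (row_matchings n r)
      = matching_inner n (hom la e) (row_matchings n r)"
    using matching_inner_act[OF tp] by metis
  then show ?thesis unfolding act matching_inner_scale by simp
qed

text \<open>\<open>gen la\<close> is a signed sum of relabellings of this indicator. If the
  indicator were orthogonal to all relabellings of \<open>gen la\<close>, then \<open>gen la\<close>
  would be orthogonal to itself.\<close>

lemma inner_row_matchings_nonzero:
  assumes la: "la \<in> partitions n"
  shows "\<exists>s. s permutes {0..<2*n} \<and>
    matching_inner n (act_match s (gen la)) (row_matchings n (tabloid_of (double la) (2*n) (tab la))) \<noteq> 0"
proof (rule ccontr)
  let ?C = "column_group (double la) (2*n) (tab la)"
  let ?u = "row_matchings n (tabloid_of (double la) (2*n) (tab la))"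
  assume "\<not> ?thesis"
  then have z: "matching_inner n (act_match s (gen la)) ?u = 0" if "s permutes {0..<2*n}" for s
    using that by blast
  have "gen la = (\<lambda>m. \<Sum>s\<in>?C. of_int (sign s) * act_match s ?u m)"
    unfolding gen_def by (rule row_matching_hom_polytabloid[OF tab[OF la]])
  then have "matching_inner n (gen la) (gen la) = (\<Sum>s\<in>?C. of_int (sign s) * matching_inner n (gen la) (act_match s ?u))"
    by (subst (2) \<open>gen la = _\<close>) (rule matching_inner_sum_right)
  also have "\<dots> = 0"
  proof (intro sum.neutral ballI)
    fix s assume "s \<in> ?C"
    then have s: "s permutes {0..<2*n}" using column_group_iff[OF tab[OF la]] by blast
    show "of_int (sign s) * matching_inner n (gen la) (act_match s ?u) = 0"
      unfolding matching_inner_act_left[OF s] using z[OF permutes_inv[OF s]] by simp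
  qed
  finally show False using gen_inner_pos[OF la] by simp
qed

text \<open>A tabloid with one row restricts no matching, so the component of \<open>[n]\<close> is
  generated by a nonzero constant function.\<close>

lemma gen_single:
  assumes "0 < n" shows "\<exists>k. k \<noteq> 0 \<and> (\<forall>m\<in>matchings n. gen [n] m = k)"
proof -
  have n: "[n] \<in> partitions n" using assms by (rule single_partition)
  have T: "tab [n] \<in> tableaux (double [n]) (2*n)" by (rule tab[OF n])
  have "tabloid_of (double [n]) (2*n) (tab [n]) = (\<lambda>_. 0)"
  proof
    fix x show "tabloid_of (double [n]) (2*n) (tab [n]) x = 0"
      using tableau_cell(1)[OF T, of x] unfolding tabloid_of_row[OF T] by (simp add: cells_def double_def)
  qed
  then have "act_match s (row_matchings n (tabloid_of (double [n]) (2*n) (tab [n]))) m = 1"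
    if "s permutes {0..<2*n}" "m \<in> matchings n" for s m
    using that by (simp add: act_match_row_matchings[OF that(1)] row_matchings_def row_compatible_def)
  then have "gen [n] m = (\<Sum>s\<in>column_group (double [n]) (2*n) (tab [n]). of_int (sign s))" if "m \<in> matchings n" for m
    using that unfolding gen_def row_matching_hom_polytabloid[OF T] by (simp add: column_group_iff[OF T])
  then show ?thesis using gen_nonzero[OF n] by metis
qed

end

section \<open>The eigenvalue on the hook component\<close>

lemma inner_assoc_op_extensions:
  assumes "0 < t" "2 * t < n" "revlex_less (hook n t) rho" "rho \<in> partitions n"
    and f: "\<And>m. m \<notin> extensions n t \<Longrightarrow> f m = 0"
  shows "matching_inner n (assoc_op n rho f) f = 0"
proof -
  have "assoc_op n rho f m * f m = 0" for m
  proof (cases "m \<in> extensions n t")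
    case True
    have "(if cycle_type n m m' = rho then 1 else 0) * f m' = 0" for m'
    proof (cases "m' \<in> extensions n t")
      case m': True
      have "cycle_type n m m' \<noteq> rho"
        using many_ones_not_above_hook[OF assms(4,1,2)] cycle_type_extensions[OF True m'] assms(2,3) by auto
      then show ?thesis by simp
    qed (simp add: f)
    then have "(\<Sum>m'\<in>matchings n. (if cycle_type n m m' = rho then 1 else 0) * f m') = 0"
      by (intro sum.neutral ballI)
    then show ?thesis by (simp add: assoc_op_def)
  qed (simp add: f)
  then show ?thesis unfolding matching_inner_def by (intro sum.neutral ballI)
qed


theorem mainTheorem6:
  fixes n t :: nat and x :: "nat \<Rightarrow> real"
  assumes "2 * t < n"
    and "\<forall>i\<in>{1..length (fat_list n t)}.
           (\<Sum>j=1..length (fat_list n t). x j * P n (fat_list n t ! (i-1)) (fat_list n t ! (j-1)))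
             = (if i = 1 then 1 else zeta n t)"
  shows "(\<Sum>j=1..length (fat_list n t). x j * P n (hook n t) (fat_list n t ! (j-1))) = zeta n t
       \<and> (\<forall>f\<in>isotypic n (double (hook n t)). \<forall>m.
            (\<Sum>j=1..length (fat_list n t). x j * assoc_op n (fat_list n t ! (j-1)) f m) = zeta n t * f m)"
proof (cases "t = 0")
  case True
  \<comment> \<open>For \<open>t = 0\<close> the hook is \<open>[n]\<close>, the greatest partition,
    so all sums are empty. The product in \<open>zeta\<close> is then the empty product 1, and
    division by zero makes \<open>zeta n 0 = 0\<close>.\<close>
  have "\<not> revlex_less (hook n 0) mu" if "mu \<in> partitions n" for mu
    using that by (cases mu) (auto simp: partitions_def revlex_less_def hook_def)
  then have "set (fat_list n 0) = {}" unfolding set_fat_list by blast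
  then have "fat_list n t = []" using True by simp
  then show ?thesis using True by (simp add: zeta_def)
next
  case False
  then have t: "0 < t" "t < n" "0 < n" using assms(1) by auto
  let ?J = "{1..length (fat_list n t)}" and ?rho = "\<lambda>j. fat_list n t ! (j-1)"
  let ?h = "hook n t" and ?L = "partitions n" and ?ip = "matching_inner n"
  note h = hook_partition[OF t(2)] and n1 = single_partition[OF t(3)]
  define tab where "tab la = (if la = ?h then hook_tableau t else (SOME T. T \<in> tableaux (double la) (2*n)))" for la
  interpret tableau_family n tab
  proof
    fix la assume "la \<in> ?L"
    then show "tab la \<in> tableaux (double la) (2*n)"
      using hook_tableau[OF t(2)] someI_ex[OF tableaux_nonempty[OF double_partitions]] by (simp add: tab_def)
  qed
  define eta where "eta la = (\<Sum>j\<in>?J. x j * P n la (?rho j))" for la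
  define A where "A f m = (\<Sum>j\<in>?J. x j * assoc_op n (?rho j) f m)" for f m
  have rho: "?rho j \<in> ?L" "revlex_less ?h (?rho j)" if "j \<in> ?J" for j
  proof -
    have "?rho j \<in> set (fat_list n t)" using that by (intro nth_mem) auto
    then show "?rho j \<in> ?L" "revlex_less ?h (?rho j)" unfolding set_fat_list by simp_all
  qed
  have A: "A f m = eta la * f m" if "la \<in> ?L" "f \<in> isotypic n (double la)" for la f m
    using assoc_op_P[OF that] by (simp add: A_def eta_def sum_distrib_right mult.assoc)
  have eta1: "eta [n] = 1"
  proof -
    have "1 \<in> ?J" using fat_list_hd(1)[OF t(1,2)] by (simp add: Suc_leI)
    then show ?thesis using assms(2) fat_list_hd(2)[OF t(1,2)] unfolding eta_def by fastforce
  qed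
  have eta_fat: "eta la = zeta n t" if la: "la \<in> ?L" "revlex_less ?h la" "la \<noteq> [n]" for la
  proof -
    obtain k where k: "k < length (fat_list n t)" "fat_list n t ! k = la"
      using la set_fat_list[of n t] by (metis (mono_tags, lifting) in_set_conv_nth mem_Collect_eq)
    then have "Suc k \<in> ?J" by simp
    have "k \<noteq> 0" using k(2) la(3) fat_list_hd(2)[OF t(1,2)] by metis
    then show ?thesis using assms(2)[rule_format, OF \<open>Suc k \<in> ?J\<close>] k by (simp add: eta_def)
  qed
  define r where "r = (\<lambda>x. if x < 2*t then x div 2 + 1 else 0)"
  have r: "tabloid_of (double ?h) (2*n) (tab ?h) = r" using hook_tabloid[OF t(2)] by (simp add: tab_def r_def)
  define U where "U = row_matchings n r"
  have U: "U m = (if m \<in> extensions n t then 1 else 0)" for m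
    using row_compatible_extensions[of m n t] t
    by (auto simp: U_def row_matchings_def r_def[symmetric]) (auto simp: extensions_def)
  obtain d where d: "\<And>la. la \<in> ?L \<Longrightarrow> d la \<noteq> 0"
      "\<And>f. (\<And>m. m \<notin> matchings n \<Longrightarrow> f m = 0) \<Longrightarrow> f = (\<lambda>m. \<Sum>la\<in>?L. d la * kernel_op n (ker la) f m)"
    using identity_resolution by blast
  define u where "u la = kernel_op n (ker la) U" for la
  have Usum: "U = (\<lambda>m. \<Sum>la\<in>?L. d la * u la m)"
    unfolding u_def by (rule d(2)) (simp add: U_def row_matchings_def)
  have u: "u la \<in> isotypic n (double la)" if "la \<in> ?L" for la
    unfolding u_def by (rule kernel_op_ker_isotypic[OF that])
  \<comment> \<open>The contribution of the component of \<open>la\<close> to the squared norm of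
    \<open>U\<close>, since \<open>d la * u la\<close> is the part of \<open>U\<close> in that
    component.\<close>
  define w where "w la = d la * ?ip (u la) U" for la
  have "?ip U U = (\<Sum>la\<in>?L. w la)"
    by (subst (1) Usum) (simp add: matching_inner_sum_left w_def)
  moreover have ipUU: "?ip U U = card (extensions n t)"
  proof -
    have "?ip U U = (\<Sum>m\<in>matchings n. if m \<in> extensions n t then 1 else 0)"
      unfolding matching_inner_def U by (intro sum.cong) auto
    also have "\<dots> = card (extensions n t)"
      using finite_matchings by (simp add: sum.If_cases extensions_def Int_def Collect_conj_eq[symmetric])
    finally show ?thesis .
  qed
  ultimately have wsum: "(\<Sum>la\<in>?L. w la) = card (extensions n t)" by simp
  have "A U = (\<lambda>m. \<Sum>la\<in>?L. d la * (eta la * u la m))"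
  proof
    fix m
    have "A U m = (\<Sum>j\<in>?J. x j * (\<Sum>la\<in>?L. d la * assoc_op n (?rho j) (u la) m))"
      unfolding A_def assoc_op_kernel_op by (subst Usum) (simp only: kernel_op_sum)
    also have "\<dots> = (\<Sum>la\<in>?L. d la * A (u la) m)"
      unfolding A_def sum_distrib_left by (subst sum.swap) (simp add: mult_ac)
    also have "\<dots> = (\<Sum>la\<in>?L. d la * (eta la * u la m))" using A u by simp
    finally show "A U m = (\<Sum>la\<in>?L. d la * (eta la * u la m))" .
  qed
  then have "?ip (A U) U = (\<Sum>la\<in>?L. eta la * w la)"
    by (simp add: matching_inner_sum_left matching_inner_scale w_def mult_ac)
  moreover have "?ip (A U) U = (\<Sum>j\<in>?J. x j * ?ip (assoc_op n (?rho j) U) U)"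
    unfolding A_def by (rule matching_inner_sum_left)
  moreover have "?ip (assoc_op n (?rho j) U) U = 0" if "j \<in> ?J" for j
    by (rule inner_assoc_op_extensions[OF t(1) assms(1) rho(2,1)[OF that]]) (simp add: U)
  ultimately have etaw: "(\<Sum>la\<in>?L. eta la * w la) = 0" by simp
  have w0: "w la = 0" if la: "la \<in> ?L" "la \<noteq> ?h" "\<not> revlex_less ?h la" for la
  proof -
    \<comment> \<open>A partition that is not fat has a short first part: the \<open>2*(n-t)\<close>
      points of the long row, on which \<open>r\<close> is constant, then outnumber the
      \<open>2 * la ! 0\<close> columns.\<close>
    have "la ! 0 < n - t" using partition_above_hook[OF la(1) t(2) la(2)] la(3) by (meson not_le)
    then have "2 * la ! 0 < card {2*t..<2*n}" by simp
    then have "?ip (act_match s (gen la)) U = 0" if "s permutes {0..<2*n}" for s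
      unfolding U_def using that by (intro inner_row_matchings_zero[OF la(1), where A="{2*t..<2*n}"]) (auto simp: r_def)
    then show ?thesis unfolding w_def u_def inner_kernel_op_ker[OF la(1)] by simp
  qed
  have wh: "w ?h \<noteq> 0"
  proof -
    obtain s where s: "s permutes {0..<2*n}" "?ip (act_match s (gen ?h)) U \<noteq> 0"
      using inner_row_matchings_nonzero[OF h] unfolding r U_def by blast
    then have "0 < (\<Sum>s\<in>perms (2*n). (?ip (act_match s (gen ?h)) U)\<^sup>2)"
      by (intro sum_pos2[of _ s] finite_perms) auto
    then show ?thesis unfolding w_def u_def inner_kernel_op_ker[OF h] using d(1)[OF h] by simp
  qed
  let ?D = "\<Prod>k\<in>{1..t}. real (2*n - 2*k + 1)"
  have card: "real (card (matchings n)) = ?D * real (card (extensions n t))"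
    using card_matchings_extensions t by simp
  have w1: "?D * w [n] = card (extensions n t)"
  proof -
    obtain k where k: "k \<noteq> 0" "\<And>m. m \<in> matchings n \<Longrightarrow> gen [n] m = k" using gen_single[OF t(3)] by blast
    obtain c where c: "u [n] = (\<lambda>m. \<Sum>s\<in>perms (2*n). c s * act_match s (gen [n]) m)"
      using isotypic_combination[OF n1 u[OF n1]] by blast
    \<comment> \<open>The constant value on matchings of the trivial component of \<open>U\<close>.
      Pairing \<open>U\<close> with the constants shows that it is the proportion of matchings that
      contain the fixed edges.\<close>
    define q where "q = d [n] * (\<Sum>s\<in>perms (2*n). c s * k)"
    have q: "d [n] * u [n] m = q" if m: "m \<in> matchings n" for m
    proof -
      have "act_match s (gen [n]) m = k" if "s \<in> perms (2*n)" for s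
        using k(2) relabel_matchings[OF permutes_inv m] that by (simp add: act_match_relabel)
      then have "u [n] m = (\<Sum>s\<in>perms (2*n). c s * k)" unfolding c by (intro sum.cong) auto
      then show ?thesis by (simp add: q_def)
    qed
    have ipg: "?ip f (gen [n]) = k * (\<Sum>m\<in>matchings n. f m)" for f
      using k(2) by (simp add: matching_inner_def sum_distrib_left mult.commute)
    have sumU: "(\<Sum>m\<in>matchings n. U m) = card (extensions n t)"
      using ipUU unfolding matching_inner_def by (simp add: U if_distrib cong: if_cong)
    have "k * card (extensions n t) = ?ip U (gen [n])" by (simp add: ipg sumU)
    also have "\<dots> = (\<Sum>la\<in>?L. d la * ?ip (u la) (gen [n]))"
      by (subst Usum) (rule matching_inner_sum_left)
    also have "\<dots> = (\<Sum>la\<in>{[n]}. d la * ?ip (u la) (gen [n]))"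
      using n1 finite_partitions isotypic_orthogonal[OF _ n1 _ u gen_isotypic[OF n1]]
      by (intro sum.mono_neutral_right) auto
    also have "\<dots> = k * (\<Sum>m\<in>matchings n. d [n] * u [n] m)" by (simp add: ipg sum_distrib_left mult_ac)
    also have "\<dots> = k * (q * card (matchings n))" using q by simp
    finally have "q * card (matchings n) = card (extensions n t)" using k(1) by simp
    moreover have "w [n] = q * card (extensions n t)"
    proof -
      have "w [n] = (\<Sum>m\<in>matchings n. d [n] * u [n] m * U m)"
        by (simp add: w_def matching_inner_def sum_distrib_left mult_ac)
      also have "\<dots> = (\<Sum>m\<in>matchings n. q * U m)" using q by (intro sum.cong) auto
      finally show ?thesis by (simp add: sum_distrib_left[symmetric] sumU)
    qed
    ultimately show ?thesis unfolding card by (simp add: mult_ac)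
  qed
  have D: "?D > 1"
  proof -
    have f: "1 < real (2*n - 2*k + 1)" if "k \<in> {1..t}" for k using that t by auto
    have "(\<Prod>k\<in>{1..t}. 1) < ?D"
      using f t by (intro prod_mono_strict[of 1]) (auto intro: less_imp_le)
    then show ?thesis by simp
  qed
  have hn: "?h \<noteq> [n]" using t by (simp add: hook_def)
  \<comment> \<open>Shifting all eigenvalues by zeta removes every fat partition other than
    \<open>[n]\<close> and the hook; the remaining partitions have weight zero.\<close>
  have "(\<Sum>la\<in>?L. (eta la - zeta n t) * w la) = - (zeta n t * card (extensions n t))"
    using etaw wsum by (simp add: left_diff_distrib sum_subtractf sum_distrib_left[symmetric])
  moreover have "(\<Sum>la\<in>?L. (eta la - zeta n t) * w la) = (\<Sum>la\<in>{[n], ?h}. (eta la - zeta n t) * w la)"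
    using n1 h finite_partitions w0 eta_fat by (intro sum.mono_neutral_right) auto
  ultimately have "- (zeta n t * card (extensions n t)) = (1 - zeta n t) * w [n] + (eta ?h - zeta n t) * w ?h"
    using hn eta1 by simp
  \<comment> \<open>This is the choice of zeta: with \<open>?D * w [n]\<close> in place of the
    cardinality it reads 1 - zeta = - zeta D, and \<open>?D > 1\<close> keeps the denominator D - 1
    nonzero.\<close>
  moreover have "- (zeta n t * card (extensions n t)) = (1 - zeta n t) * w [n]"
    using D unfolding zeta_def w1[symmetric] by (simp add: field_simps)
  ultimately have eta_h: "eta ?h = zeta n t" using wh by simp
  show ?thesis
  proof (intro conjI ballI allI)
    show "(\<Sum>j=1..length (fat_list n t). x j * P n ?h (?rho j)) = zeta n t"
      using eta_h by (simp add: eta_def)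
    fix f m assume "f \<in> isotypic n (double ?h)"
    then show "(\<Sum>j=1..length (fat_list n t). x j * assoc_op n (?rho j) f m) = zeta n t * f m"
      using A[OF h] eta_h by (simp add: A_def)
  qed
qed

end
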